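(* Let $X$ be a subordinator with drift $\delta>0$ and Lévy measure $\Pi$ with $\beta(\Pi)<1$, and let $q\ge0$. For every integer $N\ge1$ and every fixed $\lambda>0$, the function $$g^{N,q}(\lambda+i\theta)=\frac{\big(-\mathcal L(\bar\Pi+q)(\lambda+i\theta)\big)^N}{(\lambda+i\theta)\,\delta^{N+1}\big(1+\frac1\delta\mathcal L(\bar\Pi+q)(\lambda+i\theta)\big)}$$ is well defined and absolutely integrable in $\theta\in\mathbb{R}$, and for all $x>0$ $$u^{(q)}(x)=\sum_{n=0}^{N-1}\frac{(-1)^n}{\delta^{n+1}}\,\mathbf 1\ast(\bar\Pi+q)^{\ast n}(x)+e^{\lambda x}\frac1{2\pi}\int_{-\infty}^{\infty}e^{i\theta x}g^{N,q}(\lambda+i\theta)\,d\theta .$$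
   Context: A subordinator is a Lévy process $X=(X_t)_{t\ge0}$ with $X_0=0$ and almost surely non-decreasing paths; $X_t=\delta t+\sum_{s\le t}\Delta_s$ with drift $\delta$ and jumps $\Delta_s$ governed by a Poisson random measure with Lévy measure $\Pi$, a measure on $(0,\infty)$ with $\int_0^\infty(1\wedge x)\,\Pi(dx)<\infty$. The tail of $\Pi$ is $\bar\Pi(x)=\Pi([x,\infty))$ for $x>0$. The Blumenthal–Getoor index is $\beta(\Pi)=\inf\{\gamma>0:\int_0^1x^\gamma\,\Pi(dx)<\infty\}$. For $q\ge0$ the $q$-potential measure is $U^{(q)}(dx)=\mathbb{E}\left[\int_0^\infty e^{-qt}\mathbf 1_{\{X_t\in dx\}}\,dt\right]$. When $\delta>0$ it has a bounded continuous density with respect to Lebesgue measure, denoted $u^{(q)}$. Functions are extended by $0$ to $(-\infty,0]$, so the (bilateral) Laplace transform is $\mathcal L(\bar\Pi+q)(s)=\int_0^\infty e^{-sx}(\bar\Pi(x)+q)\,dx$ for $s=\lambda+i\theta$. Convolution: $f\ast g(x)=\int_0^xf(x-y)g(y)\,dy$; $f^{\ast n}$ is the $n$-fold convolution; $\mathbf 1$ is the Heaviside function (equal to $1$ on $(0,\infty)$), with the convention $\mathbf 1\ast f^{\ast0}(x)=1$. *)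

theory Defs
  imports "HOL-Probability.Probability"
begin

text \<open>Processes are indexed by \<^typ>\<open>real\<close>; only times \<open>t \<ge> 0\<close> are relevant.\<close>

definition levy_process :: "'a measure \<Rightarrow> (real \<Rightarrow> 'a \<Rightarrow> real) \<Rightarrow> bool" where
  "levy_process M X \<longleftrightarrow>
     prob_space M \<and>
     (\<forall>t\<ge>0. X t \<in> borel_measurable M) \<and>
     (AE \<omega> in M. X 0 \<omega> = 0) \<and>
     (AE \<omega> in M. (\<forall>t\<ge>0. ((\<lambda>s. X s \<omega>) \<longlongrightarrow> X t \<omega>) (at_right t)) \<and>
                 (\<forall>t>0. \<exists>l. ((\<lambda>s. X s \<omega>) \<longlongrightarrow> l) (at_left t))) \<and>
     (\<forall>s t. 0 \<le> s \<longrightarrow> s \<le> t \<longrightarrow>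
        distr M borel (\<lambda>\<omega>. X t \<omega> - X s \<omega>) = distr M borel (X (t - s))) \<and>
     (\<forall>\<tau> :: nat \<Rightarrow> real. 0 \<le> \<tau> 0 \<longrightarrow> mono \<tau> \<longrightarrow>
        (\<forall>n. prob_space.indep_vars M (\<lambda>_. borel)
               (\<lambda>i \<omega>. X (\<tau> (Suc i)) \<omega> - X (\<tau> i) \<omega>) {..<n}))"

definition subordinator :: "'a measure \<Rightarrow> (real \<Rightarrow> 'a \<Rightarrow> real) \<Rightarrow> bool" where
  "subordinator M X \<longleftrightarrow>
     levy_process M X \<and>
     (AE \<omega> in M. \<forall>s t. 0 \<le> s \<longrightarrow> s \<le> t \<longrightarrow> X s \<omega> \<le> X t \<omega>)"

text \<open>A measure on \<open>(0, \<infinity>)\<close> is represented by a Borel measure on the line that does not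
  charge \<open>(-\<infinity>, 0]\<close>.\<close>

definition levy_measure :: "real measure \<Rightarrow> bool" where
  "levy_measure \<nu> \<longleftrightarrow>
     sets \<nu> = sets borel \<and> emeasure \<nu> {..0} = 0 \<and>
     (\<integral>\<^sup>+x. ennreal (min 1 x) \<partial>\<nu>) < \<infinity>"

definition blumenthal_getoor :: "real measure \<Rightarrow> real" where
  "blumenthal_getoor \<nu> =
     Inf {\<gamma>. \<gamma> > 0 \<and> (\<integral>\<^sup>+x\<in>{0<..1}. ennreal (x powr \<gamma>) \<partial>\<nu>) < \<infinity>}"

text \<open>The Poisson probabilities are written out because \<^const>\<open>poisson_pmf\<close> is only specified
  for positive rates, whereas sets of intensity \<open>0\<close> must be allowed here.\<close>

definition poisson_random_measure ::
    "'a measure \<Rightarrow> 'b measure \<Rightarrow> ('a \<Rightarrow> 'b measure) \<Rightarrow> bool" where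
  "poisson_random_measure M \<mu> N \<longleftrightarrow>
     (\<forall>\<omega>\<in>space M. sets (N \<omega>) = sets \<mu>) \<and>
     (\<forall>A\<in>sets \<mu>. (\<lambda>\<omega>. emeasure (N \<omega>) A) \<in> borel_measurable M) \<and>
     (\<forall>A\<in>sets \<mu>. emeasure \<mu> A < \<infinity> \<longrightarrow>
        (\<forall>k::nat. measure M {\<omega>\<in>space M. emeasure (N \<omega>) A = of_nat k} =
           exp (- measure \<mu> A) * measure \<mu> A ^ k / fact k)) \<and>
     (\<forall>A\<in>sets \<mu>. emeasure \<mu> A = \<infinity> \<longrightarrow> (AE \<omega> in M. emeasure (N \<omega>) A = \<infinity>)) \<and>
     (\<forall>A :: nat \<Rightarrow> 'b set. range A \<subseteq> sets \<mu> \<longrightarrow> disjoint_family A \<longrightarrow>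
        prob_space.indep_vars M (\<lambda>_. borel) (\<lambda>i \<omega>. emeasure (N \<omega>) (A i)) UNIV)"

definition jump :: "(real \<Rightarrow> real) \<Rightarrow> real \<Rightarrow> real" where
  "jump w s = w s - Lim (at_left s) w"

text \<open>The counting measure of the points \<open>(s, \<Delta>\<^sub>s)\<close> over the jump times \<open>s > 0\<close> of a path.\<close>

definition jump_measure :: "(real \<Rightarrow> real) \<Rightarrow> (real \<times> real) measure" where
  "jump_measure w =
     distr (count_space {s. 0 < s \<and> jump w s \<noteq> 0}) (borel \<Otimes>\<^sub>M borel) (\<lambda>s. (s, jump w s))"

text \<open>\<open>X\<^sub>t = \<delta> t + (\<Sum>s\<le>t. \<Delta>\<^sub>s)\<close>, the jumps forming a Poisson random measure with intensity
  \<open>ds \<otimes> \<nu>(dx)\<close>. The random measure \<open>N\<close> is only required to agree almost surely with the jump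
  measure, since the paths are regular only almost surely and \<open>M\<close> need not be complete.\<close>

definition has_drift_and_levy_measure ::
    "'a measure \<Rightarrow> (real \<Rightarrow> 'a \<Rightarrow> real) \<Rightarrow> real \<Rightarrow> real measure \<Rightarrow> bool" where
  "has_drift_and_levy_measure M X \<delta> \<nu> \<longleftrightarrow>
     levy_measure \<nu> \<and>
     (\<exists>N. poisson_random_measure M (density lborel (indicator {0<..}) \<Otimes>\<^sub>M \<nu>) N \<and>
          (AE \<omega> in M. N \<omega> = jump_measure (\<lambda>t. X t \<omega>))) \<and>
     (AE \<omega> in M. \<forall>t\<ge>0. (jump (\<lambda>s. X s \<omega>) has_sum (X t \<omega> - \<delta> * t)) {0<..t})"

definition potential_measure ::
    "'a measure \<Rightarrow> (real \<Rightarrow> 'a \<Rightarrow> real) \<Rightarrow> real \<Rightarrow> real measure" where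
  "potential_measure M X q =
     measure_of UNIV (sets borel)
       (\<lambda>B. \<integral>\<^sup>+\<omega>. (\<integral>\<^sup>+t\<in>{0..}. ennreal (exp (- q * t)) * indicator B (X t \<omega>) \<partial>lborel) \<partial>M)"

text \<open>The bounded density that is continuous on \<open>(0, \<infinity>)\<close> and extended by \<open>0\<close> to \<open>(-\<infinity>, 0]\<close>.
  Since \<^const>\<open>ennreal\<close> truncates negative values, nonnegativity has to be required for
  uniqueness.\<close>

definition potential_density ::
    "'a measure \<Rightarrow> (real \<Rightarrow> 'a \<Rightarrow> real) \<Rightarrow> real \<Rightarrow> real \<Rightarrow> real" where
  "potential_density M X q =
     (THE u. (\<forall>x\<le>0. u x = 0) \<and> (\<forall>x. 0 \<le> u x) \<and> continuous_on {0<..} u \<and> bounded (range u) \<and>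
             potential_measure M X q = density lborel (\<lambda>x. ennreal (u x)))"

text \<open>The function \<open>x \<mapsto> \<nu>([x, \<infinity>)) + q\<close> on \<open>(0, \<infinity>)\<close>, extended by \<open>0\<close>.\<close>

definition tail_plus :: "real measure \<Rightarrow> real \<Rightarrow> real \<Rightarrow> real" where
  "tail_plus \<nu> q x = (if x > 0 then measure \<nu> {x..} + q else 0)"

definition laplace :: "(real \<Rightarrow> real) \<Rightarrow> complex \<Rightarrow> complex" where
  "laplace f s = (LINT x:{0<..}|lborel. exp (- s * of_real x) * of_real (f x))"

definition heaviside :: "real \<Rightarrow> real" where
  "heaviside x = (if x > 0 then 1 else 0)"

definition convol :: "(real \<Rightarrow> real) \<Rightarrow> (real \<Rightarrow> real) \<Rightarrow> real \<Rightarrow> real" where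
  "convol f g x = (LINT y:{0<..<x}|lborel. f (x - y) * g y)"

text \<open>The \<open>n\<close>-fold convolution, for \<open>n \<ge> 1\<close> only; the case \<open>n = 0\<close> is covered by the
  convention \<open>1 * f\<^sup>*\<^sup>0 = 1\<close> in the next definition.\<close>

definition convol_power :: "(real \<Rightarrow> real) \<Rightarrow> nat \<Rightarrow> real \<Rightarrow> real" where
  "convol_power f n = ((\<lambda>h. convol h f) ^^ (n - 1)) f"

definition heaviside_convol_power :: "(real \<Rightarrow> real) \<Rightarrow> nat \<Rightarrow> real \<Rightarrow> real" where
  "heaviside_convol_power f n x =
     (if n = 0 then 1 else convol heaviside (convol_power f n) x)"

definition remainder_transform ::
    "real measure \<Rightarrow> real \<Rightarrow> nat \<Rightarrow> real \<Rightarrow> complex \<Rightarrow> complex" where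
  "remainder_transform \<nu> \<delta> N q s =
     (- laplace (tail_plus \<nu> q) s) ^ N /
     (s * of_real \<delta> ^ (N + 1) * (1 + 1 / of_real \<delta> * laplace (tail_plus \<nu> q) s))"

end

theory Submission
  imports Defs
begin

text \<open>
  Write \<open>f\<close> for the tail plus \<open>q\<close>, \<open>L\<close> for its Laplace transform and \<open>\<Phi>\<close> for the Laplace exponent
  of \<open>X\<close>. Integration by parts against the Levy measure turns the exponent into
  \<open>q + \<Phi>(s) = s (\<delta> + L(s))\<close>, and by the Levy-Khintchine formula the potential measure has the transform
  \<open>1 / (q + \<Phi>(s)) = 1 / (s (\<delta> + L(s)))\<close>. Expanding \<open>1 / (\<delta> + L)\<close> as a geometric series with remainder
  gives, for every \<open>N\<close>,
  \<open>1 / (s (\<delta> + L)) = (\<Sum>n<N. (-1)^n L^n / (s \<delta>^(n+1))) + g^N(s)\<close>.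
  The \<open>n\<close>-th term is the transform of \<open>1 * f^(*n)\<close> up to its constant, so the theorem is this identity
  after inversion along the line \<open>Re s = l\<close>. What makes the inversion legitimate is the hypothesis on
  the index: choosing \<open>\<gamma> < 1\<close> with \<open>\<integral>x^\<gamma> < \<infinity>\<close> near \<open>0\<close> yields \<open>L(s) = O(|s|^(\<gamma>-1))\<close>, hence
  \<open>L^n / s\<close> and \<open>g^n\<close> are \<open>O(|s|^(\<gamma>-2))\<close> for \<open>n \<ge> 1\<close> and absolutely integrable on the line. Only the
  leading term \<open>1 / (\<delta> s)\<close> is not, and it belongs to Lebesgue measure on the half-line.

  The inversion used throughout (\<open>fourier_inversion_difference\<close>) is for a difference of two finite
  measures: if the difference of their Fourier transforms is integrable, then the difference of the
  measures has the inverse transform as a continuous density. It is applied to the exponentially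
  weighted potential measure minus \<open>e^(-l x) dx / \<delta>\<close>, which produces the continuous density and the
  case \<open>N = 1\<close> together (\<open>potential_density_inversion\<close>), and to the weighted functions \<open>1 * f^(*n)\<close>
  (\<open>laplace_inversion_pointwise\<close>), which turns the step from \<open>N\<close> to \<open>N + 1\<close> into
  \<open>g^N - g^(N+1) = (-L)^N / (s \<delta>^(N+1))\<close>.

  Three facts about the process enter. The Laplace functional of a Poisson random measure
  (\<open>poisson_laplace_functional\<close>), applied to the jumps up to time \<open>t\<close>, gives
  \<open>E e^(-s X_t) = e^(-t \<Phi>(s))\<close> for complex \<open>s\<close>. Replacing the paths on a null set by a pure drift gives
  a version measurable in time and chance, without which the potential measure could not be handled
  by Fubini. Finally every path increases at rate at least \<open>\<delta>\<close>, so it spends time at most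
  \<open>(b - a) / \<delta>\<close> in \<open>(a, b]\<close>; this bounds the density by \<open>1 / \<delta>\<close>, which the inversion formula, growing
  like \<open>e^(l x)\<close>, does not show.
\<close>

section \<open>Fourier inversion for finite measures\<close>

text \<open>Normalising to total mass \<open>1\<close> reduces this to the inversion theorem for distributions; the zero
  measure has to be treated apart.\<close>

lemma finite_measure_Levy_Inversion:
  fixes M :: "real measure"
  assumes fin: "finite_measure M" and sets: "sets M = sets borel"
    and "a \<le> b" "measure M {a} = 0" "measure M {b} = 0"
  shows "(\<lambda>T::nat. 1 / (2 * pi) * (CLBINT t=-T..T. (iexp (-(t * a)) - iexp (-(t * b))) / (\<i> * t) * char M t))
    \<longlonglongrightarrow> of_real (measure M {a<..b})"
proof -
  interpret finite_measure M by fact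
  define m where "m = measure M UNIV"
  have space: "space M = UNIV" using sets_eq_imp_space_eq[OF sets] by simp
  note [measurable_cong] = sets
  show ?thesis
  proof (cases "m = 0")
    case True
    then have "emeasure M (space M) = 0" by (simp add: emeasure_eq_measure space m_def)
    then have ae: "AE x in M. False"
      by (simp add: AE_iff_null space null_sets_def sets)
    have "char M t = 0" for t
      unfolding char_def using ae by (intro integral_eq_zero_AE) auto
    moreover have "measure M {a<..b} = 0"
      using True by (intro antisym order.trans[OF finite_measure_mono[of "{a<..b}" UNIV]]) (auto simp: m_def sets)
    ultimately show ?thesis by simp
  next
    case False
    then have m: "m > 0" by (simp add: m_def zero_less_measure_iff)
    define P where "P = density M (\<lambda>_. ennreal (1 / m))"
    have P_meas: "measure P A = measure M A / m" if "A \<in> sets borel" for A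
      unfolding P_def using that m by (subst measure_density_const) (auto simp: sets)
    have "emeasure P (space P) = 1"
      using m by (simp add: P_def emeasure_density_const sets space emeasure_eq_measure m_def
          flip: ennreal_mult)
    then have "prob_space P" by (rule prob_spaceI)
    then interpret P: real_distribution P
      by (simp add: real_distribution_def real_distribution_axioms_def P_def sets)
    have char: "char P t = char M t / m" for t
      unfolding char_def P_def using m
      by (subst integral_density) (auto simp: scaleR_conv_of_real divide_inverse mult.commute)
    have "(\<lambda>T::nat. of_real m * (1 / (2 * pi) * (CLBINT t=-T..T. (iexp (-(t * a)) - iexp (-(t * b))) / (\<i> * t) * char P t)))
        \<longlonglongrightarrow> of_real m * of_real (measure P {a<..b})"
      using assms by (intro tendsto_mult_left P.Levy_Inversion) (auto simp: P_meas)
    moreover have "(CLBINT t=-T..T. (iexp (-(t * a)) - iexp (-(t * b))) / (\<i> * t) * char P t)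
       = (CLBINT t=-T..T. (iexp (-(t * a)) - iexp (-(t * b))) / (\<i> * t) * char M t) / m" for T :: nat
      unfolding char times_divide_eq_right by (rule interval_lebesgue_integral_divide)
    ultimately show ?thesis using m by (simp add: P_meas)
  qed
qed

lemma integral_exp_Ioc:
  fixes a b t :: real
  assumes "a \<le> b" "t \<noteq> 0"
  shows "(CLBINT x:{a<..b}. iexp (- (t * x))) = (iexp (-(t * a)) - iexp (-(t * b))) / (\<i> * t)"
proof -
  have "(CLBINT x=a..b. iexp (- (t * x))) = (- iexp (- (t * b)) / (\<i> * t)) - (- iexp (- (t * a)) / (\<i> * t))"
    using assms
    by (intro interval_integral_FTC_finite[where F = "\<lambda>x. - iexp (- (t * x)) / (\<i> * t)"])
       (auto intro!: derivative_eq_intros continuous_intros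
         has_vector_derivative_real_field simp: field_simps)
  then show ?thesis using assms by (simp add: interval_integral_Ioc diff_divide_distrib)
qed

lemma continuous_inverse_fourier:
  fixes G :: "real \<Rightarrow> complex"
  assumes [measurable]: "integrable lborel G"
  shows "continuous_on UNIV (\<lambda>x. CLBINT \<theta>. iexp (\<theta> * x) * G \<theta>)"
proof -
  have "isCont (\<lambda>x. CLBINT \<theta>. iexp (\<theta> * x) * G \<theta>) x" for x
    unfolding continuous_at_sequentially comp_def
  proof safe
    fix u assume u: "u \<longlonglongrightarrow> x"
    show "(\<lambda>n. CLBINT \<theta>. iexp (\<theta> * u n) * G \<theta>) \<longlonglongrightarrow> (CLBINT \<theta>. iexp (\<theta> * x) * G \<theta>)"
    proof (rule integral_dominated_convergence[where w = "\<lambda>\<theta>. norm (G \<theta>)"])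
      show "AE \<theta> in lborel. (\<lambda>n. iexp (\<theta> * u n) * G \<theta>) \<longlonglongrightarrow> iexp (\<theta> * x) * G \<theta>"
        using u by (intro AE_I2 tendsto_intros)
    qed (use assms in \<open>auto simp: norm_mult\<close>)
  qed
  then show ?thesis by (simp add: continuous_on_eq_continuous_at)
qed

lemma cmod_char_le:
  assumes "finite_measure M" "sets M = sets borel"
  shows "norm (char M t) \<le> measure M UNIV"
proof -
  interpret finite_measure M by fact
  have space: "space M = UNIV" using sets_eq_imp_space_eq[OF assms(2)] by simp
  note [measurable_cong] = assms(2)
  have "norm (char M t) \<le> (\<integral>x. norm (iexp (t * x)) \<partial>M)"
    unfolding char_def by (intro integral_norm_bound)
  also have "\<dots> = measure M UNIV" by (simp add: space flip: of_real_mult)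
  finally show ?thesis .
qed

lemma char_borel_measurable:
  assumes "finite_measure M" "sets M = sets borel"
  shows "char M \<in> borel_measurable borel"
proof -
  interpret finite_measure M by fact
  note [measurable_cong] = assms(2)
  show ?thesis unfolding char_def by measurable
qed

text \<open>Neither of the two transforms need be integrable, so Levy's formula is only available as a limit of
  integrals over \<open>[-T, T]\<close>. For the difference that limit is an absolutely convergent integral, and
  writing the kernel as \<open>\<integral>e^(-itx) dx\<close> over \<open>(a, b]\<close> and exchanging the integrals exhibits a density.
  Excluding atoms makes every \<open>a\<close> and \<open>b\<close> admissible end points.\<close>

lemma fourier_inversion_difference:
  fixes M1 M2 :: "real measure"
  assumes M1: "finite_measure M1" "sets M1 = sets borel" "\<And>x. measure M1 {x} = 0"
    and M2: "finite_measure M2" "sets M2 = sets borel" "\<And>x. measure M2 {x} = 0"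
    and G: "\<And>\<theta>. G \<theta> = (CLINT x|M1. iexp (- (\<theta> * x))) - (CLINT x|M2. iexp (- (\<theta> * x)))"
    and int: "integrable lborel G"
    and ab: "a \<le> b"
  shows "complex_of_real (measure M1 {a<..b} - measure M2 {a<..b}) =
    (CLBINT x:{a<..b}. (1 / (2 * pi)) * (CLBINT \<theta>. iexp (\<theta> * x) * G \<theta>))"
proof -
  interpret M1: finite_measure M1 by fact
  interpret M2: finite_measure M2 by fact
  define D where "D t = char M1 t - char M2 t" for t
  have DG: "D t = G (- t)" for t by (simp add: D_def G char_def)
  have intD: "integrable lborel D"
    using lborel_integrable_real_affine_iff[of "-1" G 0] int by (simp add: DG[abs_def])
  have [measurable]: "D \<in> borel_measurable borel" using intD by auto
  define K where "K t = (iexp (-(t * a)) - iexp (-(t * b))) / (\<i> * complex_of_real t)" for t :: real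
  have [measurable]: "K \<in> borel_measurable borel" unfolding K_def by measurable
  have Kle: "norm (K t) \<le> b - a" for t
  proof (cases "t = 0")
    case False
    then show ?thesis
      using Levy_Inversion_aux2[of "-b" "-a" t] ab by (simp add: K_def)
  qed (use ab in \<open>simp add: K_def\<close>)
  have intK: "interval_lebesgue_integrable lborel (-ereal (real T)) (ereal (real T)) (\<lambda>t. K t * char M t)"
    if "finite_measure M" "sets M = sets borel" for M and T :: nat
  proof -
    note [measurable] = char_borel_measurable[OF that]
    have "set_integrable lborel {-real T<..<real T} (\<lambda>t. K t * char M t)"
      unfolding set_integrable_def
    proof (rule Bochner_Integration.integrable_bound)
      show "integrable lborel (\<lambda>t. indicator {-real T<..<real T} t * ((b - a) * measure M UNIV))"
        by (intro integrable_mult_left) simp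
      show "AE t in lborel. norm (indicator {-real T<..<real T} t *\<^sub>R (K t * char M t))
         \<le> norm (indicator {-real T<..<real T} t * ((b - a) * measure M UNIV))"
        using Kle cmod_char_le[OF that] ab
        by (auto simp: norm_mult simp del: of_real_mult split: split_indicator intro!: AE_I2 mult_mono)
    qed measurable
    then show ?thesis
      by (simp add: interval_lebesgue_integrable_def einterval_eq)
  qed
  have "(\<lambda>T::nat. 1 / (2 * pi) * (CLBINT t=-T..T. K t * char M1 t) - 1 / (2 * pi) * (CLBINT t=-T..T. K t * char M2 t))
     \<longlonglongrightarrow> of_real (measure M1 {a<..b}) - of_real (measure M2 {a<..b})"
    unfolding K_def by (intro tendsto_diff finite_measure_Levy_Inversion assms)
  also have "(\<lambda>T::nat. 1 / (2 * pi) * (CLBINT t=-T..T. K t * char M1 t) - 1 / (2 * pi) * (CLBINT t=-T..T. K t * char M2 t))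
     = (\<lambda>T::nat. 1 / (2 * pi) * (CLBINT t:{-real T<..<real T}. K t * D t))" (is "_ = ?L")
  proof
    fix T :: nat
    have "(CLBINT t=-T..T. K t * char M1 t) - (CLBINT t=-T..T. K t * char M2 t) = (CLBINT t=-T..T. K t * char M1 t - K t * char M2 t)"
      using intK[OF M1(1,2), of T] intK[OF M2(1,2), of T]
      by (intro interval_lebesgue_integral_diff(2)[symmetric]) auto
    also have "\<dots> = (CLBINT t:{-real T<..<real T}. K t * D t)"
      by (simp add: interval_lebesgue_integral_def einterval_eq D_def right_diff_distrib)
    finally show "1 / (2 * pi) * (CLBINT t=-T..T. K t * char M1 t) - 1 / (2 * pi) * (CLBINT t=-T..T. K t * char M2 t) = 1 / (2 * pi) * (CLBINT t:{-real T<..<real T}. K t * D t)"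
      by (simp only: flip: right_diff_distrib)
  qed
  finally have lim1: "?L \<longlonglongrightarrow> of_real (measure M1 {a<..b} - measure M2 {a<..b})" by simp
  have lim2: "?L \<longlonglongrightarrow> 1 / (2 * pi) * (CLBINT t. K t * D t)"
    unfolding set_lebesgue_integral_def
  proof (intro tendsto_mult_left integral_dominated_convergence[where w = "\<lambda>t. (b - a) * norm (D t)"])
    show "AE t in lborel. (\<lambda>T. indicator {-real T<..<real T} t *\<^sub>R (K t * D t)) \<longlonglongrightarrow> K t * D t"
    proof (intro AE_I2 tendsto_eventually)
      fix t :: real
      obtain n where n: "real n > \<bar>t\<bar>" using reals_Archimedean2 by blast
      show "\<forall>\<^sub>F T in sequentially. indicator {-real T<..<real T} t *\<^sub>R (K t * D t) = K t * D t"
        using eventually_ge_at_top[of n] by eventually_elim (use n in \<open>auto simp: indicator_def\<close>)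
    qed
    show "AE t in lborel. norm (indicator {-real T<..<real T} t *\<^sub>R (K t * D t)) \<le> (b - a) * norm (D t)" for T
      using Kle ab by (auto simp: norm_mult simp del: of_real_mult split: split_indicator intro!: AE_I2 mult_right_mono)
    show "integrable lborel (\<lambda>t. (b - a) * norm (D t))" using intD by simp
  qed measurable
  have "(CLBINT t. K t * D t) = (CLBINT t. (CLBINT x. indicator {a<..b} x *\<^sub>R (iexp (- (t * x)) * D t)))"
  proof (rule integral_cong_AE)
    have "AE t in lborel. t \<noteq> (0::real)"
      by (auto intro!: AE_I[where N = "{0}"])
    then show "AE t in lborel. K t * D t = (CLBINT x. indicator {a<..b} x *\<^sub>R (iexp (- (t * x)) * D t))"
    proof eventually_elim
      case (elim t)
      have "K t * D t = (CLBINT x:{a<..b}. iexp (- (t * x))) * D t"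
        using integral_exp_Ioc[OF ab elim] by (simp add: K_def)
      also have "\<dots> = (CLBINT x:{a<..b}. iexp (- (t * x)) * D t)" by simp
      finally show ?case unfolding set_lebesgue_integral_def .
    qed
  qed measurable
  also have "\<dots> = (CLBINT x. (CLBINT t. indicator {a<..b} x *\<^sub>R (iexp (- (t * x)) * D t)))"
  proof -
    have "integrable (lborel \<Otimes>\<^sub>M lborel) (\<lambda>(x, t). indicator {a<..b} x *\<^sub>R (iexp (- (t * x)) * D t))"
    proof (rule lborel_pair.Fubini_integrable, goal_cases)
      case 1
      show ?case by measurable
    next
      case 2
      have eq: "(\<integral>y. norm (case (x, y) of (x, t) \<Rightarrow> indicator {a<..b} x *\<^sub>R (iexp (- (t * x)) * D t)) \<partial>lborel)
        = indicator {a<..b} x * (\<integral>y. norm (D y) \<partial>lborel)" for x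
        by (auto simp: norm_mult simp del: of_real_mult split: split_indicator)
      show ?case unfolding eq by (intro integrable_mult_left) (use ab in simp)
    next
      case 3
      have *: "integrable lborel (\<lambda>t. iexp (- (t * x)) * D t)" for x
        by (rule Bochner_Integration.integrable_bound[OF intD]) (auto simp: norm_mult simp del: of_real_mult)
      show ?case unfolding prod.case by (intro AE_I2 integrable_scaleR_right *)
    qed
    from lborel_pair.Fubini_integral[OF this] show ?thesis by simp
  qed
  also have "\<dots> = (CLBINT x:{a<..b}. (CLBINT t. iexp (- (t * x)) * D t))"
    unfolding set_lebesgue_integral_def by simp
  also have "\<dots> = (CLBINT x:{a<..b}. (CLBINT \<theta>. iexp (\<theta> * x) * G \<theta>))"
    using lborel_integral_real_affine[of "-1" "\<lambda>t. iexp (- (t * x)) * D t" 0 for x]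
    by (simp add: DG)
  finally have "(CLBINT t. K t * D t) = (CLBINT x:{a<..b}. (CLBINT \<theta>. iexp (\<theta> * x) * G \<theta>))" .
  with LIMSEQ_unique[OF lim1 lim2] show ?thesis by simp
qed

section \<open>The Laplace functional of a Poisson random measure\<close>

lemma norm_one_minus_exp_minus_le:
  fixes z :: complex
  assumes "Re z \<ge> 0"
  shows "norm (1 - exp (- z)) \<le> norm z" "norm (1 - exp (- z)) \<le> 2"
proof -
  have "norm (exp (- z) - exp (- 0)) \<le> 1 * norm (z - 0)"
  proof (rule field_differentiable_bound[where S = "{z. Re z \<ge> 0}" and f' = "\<lambda>z. - exp (- z)"])
    show "convex {z. Re z \<ge> 0}" by (rule convex_halfspace_Re_ge)
  qed (use assms in \<open>auto intro!: derivative_eq_intros\<close>)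
  then show "norm (1 - exp (- z)) \<le> norm z" by (simp add: norm_minus_commute)
  have "norm (1 - exp (- z)) \<le> norm (1::complex) + norm (exp (- z))" by (rule norm_triangle_ineq4)
  also have "\<dots> \<le> 2" using assms by simp
  finally show "norm (1 - exp (- z)) \<le> 2" .
qed

lemma norm_one_minus_exp_minus_scaled_le:
  fixes s :: complex
  assumes "Re s \<ge> 0" "x \<ge> 0"
  shows "norm (1 - exp (- s * of_real x)) \<le> max 2 (norm s) * min 1 x"
proof (cases "x \<le> 1")
  case True
  have "norm (1 - exp (- (s * of_real x))) \<le> norm (s * of_real x)"
    using assms by (intro norm_one_minus_exp_minus_le) simp
  also have "\<dots> = norm s * x" using assms by (simp add: norm_mult)
  also have "\<dots> \<le> max 2 (norm s) * x" using assms by (intro mult_right_mono) auto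
  finally show ?thesis using True by simp
next
  case False
  have "norm (1 - exp (- (s * of_real x))) \<le> 2"
    using assms by (intro norm_one_minus_exp_minus_le) simp
  then show ?thesis using False by simp
qed

text \<open>The Poisson weights sum to \<open>1\<close>, so nothing is left for the non-integer values that an extended
  nonnegative count could take.\<close>

lemma poisson_count_AE_nat:
  assumes M: "prob_space M" and N: "poisson_random_measure M \<mu> N"
    and A: "A \<in> sets \<mu>" "emeasure \<mu> A < \<infinity>"
  shows "AE \<omega> in M. \<exists>k::nat. emeasure (N \<omega>) A = of_nat k"
proof -
  interpret prob_space M by fact
  have [measurable]: "(\<lambda>\<omega>. emeasure (N \<omega>) A) \<in> borel_measurable M"
    using N A unfolding poisson_random_measure_def by auto
  define E where "E k = {\<omega>\<in>space M. emeasure (N \<omega>) A = of_nat k}" for k :: nat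
  have E_sets: "range E \<subseteq> sets M" unfolding E_def by auto
  have disj: "disjoint_family E" by (auto simp: disjoint_family_on_def E_def)
  have "measure M (E k) = exp (- measure \<mu> A) * measure \<mu> A ^ k / fact k" for k
    using N A unfolding poisson_random_measure_def E_def by auto
  then have "(\<lambda>k. measure M (E k)) sums 1"
    using sums_mult[OF exp_converges[of "measure \<mu> A"], of "exp (- measure \<mu> A)"]
    by (simp add: scaleR_conv_of_real divide_inverse mult_ac exp_minus)
  then have "prob (\<Union>k. E k) = 1"
    using sums_unique2[OF finite_measure_UNION[OF E_sets disj]] by auto
  then have "AE \<omega> in M. \<omega> \<in> (\<Union>k. E k)"
    using E_sets by (subst (asm) prob_eq_1) auto
  then show ?thesis by eventually_elim (auto simp: E_def)
qed

lemma poisson_count_laplace: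
  assumes M: "prob_space M" and N: "poisson_random_measure M \<mu> N"
    and A: "A \<in> sets \<mu>" "emeasure \<mu> A < \<infinity>" and c: "Re c \<ge> 0"
  shows "(LINT \<omega>|M. exp (- c * of_real (enn2real (emeasure (N \<omega>) A))))
           = exp (- of_real (measure \<mu> A) * (1 - exp (- c)))"
proof -
  interpret prob_space M by fact
  define a where "a = measure \<mu> A"
  define Z where "Z \<omega> = emeasure (N \<omega>) A" for \<omega>
  have [measurable]: "Z \<in> borel_measurable M"
    using N A unfolding poisson_random_measure_def Z_def by auto
  define E where "E k = {\<omega>\<in>space M. Z \<omega> = of_nat k}" for k
  have [measurable]: "E k \<in> sets M" for k unfolding E_def by measurable
  have pE: "measure M (E k) = exp (- a) * a ^ k / fact k" for k
    using N A unfolding poisson_random_measure_def E_def Z_def a_def by auto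
  have intE: "integrable M (indicator (E k) :: _ \<Rightarrow> real)" for k
    by (rule integrable_real_indicator) (auto simp: emeasure_eq_measure)
  have summE: "summable (\<lambda>k. measure M (E k))"
    using sums_summable[OF sums_mult[OF exp_converges[of a], of "exp (- a)"]]
    by (simp add: pE scaleR_conv_of_real divide_inverse mult_ac)
  have ae: "AE \<omega> in M. \<omega> \<in> (\<Union>k. E k)"
    using poisson_count_AE_nat[OF M N A] AE_space by eventually_elim (auto simp: E_def Z_def)
  define f where "f k \<omega> = indicator (E k) \<omega> *\<^sub>R exp (- c * of_nat k)" for k \<omega>
  have norm_f: "norm (f k \<omega>) = indicator (E k) \<omega> * norm (exp (- c * of_nat k))" for k \<omega>
    by (simp add: f_def)
  have le1: "norm (exp (- c * of_nat k)) \<le> 1" for k using c by simp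
  have f_val: "f k \<omega> = (if k = j then exp (- c * of_nat j) else 0)" if "\<omega> \<in> E j" for \<omega> j k
    using that by (auto simp: f_def E_def)
  have "(\<lambda>k. integral\<^sup>L M (f k)) sums (\<integral>\<omega>. (\<Sum>k. f k \<omega>) \<partial>M)"
  proof (rule sums_integral)
    show "integrable M (f k)" for k unfolding f_def using intE by (intro integrable_scaleR_left) auto
    show "AE \<omega> in M. summable (\<lambda>k. norm (f k \<omega>))"
      using ae
    proof eventually_elim
      case (elim \<omega>)
      then obtain j where j: "\<omega> \<in> E j" by auto
      show ?case by (rule summable_finite[of "{j}"]) (auto simp: f_val[OF j])
    qed
    show "summable (\<lambda>k. \<integral>\<omega>. norm (f k \<omega>) \<partial>M)"
    proof (rule summable_comparison_test')
      show "summable (\<lambda>k. measure M (E k))" by (rule summE)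
      show "norm (\<integral>\<omega>. norm (f k \<omega>) \<partial>M) \<le> measure M (E k)" if "k \<ge> 0" for k
        unfolding norm_f using le1[of k] by (simp add: mult_left_le)
    qed
  qed
  moreover have "(\<integral>\<omega>. (\<Sum>k. f k \<omega>) \<partial>M) = (\<integral>\<omega>. exp (- c * of_real (enn2real (Z \<omega>))) \<partial>M)"
  proof (rule integral_cong_AE)
    show "AE \<omega> in M. (\<Sum>k. f k \<omega>) = exp (- c * of_real (enn2real (Z \<omega>)))"
      using ae
    proof eventually_elim
      case (elim \<omega>)
      then obtain j where j: "\<omega> \<in> E j" by auto
      have "(\<Sum>k. f k \<omega>) = (\<Sum>k\<in>{j}. f k \<omega>)"
        by (rule suminf_finite) (auto simp: f_val[OF j])
      then show ?case using j by (simp add: f_val[OF j]) (simp add: E_def)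
    qed
  qed (unfold f_def, measurable)
  moreover have "(\<lambda>k. integral\<^sup>L M (f k)) sums (exp (- of_real a) * exp (of_real a * exp (- c)))"
  proof -
    have "integral\<^sup>L M (f k) = exp (- of_real a) * ((of_real a * exp (- c)) ^ k /\<^sub>R fact k)" for k
    proof -
      have "integral\<^sup>L M (f k) = of_real (measure M (E k)) * exp (- c * of_nat k)"
        unfolding f_def by (subst integral_scaleR_left[OF intE]) (auto simp: scaleR_conv_of_real)
      also have "exp (- c * of_nat k) = exp (- c) ^ k"
        by (simp add: exp_of_nat_mult[symmetric] mult.commute)
      finally show ?thesis
        by (simp add: pE scaleR_conv_of_real power_mult_distrib divide_inverse mult_ac flip: exp_of_real)
    qed
    then show ?thesis by (simp only:) (intro sums_mult exp_converges)
  qed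
  ultimately have "(\<integral>\<omega>. exp (- c * of_real (enn2real (Z \<omega>))) \<partial>M) = exp (- of_real a) * exp (of_real a * exp (- c))"
    by (metis sums_unique2)
  then show "(LINT \<omega>|M. exp (- c * of_real (enn2real (emeasure (N \<omega>) A))))
           = exp (- of_real (measure \<mu> A) * (1 - exp (- c)))"
    by (simp add: Z_def a_def algebra_simps flip: exp_add)
qed

text \<open>Independence over disjoint sets turns the expectation into a product of the Poisson generating
  functions.\<close>

lemma poisson_simple_laplace:
  fixes c :: "nat \<Rightarrow> complex"
  assumes M: "prob_space M" and N: "poisson_random_measure M \<mu> N"
    and A: "range A \<subseteq> sets \<mu>" "disjoint_family A" "\<And>i. emeasure \<mu> (A i) < \<infinity>"
    and c: "\<And>i. Re (c i) \<ge> 0"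
  shows "(LINT \<omega>|M. exp (- (\<Sum>i<n. c i * of_real (enn2real (emeasure (N \<omega>) (A i))))))
           = exp (- (\<Sum>i<n. of_real (measure \<mu> (A i)) * (1 - exp (- c i))))"
proof -
  interpret prob_space M by fact
  have Am: "A i \<in> sets \<mu>" for i using A by auto
  have [measurable]: "(\<lambda>\<omega>. emeasure (N \<omega>) (A i)) \<in> borel_measurable M" for i
    using N Am unfolding poisson_random_measure_def by auto
  define X where "X i \<omega> = exp (- c i * of_real (enn2real (emeasure (N \<omega>) (A i))))" for i \<omega>
  have "indep_vars (\<lambda>_. borel) (\<lambda>i \<omega>. emeasure (N \<omega>) (A i)) UNIV"
    using N A unfolding poisson_random_measure_def by auto
  then have "indep_vars (\<lambda>_. borel) (\<lambda>i \<omega>. emeasure (N \<omega>) (A i)) {..<n}"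
    by (rule indep_vars_subset) auto
  then have ind: "indep_vars (\<lambda>_. borel) X {..<n}"
    unfolding X_def by (rule indep_vars_compose2) measurable
  have int: "integrable M (X i)" for i
    unfolding X_def
    by (rule integrable_const_bound[where B = 1]) (use c in auto)
  have "(LINT \<omega>|M. exp (- (\<Sum>i<n. c i * of_real (enn2real (emeasure (N \<omega>) (A i)))))) = (LINT \<omega>|M. (\<Prod>i<n. X i \<omega>))"
    by (simp add: X_def flip: exp_sum sum_negf)
  also have "\<dots> = (\<Prod>i<n. LINT \<omega>|M. X i \<omega>)"
    by (rule indep_vars_lebesgue_integral[OF _ ind int]) auto
  also have "\<dots> = (\<Prod>i<n. exp (- (of_real (measure \<mu> (A i)) * (1 - exp (- c i)))))"
    unfolding X_def by (intro prod.cong refl) (simp add: poisson_count_laplace[OF M N Am A(3) c, simplified])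
  finally show ?thesis by (simp flip: exp_sum sum_negf)
qed

text \<open>Campbell's formula. The function \<open>f\<close> is approximated from below by rounding down to multiples of
  \<open>1 / (n + 1)\<close> and replacing values from \<open>n + 1\<close> on by \<open>0\<close>. The approximations take finitely many values, each
  nonzero one on a set of finite intensity, which is the simple case; they are dominated by \<open>f\<close>, so
  both sides pass to the limit by dominated convergence. Working with complex \<open>s\<close> from the start
  avoids an analytic continuation later.\<close>

lemma poisson_laplace_functional:
  fixes f :: "'b \<Rightarrow> real"
  assumes M: "prob_space M" and N: "poisson_random_measure M \<mu> N"
    and f[measurable]: "f \<in> borel_measurable \<mu>" and f0: "\<And>x. f x \<ge> 0"
    and fin: "(\<integral>\<^sup>+x. ennreal (min 1 (f x)) \<partial>\<mu>) < \<infinity>"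
    and Y[measurable]: "Y \<in> borel_measurable M"
    and NY: "AE \<omega> in M. (\<integral>\<^sup>+x. ennreal (f x) \<partial>N \<omega>) = ennreal (Y \<omega>) \<and> Y \<omega> \<ge> 0"
    and s: "Re s \<ge> 0"
  shows "(LINT \<omega>|M. exp (- s * of_real (Y \<omega>))) = exp (- (LINT x|\<mu>. 1 - exp (- s * of_real (f x))))"
proof -
  interpret prob_space M by fact
  (* J n x is the index of the cell of width 1 / (n + 1) that contains f x; the cell of index 0 is
     left out of A since its intensity may be infinite. *)
  define J where "J n x = nat \<lfloor>real (Suc n) * f x\<rfloor>" for n x
  define g where "g n x = (if J n x < Suc n ^ 2 then real (J n x) / real (Suc n) else 0)" for n x
  define A where "A n k = {x\<in>space \<mu>. k > 0 \<and> J n x = k}" for n k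
  have J[measurable]: "J n \<in> measurable \<mu> (count_space UNIV)" for n
    unfolding J_def by measurable
  have [measurable]: "A n k \<in> sets \<mu>" for n k unfolding A_def by measurable
  have g[measurable]: "g n \<in> borel_measurable \<mu>" for n
    unfolding g_def by measurable
  have g0: "g n x \<ge> 0" for n x by (simp add: g_def)
  have Jle: "real (J n x) \<le> real (Suc n) * f x" for n x
    unfolding J_def using f0[of x] by (simp add: of_nat_nat)
  have Jge: "real (J n x) > real (Suc n) * f x - 1" for n x
    unfolding J_def using f0[of x] by linarith
  have gle: "g n x \<le> f x" for n x
    using Jle[of n x] f0[of x] by (auto simp: g_def field_simps)
  have glim: "(\<lambda>n. g n x) \<longlonglongrightarrow> f x" for x
  proof (rule tendsto_sandwich[OF _ _ _ tendsto_const])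
      show "\<forall>\<^sub>F n in sequentially. g n x \<le> f x" using gle by simp
      obtain m where m: "real m > f x" using reals_Archimedean2 by blast
      show "\<forall>\<^sub>F n in sequentially. f x - 1 / real (Suc n) \<le> g n x"
        using eventually_ge_at_top[of m]
      proof eventually_elim
        case (elim n)
        have "real (J n x) \<le> real (Suc n) * f x" by (rule Jle)
        also have "\<dots> < real (Suc n) * real (Suc n)"
          using m elim by (intro mult_strict_left_mono) auto
        finally have "real (J n x) < real (Suc n ^ 2)" 
          by (simp only: power2_eq_square of_nat_mult)
        then have "J n x < Suc n ^ 2" by (simp only: of_nat_less_iff)
        then have "g n x = real (J n x) / real (Suc n)" by (simp add: g_def)
        then show ?case using Jge[of n x] by (simp add: field_simps)
      qed
      show "(\<lambda>n. f x - 1 / real (Suc n)) \<longlonglongrightarrow> f x"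
        using tendsto_diff[OF tendsto_const LIMSEQ_inverse_real_of_nat, of "f x"] by (simp add: divide_inverse)
  qed
  have gsum: "\<phi> (g n x) = (\<Sum>k<Suc n ^ 2. indicator (A n k) x *\<^sub>R \<phi> (real k / real (Suc n)))"
    if "x \<in> space \<mu>" "\<phi> 0 = 0" for n x and \<phi> :: "real \<Rightarrow> 'c::real_vector"
  proof -
    have "(\<Sum>k<Suc n ^ 2. indicator (A n k) x *\<^sub>R \<phi> (real k / real (Suc n)))
       = (\<Sum>k<Suc n ^ 2. if k = J n x then \<phi> (real k / real (Suc n)) else 0)"
      using that by (intro sum.cong refl) (auto simp: A_def indicator_def)
    then show ?thesis using that by (simp add: g_def)
  qed
  have Afin: "emeasure \<mu> (A n k) < \<infinity>" for n k
  proof (cases "k = 0")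
    case False
    have "emeasure \<mu> (A n k) = (\<integral>\<^sup>+x. indicator (A n k) x \<partial>\<mu>)" by simp
    also have "\<dots> \<le> (\<integral>\<^sup>+x. ennreal (real (Suc n)) * ennreal (min 1 (f x)) \<partial>\<mu>)"
    proof (intro nn_integral_mono)
      fix x
      show "indicator (A n k) x \<le> ennreal (real (Suc n)) * ennreal (min 1 (f x))"
      proof (cases "x \<in> A n k")
        case True
        then have "1 \<le> real (J n x)" by (auto simp: A_def)
        also note Jle
        finally have "1 \<le> real (Suc n) * min 1 (f x)" by (auto simp: min_def)
        then have "ennreal 1 \<le> ennreal (real (Suc n) * min 1 (f x))" by (rule ennreal_leI)
        then show ?thesis using True f0[of x] by (simp add: ennreal_mult)
      qed simp
    qed
    also have "\<dots> = ennreal (real (Suc n)) * (\<integral>\<^sup>+x. ennreal (min 1 (f x)) \<partial>\<mu>)"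
      by (rule nn_integral_cmult) measurable
    also have "\<dots> < \<infinity>" using fin by (simp add: ennreal_mult_less_top del: of_nat_Suc)
    finally show ?thesis .
  qed (simp add: A_def)
  (* Z n is the integral of g n with respect to the random measure. *)
  define Z where "Z n \<omega> = (\<Sum>k<Suc n ^ 2. (real k / real (Suc n)) * enn2real (emeasure (N \<omega>) (A n k)))" for n \<omega>
  have [measurable]: "(\<lambda>\<omega>. emeasure (N \<omega>) (A n k)) \<in> borel_measurable M" for n k
    using N unfolding poisson_random_measure_def by auto
  have [measurable]: "Z n \<in> borel_measurable M" for n unfolding Z_def by measurable
  have Z0: "Z n \<omega> \<ge> 0" for n \<omega> unfolding Z_def by (intro sum_nonneg mult_nonneg_nonneg) auto
  have lapl: "LINT \<omega>|M. exp (- s * of_real (Z n \<omega>)) = exp (- (LINT x|\<mu>. 1 - exp (- s * of_real (g n x))))" for n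
  proof -
    have "LINT \<omega>|M. exp (- s * of_real (Z n \<omega>)) = LINT \<omega>|M. exp (- (\<Sum>k<Suc n ^ 2. (s * of_real (real k / real (Suc n))) * of_real (enn2real (emeasure (N \<omega>) (A n k)))))"
      unfolding Z_def by (simp add: sum_distrib_left mult_ac sum_negf)
    also have "\<dots> = exp (- (\<Sum>k<Suc n ^ 2. of_real (measure \<mu> (A n k)) * (1 - exp (- (s * of_real (real k / real (Suc n)))))))"
      using s Afin by (intro poisson_simple_laplace M N) (auto simp: disjoint_family_on_def A_def)
    also have "(\<Sum>k<Suc n ^ 2. of_real (measure \<mu> (A n k)) * (1 - exp (- (s * of_real (real k / real (Suc n))))))
       = (LINT x|\<mu>. (\<Sum>k<Suc n ^ 2. indicator (A n k) x *\<^sub>R (1 - exp (- s * of_real (real k / real (Suc n))))))"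
    proof (subst Bochner_Integration.integral_sum)
      show "integrable \<mu> (\<lambda>x. indicator (A n k) x *\<^sub>R (1 - exp (- s * of_real (real k / real (Suc n)))))" for k
        using Afin[of n k] by (intro integrable_scaleR_left) simp
    qed (use Afin in \<open>simp add: scaleR_conv_of_real\<close>)
    also have "\<dots> = (LINT x|\<mu>. 1 - exp (- s * of_real (g n x)))"
      by (intro Bochner_Integration.integral_cong refl gsum[symmetric, where \<phi> = "\<lambda>y. 1 - exp (- s * of_real y)"]) auto
    finally show ?thesis .
  qed
  have lim1: "(\<lambda>n. exp (- (LINT x|\<mu>. 1 - exp (- s * of_real (g n x))))) \<longlonglongrightarrow>
     exp (- (LINT x|\<mu>. 1 - exp (- s * of_real (f x))))"
  proof (intro tendsto_exp tendsto_minus integral_dominated_convergence[where w = "\<lambda>x. max 2 (norm s) * min 1 (f x)"])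
    have "integrable \<mu> (\<lambda>x. min 1 (f x))"
      by (rule integrableI_bounded) (use fin f0 in auto)
    then show "integrable \<mu> (\<lambda>x. max 2 (norm s) * min 1 (f x))" by simp
    show "AE x in \<mu>. (\<lambda>n. 1 - exp (- s * of_real (g n x))) \<longlonglongrightarrow> 1 - exp (- s * of_real (f x))"
      using glim by (intro AE_I2 tendsto_intros)
    show "AE x in \<mu>. norm (1 - exp (- s * of_real (g n x))) \<le> max 2 (norm s) * min 1 (f x)" for n
    proof (intro AE_I2)
      fix x
      have "norm (1 - exp (- s * of_real (g n x))) \<le> max 2 (norm s) * min 1 (g n x)"
        using s g0 by (rule norm_one_minus_exp_minus_scaled_le)
      also have "\<dots> \<le> max 2 (norm s) * min 1 (f x)"
        using gle[of n x] by (intro mult_left_mono) auto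
      finally show "norm (1 - exp (- s * of_real (g n x))) \<le> max 2 (norm s) * min 1 (f x)" .
    qed
  qed measurable
  have lim2: "(\<lambda>n. LINT \<omega>|M. exp (- s * of_real (Z n \<omega>))) \<longlonglongrightarrow> (LINT \<omega>|M. exp (- s * of_real (Y \<omega>)))"
  proof (rule integral_dominated_convergence[where w = "\<lambda>_. 1"])
    have "AE \<omega> in M. emeasure (N \<omega>) (A n k) < \<infinity>" for n k
      using poisson_count_AE_nat[OF M N _ Afin[of n k]]
      by (auto elim!: eventually_mono simp: of_nat_less_top)
    then have "AE \<omega> in M. \<forall>n k. emeasure (N \<omega>) (A n k) < \<infinity>"
      unfolding AE_all_countable by simp
    moreover have "AE \<omega> in M. sets (N \<omega>) = sets \<mu>"
      using N unfolding poisson_random_measure_def by (intro AE_I2) auto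
    ultimately show "AE \<omega> in M. (\<lambda>n. exp (- s * of_real (Z n \<omega>))) \<longlonglongrightarrow> exp (- s * of_real (Y \<omega>))"
      using NY
    proof eventually_elim
      case (elim \<omega>)
      note [measurable_cong] = elim(2)
      have sp: "space (N \<omega>) = space \<mu>" using sets_eq_imp_space_eq[OF elim(2)] .
      have ZN: "(\<integral>\<^sup>+x. ennreal (g n x) \<partial>N \<omega>) = ennreal (Z n \<omega>)" for n
      proof -
        have "(\<integral>\<^sup>+x. ennreal (g n x) \<partial>N \<omega>) = (\<integral>\<^sup>+x. (\<Sum>k<Suc n ^ 2. ennreal (real k / real (Suc n)) * indicator (A n k) x) \<partial>N \<omega>)"
        proof (intro nn_integral_cong)
          fix x assume x: "x \<in> space (N \<omega>)"
          have "ennreal (g n x) = ennreal (\<Sum>k<Suc n ^ 2. indicator (A n k) x *\<^sub>R (real k / real (Suc n)))"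
            using gsum[of x "\<lambda>y. y" n] x sp by simp
          also have "\<dots> = (\<Sum>k<Suc n ^ 2. ennreal (indicator (A n k) x *\<^sub>R (real k / real (Suc n))))"
            by (intro sum_ennreal[symmetric]) auto
          also have "\<dots> = (\<Sum>k<Suc n ^ 2. ennreal (real k / real (Suc n)) * indicator (A n k) x)"
            by (intro sum.cong refl) (auto split: split_indicator)
          finally show "ennreal (g n x) = \<dots>" .
        qed
        also have "\<dots> = (\<Sum>k<Suc n ^ 2. ennreal (real k / real (Suc n)) * emeasure (N \<omega>) (A n k))"
          by (subst nn_integral_sum) (auto simp: elim(2) nn_integral_cmult_indicator)
        also have "\<dots> = (\<Sum>k<Suc n ^ 2. ennreal ((real k / real (Suc n)) * enn2real (emeasure (N \<omega>) (A n k))))"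
        proof (intro sum.cong refl)
          fix k
          have "ennreal (enn2real (emeasure (N \<omega>) (A n k))) = emeasure (N \<omega>) (A n k)"
            using elim(1) by (simp add: less_top)
          then show "ennreal (real k / real (Suc n)) * emeasure (N \<omega>) (A n k) =
              ennreal ((real k / real (Suc n)) * enn2real (emeasure (N \<omega>) (A n k)))"
            by (simp only: ennreal_mult''[OF enn2real_nonneg])
        qed
        also have "\<dots> = ennreal (Z n \<omega>)"
          unfolding Z_def by (intro sum_ennreal mult_nonneg_nonneg) auto
        finally show ?thesis .
      qed
      have "(\<lambda>n. \<integral>\<^sup>+x. ennreal (g n x) \<partial>N \<omega>) \<longlonglongrightarrow> (\<integral>\<^sup>+x. ennreal (f x) \<partial>N \<omega>)"
        by (rule nn_integral_dominated_convergence[where w = "\<lambda>x. ennreal (f x)"])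
          (use elim(3) glim gle in \<open>auto intro!: ennreal_leI tendsto_ennrealI\<close>)
      then have "(\<lambda>n. ennreal (Z n \<omega>)) \<longlonglongrightarrow> ennreal (Y \<omega>)"
        using elim(3) by (simp add: ZN)
      then have "(\<lambda>n. Z n \<omega>) \<longlonglongrightarrow> Y \<omega>"
        using elim(3) Z0 by (subst (asm) tendsto_ennreal_iff) auto
      then show ?case by (intro tendsto_intros)
    qed
    show "AE \<omega> in M. norm (exp (- s * of_real (Z n \<omega>))) \<le> 1" for n
      using s Z0 by (intro AE_I2) simp
  qed auto
  show ?thesis by (rule LIMSEQ_unique[OF lim2[unfolded lapl] lim1])
qed

section \<open>Levy measures and the Laplace transform of the tail\<close>

lemma integral_exp_minus_Ioc:
  fixes z :: complex
  assumes "z \<noteq> 0" "y \<ge> 0"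
  shows "(LINT x:{0<..y}|lborel. exp (- z * of_real x)) = (1 - exp (- z * of_real y)) / z"
proof -
  have "(LBINT x=0..y. exp (- z * of_real x)) = (- exp (- z * of_real y) / z) - (- exp (- z * of_real 0) / z)"
    unfolding zero_ereal_def using assms
    by (intro interval_integral_FTC_finite[where F = "\<lambda>x. - exp (- z * of_real x) / z"])
       (auto intro!: derivative_eq_intros continuous_intros
         has_vector_derivative_real_field simp: field_simps)
  then show ?thesis using assms
    unfolding zero_ereal_def by (simp add: interval_integral_Ioc diff_divide_distrib)
qed

lemma
  fixes z :: complex
  assumes "Re z > 0"
  shows set_integrable_exp_minus: "set_integrable lborel {0<..} (\<lambda>x. exp (- z * of_real x))"
    and integral_exp_minus_Ioi: "(LINT x:{0<..}|lborel. exp (- z * of_real x)) = 1 / z"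
proof -
  have z: "z \<noteq> 0" using assms by auto
  have "(\<integral>\<^sup>+x. ennreal (exp (- Re z * x)) * indicator {0..} x \<partial>lborel) = ennreal (0 - (- exp (- Re z * 0) / Re z))"
  proof (rule nn_integral_FTC_atLeast)
    show "((\<lambda>x. - exp (- Re z * x) / Re z) \<longlongrightarrow> 0) at_top"
      using assms by real_asymp
  qed (use assms in \<open>auto intro!: derivative_eq_intros\<close>)
  then have fin: "(\<integral>\<^sup>+x. ennreal (exp (- Re z * x)) * indicator {0..} x \<partial>lborel) < \<infinity>" by simp
  have dom: "integrable lborel (\<lambda>x. indicator {0..} x * exp (- Re z * x))"
    by (rule integrableI_bounded) (use fin in \<open>auto simp: ennreal_mult mult.commute ennreal_indicator\<close>)
  show int: "set_integrable lborel {0<..} (\<lambda>x. exp (- z * of_real x))"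
    unfolding set_integrable_def
    by (rule Bochner_Integration.integrable_bound[OF dom]) (auto split: split_indicator)
  have "(\<lambda>n. LINT x:{0<..real n}|lborel. exp (- z * of_real x)) \<longlonglongrightarrow> (LINT x:{0<..}|lborel. exp (- z * of_real x))"
    unfolding set_lebesgue_integral_def
  proof (rule integral_dominated_convergence[OF _ _ dom])
    show "AE x in lborel. (\<lambda>n. indicator {0<..real n} x *\<^sub>R exp (- z * of_real x)) \<longlonglongrightarrow> indicator {0<..} x *\<^sub>R exp (- z * of_real x)"
    proof (intro AE_I2 tendsto_eventually)
      fix x :: real
      obtain m where m: "real m > x" using reals_Archimedean2 by blast
      show "\<forall>\<^sub>F n in sequentially. indicator {0<..real n} x *\<^sub>R exp (- z * of_real x) = indicator {0<..} x *\<^sub>R exp (- z * of_real x)"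
        using eventually_ge_at_top[of m] by eventually_elim (use m in \<open>auto simp: indicator_def\<close>)
    qed
  qed (auto split: split_indicator)
  moreover have "(\<lambda>n. LINT x:{0<..real n}|lborel. exp (- z * of_real x)) \<longlonglongrightarrow> (1 - 0) / z"
  proof -
    have "(\<lambda>n. exp (- Re z * real n)) \<longlonglongrightarrow> 0" using assms by real_asymp
    then have "(\<lambda>n. exp (- z * of_real (real n))) \<longlonglongrightarrow> 0"
      by (intro tendsto_norm_zero_cancel[where f = "\<lambda>n. exp (- z * of_real (real n))"]) simp
    from tendsto_divide[OF tendsto_diff[OF tendsto_const this] tendsto_const z, of 1]
    show ?thesis by (subst integral_exp_minus_Ioc) (use z in auto)
  qed
  ultimately show "(LINT x:{0<..}|lborel. exp (- z * of_real x)) = 1 / z"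
    using LIMSEQ_unique by fastforce
qed

lemma levy_measure_sets: "levy_measure \<nu> \<Longrightarrow> sets \<nu> = sets borel"
  by (simp add: levy_measure_def)

lemma levy_measure_space: "levy_measure \<nu> \<Longrightarrow> space \<nu> = UNIV"
  using sets_eq_imp_space_eq[of \<nu> borel] by (simp add: levy_measure_def)

lemma levy_measure_AE_pos:
  assumes "levy_measure \<nu>"
  shows "AE x in \<nu>. x > 0"
  using assms by (intro AE_I[where N = "{..0}"]) (auto simp: levy_measure_def)

lemma levy_measure_integrable_min:
  assumes "levy_measure \<nu>"
  shows "integrable \<nu> (\<lambda>x. min 1 x)"
proof (rule integrableI_bounded)
  note [measurable_cong] = levy_measure_sets[OF assms]
  show "(\<lambda>x. min 1 x) \<in> borel_measurable \<nu>" by measurable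
  have "(\<integral>\<^sup>+x. ennreal (norm (min 1 x)) \<partial>\<nu>) = (\<integral>\<^sup>+x. ennreal (min 1 x) \<partial>\<nu>)"
    using levy_measure_AE_pos[OF assms] by (intro nn_integral_cong_AE) auto
  then show "(\<integral>\<^sup>+x. ennreal (norm (min 1 x)) \<partial>\<nu>) < \<infinity>" using assms by (simp add: levy_measure_def)
qed

lemma levy_measure_tail_finite:
  assumes "levy_measure \<nu>" "x > 0"
  shows "emeasure \<nu> {x..} < \<infinity>"
proof -
  note [measurable_cong] = levy_measure_sets[OF assms(1)]
  define e where "e = min 1 x"
  have e: "e > 0" using assms by (simp add: e_def)
  have "emeasure \<nu> {x..} = (\<integral>\<^sup>+y. indicator {x..} y \<partial>\<nu>)" by simp
  also have "\<dots> \<le> (\<integral>\<^sup>+y. ennreal (1 / e) * ennreal (min 1 y) \<partial>\<nu>)"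
  proof (intro nn_integral_mono)
    fix y
    have "1 \<le> 1 / e * min 1 y" if "x \<le> y" using that e by (auto simp: e_def field_simps)
    then show "indicator {x..} y \<le> ennreal (1 / e) * ennreal (min 1 y)"
      using e by (auto split: split_indicator simp flip: ennreal_mult' intro!: ennreal_leI simp flip: ennreal_1)
  qed
  also have "\<dots> = ennreal (1 / e) * (\<integral>\<^sup>+y. ennreal (min 1 y) \<partial>\<nu>)"
    by (rule nn_integral_cmult) measurable
  also have "\<dots> < \<infinity>" using assms(1) by (simp add: ennreal_mult_less_top levy_measure_def)
  finally show ?thesis .
qed

lemma levy_measure_sigma_finite:
  assumes "levy_measure \<nu>"
  shows "sigma_finite_measure \<nu>"
proof
  let ?A = "insert {..0} ((\<lambda>n. {1 / real (Suc n)..}) ` UNIV)"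
  have "x \<in> \<Union>?A" for x :: real
  proof (cases "x > 0")
    case True
    then obtain n where "1 / real (Suc n) < x" using nat_approx_posE by blast
    then show ?thesis by (intro UnionI[of "{1 / real (Suc n)..}"]) auto
  qed auto
  then have "(\<Union>?A) = UNIV" by blast
  then show "\<exists>A. countable A \<and> A \<subseteq> sets \<nu> \<and> \<Union>A = space \<nu> \<and> (\<forall>a\<in>A. emeasure \<nu> a \<noteq> \<infinity>)"
    using assms levy_measure_tail_finite[OF assms, of "1 / real (Suc n)" for n]
    by (intro exI[of _ ?A]) (auto simp: levy_measure_def levy_measure_space less_top)
qed

lemma levy_measure_integrable_exp:
  assumes "levy_measure \<nu>" "Re s \<ge> 0"
  shows "integrable \<nu> (\<lambda>x. 1 - exp (- s * of_real x))"
proof (rule Bochner_Integration.integrable_bound)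
  show "integrable \<nu> (\<lambda>x. max 2 (norm s) * min 1 x)"
    using levy_measure_integrable_min[OF assms(1)] by simp
  show "AE x in \<nu>. norm (1 - exp (- s * of_real x)) \<le> norm (max 2 (norm s) * min 1 x)"
    using levy_measure_AE_pos[OF assms(1)]
  proof eventually_elim
    case (elim x)
    then have "norm (1 - exp (- s * of_real x)) \<le> max 2 (norm s) * min 1 x"
      using assms(2) by (intro norm_one_minus_exp_minus_scaled_le) auto
    then show ?case by (simp only: real_norm_def abs_le_D1 abs_ge_self order_trans[OF _ abs_ge_self])
  qed
  note [measurable_cong] = levy_measure_sets[OF assms(1)]
  show "(\<lambda>x. 1 - exp (- s * of_real x)) \<in> borel_measurable \<nu>" by measurable
qed

definition laplace_exponent :: "real measure \<Rightarrow> real \<Rightarrow> complex \<Rightarrow> complex" where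
  "laplace_exponent \<nu> \<delta> s = of_real \<delta> * s + (LINT x|\<nu>. 1 - exp (- s * of_real x))"

text \<open>Each jump contributes \<open>Re (1 - e^(-s x)) \<ge> 0\<close>, so the drift alone bounds the real part. This keeps
  the denominator of the resolvent away from \<open>0\<close>.\<close>

lemma Re_laplace_exponent_ge:
  assumes "levy_measure \<nu>" "Re s \<ge> 0"
  shows "Re (laplace_exponent \<nu> \<delta> s) \<ge> \<delta> * Re s"
proof -
  have "Re (LINT x|\<nu>. 1 - exp (- s * of_real x)) = (LINT x|\<nu>. Re (1 - exp (- s * of_real x)))"
    by (rule integral_Re[symmetric]) (rule levy_measure_integrable_exp[OF assms])
  also have "\<dots> \<ge> 0"
  proof (rule integral_nonneg_AE)
    show "AE x in \<nu>. 0 \<le> Re (1 - exp (- s * of_real x))"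
      using levy_measure_AE_pos[OF assms(1)]
    proof eventually_elim
      case (elim x)
      have "Re (exp (- s * of_real x)) \<le> norm (exp (- s * of_real x))" by (rule complex_Re_le_cmod)
      also have "\<dots> \<le> 1" using assms elim by simp
      finally show ?case by simp
    qed
  qed
  finally show ?thesis by (simp add: laplace_exponent_def)
qed

lemma tail_plus_measurable:
  assumes "levy_measure \<nu>"
  shows "tail_plus \<nu> q \<in> borel_measurable borel"
proof -
  interpret sigma_finite_measure \<nu> by (rule levy_measure_sigma_finite[OF assms])
  note [measurable_cong] = levy_measure_sets[OF assms]
  have "(\<lambda>x::real. emeasure \<nu> (Pair x -` {(x, y). x \<le> y})) \<in> borel_measurable borel"
  proof (rule measurable_emeasure_Pair)
    have "{p\<in>space (borel \<Otimes>\<^sub>M \<nu>). fst p \<le> (snd p :: real)} \<in> sets (borel \<Otimes>\<^sub>M \<nu>)" by measurable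
    then show "{(x :: real, y). x \<le> y} \<in> sets (borel \<Otimes>\<^sub>M \<nu>)"
      by (simp add: space_pair_measure levy_measure_space[OF assms] case_prod_beta')
  qed
  moreover have "Pair x -` {(x, y). x \<le> y} = {x..}" for x :: real by auto
  ultimately have [measurable]: "(\<lambda>x::real. measure \<nu> {x..}) \<in> borel_measurable borel"
    unfolding measure_def by simp
  show ?thesis unfolding tail_plus_def[abs_def] by measurable
qed

text \<open>Since \<open>\<nu>[x, \<infinity>) = \<integral>1{x \<le> y} \<nu>(dy)\<close>, Fubini replaces the transform of the tail by the integral of
  \<open>(1 - e^(-s y)) / s = \<integral>_0^y e^(-s x) dx\<close> against \<open>\<nu>\<close>; the constant \<open>q\<close> contributes \<open>q / s\<close>. Absolute
  convergence is the same computation with \<open>Re s\<close> in place of \<open>s\<close>.\<close>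

lemma
  assumes \<nu>: "levy_measure \<nu>" and s: "Re s > 0"
  shows laplace_tail_integrable: "set_integrable lborel {0<..} (\<lambda>x. exp (- s * of_real x) * of_real (tail_plus \<nu> q x))"
    and laplace_tail: "s * laplace (tail_plus \<nu> q) s = of_real q + (LINT x|\<nu>. 1 - exp (- s * of_real x))"
proof -
  note [measurable_cong] = levy_measure_sets[OF \<nu>]
  interpret \<nu>: sigma_finite_measure \<nu> by (rule levy_measure_sigma_finite[OF \<nu>])
  interpret P: pair_sigma_finite \<nu> lborel by unfold_locales
  have s0: "s \<noteq> 0" using s by auto
  define F where "F y x = indicator {0<..y} x *\<^sub>R exp (- s * of_real x)" for y x
  have F_int: "integrable lborel (F y)" for y
  proof -
    have "set_integrable lborel {0<..y} (\<lambda>x. exp (- s * of_real x))"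
      by (rule set_integrable_subset[OF set_integrable_exp_minus[OF s]]) auto
    then show ?thesis unfolding F_def[abs_def] set_integrable_def .
  qed
  have F_meas: "(\<lambda>(y, x). F y x) \<in> borel_measurable (\<nu> \<Otimes>\<^sub>M lborel)"
    unfolding F_def greaterThanAtMost_def greaterThan_def atMost_def indicator_def by measurable
  have normF: "(LINT x|lborel. norm (F y x)) = Re ((1 - exp (- of_real (Re s) * of_real y)) / of_real (Re s))" if "y > 0" for y
  proof -
    have "complex_of_real (LINT x|lborel. norm (F y x)) = (LINT x:{0<..y}|lborel. exp (- of_real (Re s) * of_real x))"
      unfolding set_lebesgue_integral_def F_def
      by (subst integral_complex_of_real[symmetric], intro Bochner_Integration.integral_cong)
         (auto simp: norm_mult simp flip: exp_of_real split: split_indicator)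
    also have "\<dots> = (1 - exp (- of_real (Re s) * of_real y)) / of_real (Re s)"
      using s that by (intro integral_exp_minus_Ioc) auto
    finally show ?thesis by (metis Re_complex_of_real)
  qed
  have F_prod: "integrable (\<nu> \<Otimes>\<^sub>M lborel) (\<lambda>(y, x). F y x)"
  proof (rule P.Fubini_integrable[OF F_meas])
    have "integrable \<nu> (\<lambda>y. Re ((1 - exp (- of_real (Re s) * of_real y)) / of_real (Re s)))"
      using levy_measure_integrable_exp[OF \<nu>, of "of_real (Re s)"] s by (intro integrable_Re) simp
    moreover have "AE y in \<nu>. Re ((1 - exp (- of_real (Re s) * of_real y)) / of_real (Re s)) = (LINT x|lborel. norm (F y x))"
      using levy_measure_AE_pos[OF \<nu>] by eventually_elim (rule normF[symmetric])
    moreover have "(\<lambda>y. LINT x|lborel. norm (F y x)) \<in> borel_measurable \<nu>"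
      using F_meas by (intro lborel.borel_measurable_lebesgue_integral) (simp add: case_prod_beta')
    ultimately show "integrable \<nu> (\<lambda>y. LINT x|lborel. norm (case (y, x) of (y, x) \<Rightarrow> F y x))"
      unfolding prod.case by (subst integrable_cong_AE[symmetric]) auto
    show "AE y in \<nu>. integrable lborel (\<lambda>x. case (y, x) of (y, x) \<Rightarrow> F y x)"
      by (simp add: F_int)
  qed
  have inner: "(LINT y|\<nu>. F y x) = indicator {0<..} x *\<^sub>R (exp (- s * of_real x) * of_real (measure \<nu> {x..}))" for x
  proof (cases "x > 0")
    case True
    then have "F y x = indicator {x..} y *\<^sub>R exp (- s * of_real x)" for y
      by (auto simp: F_def indicator_def)
    then show ?thesis using True levy_measure_tail_finite[OF \<nu> True]
      by (simp add: scaleR_conv_of_real mult.commute)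
  qed (simp add: F_def)
  have "integrable lborel (\<lambda>x. LINT y|\<nu>. F y x)"
    using P.integrable_snd[OF F_prod] .
  then have i1: "integrable lborel (\<lambda>x. indicator {0<..} x *\<^sub>R (exp (- s * of_real x) * of_real (measure \<nu> {x..})))"
    unfolding inner .
  have i2: "integrable lborel (\<lambda>x. of_real q * (indicator {0<..} x *\<^sub>R exp (- s * of_real x)))"
    using set_integrable_exp_minus[OF s] unfolding set_integrable_def by (rule integrable_mult_right)
  have eq: "indicator {0<..} x *\<^sub>R (exp (- s * of_real x) * of_real (tail_plus \<nu> q x)) =
     indicator {0<..} x *\<^sub>R (exp (- s * of_real x) * of_real (measure \<nu> {x..})) + of_real q * (indicator {0<..} x *\<^sub>R exp (- s * of_real x))" for x
    by (auto simp: tail_plus_def indicator_def algebra_simps)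
  show "set_integrable lborel {0<..} (\<lambda>x. exp (- s * of_real x) * of_real (tail_plus \<nu> q x))"
    unfolding set_integrable_def eq by (rule Bochner_Integration.integrable_add[OF i1 i2])
  have "(LINT x|lborel. LINT y|\<nu>. F y x) = (LINT y|\<nu>. LINT x|lborel. F y x)"
    by (rule P.Fubini_integral[OF F_prod])
  also have "\<dots> = (LINT y|\<nu>. (1 - exp (- s * of_real y)) / s)"
  proof (rule integral_cong_AE)
    show "(\<lambda>y. LINT x|lborel. F y x) \<in> borel_measurable \<nu>"
      using F_meas by (intro lborel.borel_measurable_lebesgue_integral) (simp add: case_prod_beta')
    show "AE y in \<nu>. (LINT x|lborel. F y x) = (1 - exp (- s * of_real y)) / s"
      using levy_measure_AE_pos[OF \<nu>]
    proof eventually_elim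
      case (elim y)
      then show ?case using integral_exp_minus_Ioc[OF s0, of y]
        by (simp add: F_def set_lebesgue_integral_def)
    qed
  qed measurable
  finally have "(LINT x|lborel. LINT y|\<nu>. F y x) = (LINT y|\<nu>. 1 - exp (- s * of_real y)) / s" by simp
  moreover have "laplace (tail_plus \<nu> q) s = (LINT x|lborel. LINT y|\<nu>. F y x) + of_real q * (LINT x:{0<..}|lborel. exp (- s * of_real x))"
    unfolding laplace_def set_lebesgue_integral_def eq inner
    by (subst Bochner_Integration.integral_add[OF i1 i2]) (simp only: integral_mult_right_zero)
  ultimately show "s * laplace (tail_plus \<nu> q) s = of_real q + (LINT x|\<nu>. 1 - exp (- s * of_real x))"
    using s0 integral_exp_minus_Ioi[OF s] by (simp add: field_simps)
qed

section \<open>Decay of the transforms along vertical lines\<close>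

lemma integrable_norm_Complex_powr:
  fixes e :: real
  assumes "l > 0" "e < -1"
  shows "integrable lborel (\<lambda>\<theta>. norm (Complex l \<theta>) powr e)"
proof -
  define h where "h \<theta> = indicator {1..} \<theta> * \<theta> powr e" for \<theta> :: real
  have "(\<integral>\<^sup>+\<theta>. ennreal (\<theta> powr e) * indicator {1..} \<theta> \<partial>lborel) = ennreal (0 - 1 powr (e + 1) / (e + 1))"
  proof (rule nn_integral_FTC_atLeast[where F = "\<lambda>x. x powr (e + 1) / (e + 1)"])
    show "((\<lambda>x. x powr (e + 1) / (e + 1)) \<longlongrightarrow> 0) at_top"
      using assms by real_asymp
  qed (use assms in \<open>auto intro!: derivative_eq_intros\<close>)
  then have "(\<integral>\<^sup>+\<theta>. ennreal (\<theta> powr e) * indicator {1..} \<theta> \<partial>lborel) < \<infinity>" by simp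
  moreover have "ennreal (norm (h \<theta>)) = ennreal (\<theta> powr e) * indicator {1..} \<theta>" for \<theta>
    by (auto simp: h_def split: split_indicator)
  ultimately have h: "integrable lborel h"
    unfolding h_def[abs_def] by (intro integrableI_bounded) (auto simp: h_def)
  have h': "integrable lborel (\<lambda>\<theta>. h (- \<theta>))"
    using lborel_integrable_real_affine_iff[of "-1" h 0] h by simp
  have c: "integrable lborel (\<lambda>\<theta>. indicator {-1..1::real} \<theta> * (l powr e))"
    by (intro integrable_mult_left) simp
  show ?thesis
  proof (rule Bochner_Integration.integrable_bound[OF Bochner_Integration.integrable_add[OF c Bochner_Integration.integrable_add[OF h h']]])
    show "AE \<theta> in lborel. norm (norm (Complex l \<theta>) powr e) \<le> norm (indicator {-1..1::real} \<theta> * (l powr e) + (h \<theta> + h (- \<theta>)))"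
    proof (intro AE_I2)
      fix \<theta> :: real
      have hn: "h \<theta> \<ge> 0" for \<theta> by (simp add: h_def)
      have 1: "l \<le> norm (Complex l \<theta>)" using complex_Re_le_cmod[of "Complex l \<theta>"] by simp
      have 2: "\<bar>\<theta>\<bar> \<le> norm (Complex l \<theta>)" using abs_Im_le_cmod[of "Complex l \<theta>"] by simp
      have "norm (Complex l \<theta>) powr e \<le> indicator {-1..1::real} \<theta> * (l powr e) + (h \<theta> + h (- \<theta>))"
      proof (cases "\<theta> \<in> {-1..1}")
        case True
        have "norm (Complex l \<theta>) powr e \<le> l powr e" using 1 assms by (intro powr_mono2') auto
        then show ?thesis using True hn[of \<theta>] hn[of "- \<theta>"] by simp
      next
        case False
        have "norm (Complex l \<theta>) powr e \<le> \<bar>\<theta>\<bar> powr e" using 2 False assms by (intro powr_mono2') auto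
        also have "\<dots> \<le> h \<theta> + h (- \<theta>)" using False by (auto simp: h_def indicator_def abs_if)
        finally show ?thesis using False by simp
      qed
      then show "norm (norm (Complex l \<theta>) powr e) \<le> norm (indicator {-1..1::real} \<theta> * (l powr e) + (h \<theta> + h (- \<theta>)))"
        by simp
    qed
  qed (simp add: Complex_eq)
qed

lemma blumenthal_getoor_less_oneD:
  assumes "levy_measure \<nu>" "blumenthal_getoor \<nu> < 1"
  obtains \<gamma> where "0 < \<gamma>" "\<gamma> < 1" "(\<integral>\<^sup>+x\<in>{0<..1}. ennreal (x powr \<gamma>) \<partial>\<nu>) < \<infinity>"
proof -
  note [measurable_cong] = levy_measure_sets[OF assms(1)]
  let ?S = "{\<gamma>. \<gamma> > 0 \<and> (\<integral>\<^sup>+x\<in>{0<..1}. ennreal (x powr \<gamma>) \<partial>\<nu>) < \<infinity>}"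
  have "(\<integral>\<^sup>+x\<in>{0<..1}. ennreal (x powr 1) \<partial>\<nu>) \<le> (\<integral>\<^sup>+x. ennreal (min 1 x) \<partial>\<nu>)"
    by (intro nn_integral_mono) (auto split: split_indicator)
  then have "1 \<in> ?S" using assms by (auto simp: levy_measure_def le_less_trans)
  moreover have "Inf ?S < 1" using assms by (simp add: blumenthal_getoor_def)
  ultimately obtain \<gamma> where "\<gamma> \<in> ?S" "\<gamma> < 1" using cInf_lessD[of ?S 1] by blast
  then show ?thesis using that by auto
qed

text \<open>For \<open>|z| \<le> 1\<close> as well as for \<open>|z| \<ge> 1\<close> the estimates \<open>|1 - e^(-z)| \<le> min(|z|, 2)\<close> are at most
  \<open>2 |z|^\<gamma>\<close>, which is integrable for the jumps below \<open>1\<close>; the jumps above \<open>1\<close> have finite total mass.\<close>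

lemma levy_integral_growth:
  assumes \<nu>: "levy_measure \<nu>" and \<gamma>: "0 < \<gamma>" "\<gamma> < 1" "(\<integral>\<^sup>+x\<in>{0<..1}. ennreal (x powr \<gamma>) \<partial>\<nu>) < \<infinity>"
  obtains C where "C \<ge> 0" "\<And>s. Re s \<ge> 0 \<Longrightarrow> norm (LINT x|\<nu>. 1 - exp (- s * of_real x)) \<le> C * (1 + norm s powr \<gamma>)"
proof -
  note [measurable_cong] = levy_measure_sets[OF \<nu>]
  have i1: "integrable \<nu> (\<lambda>x. indicator {0<..1} x * x powr \<gamma>)"
    by (rule integrableI_bounded) (use \<gamma> in \<open>auto simp: ennreal_mult ennreal_indicator mult.commute\<close>)
  have i2: "integrable \<nu> (indicator {1..} :: real \<Rightarrow> real)"
    by (rule integrable_real_indicator) (use levy_measure_tail_finite[OF \<nu>, of 1] in auto)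
  define a where "a = (LINT x|\<nu>. indicator {0<..1} x * x powr \<gamma>)"
  define b where "b = (LINT x|\<nu>. indicator {1..} x :: real)"
  have ab: "a \<ge> 0" "b \<ge> 0" unfolding a_def b_def by (auto intro!: Bochner_Integration.integral_nonneg)
  show ?thesis
  proof (rule that[of "2 * (a + b)"])
    fix s :: complex assume s: "Re s \<ge> 0"
    have bd: "norm (1 - exp (- s * of_real x)) \<le> 2 * norm s powr \<gamma> * (indicator {0<..1} x * x powr \<gamma>) + 2 * indicator {1..} x"
      if x: "x > 0" for x
    proof (cases "x < 1")
      case True
      let ?z = "s * of_real x"
      have nz: "norm ?z = norm s * x" using x by (simp add: norm_mult)
      have z: "norm (1 - exp (- ?z)) \<le> norm ?z" "norm (1 - exp (- ?z)) \<le> 2"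
        using s x by (intro norm_one_minus_exp_minus_le; simp)+
      have "norm (1 - exp (- ?z)) \<le> 2 * norm ?z powr \<gamma>"
      proof (cases "norm ?z \<le> 1")
        case True
        show ?thesis
        proof (cases "?z = 0")
          case False
          then have "norm ?z powr 1 \<le> norm ?z powr \<gamma>"
            using True \<gamma> by (intro powr_mono') auto
          then have "norm ?z \<le> norm ?z powr \<gamma>" using False by simp
          then show ?thesis using z(1) by (smt (verit) powr_ge_zero)
        next
          case True
          show ?thesis unfolding True by simp
        qed
      next
        case False
        then have "norm ?z powr \<gamma> \<ge> 1" using \<gamma> by (intro ge_one_powr_ge_zero) auto
        then show ?thesis using z(2) by linarith
      qed
      then show ?thesis using True x by (simp add: nz powr_mult)
    next
      case False
      then show ?thesis using norm_one_minus_exp_minus_le(2)[of "s * of_real x"] s x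
        by (simp add: add_nonneg_nonneg add_increasing)
    qed
    have "norm (LINT x|\<nu>. 1 - exp (- s * of_real x)) \<le> (LINT x|\<nu>. norm (1 - exp (- s * of_real x)))"
      by (rule integral_norm_bound)
    also have "\<dots> \<le> (LINT x|\<nu>. 2 * norm s powr \<gamma> * (indicator {0<..1} x * x powr \<gamma>) + 2 * indicator {1..} x)"
    proof (rule integral_mono_AE)
      show "integrable \<nu> (\<lambda>x. norm (1 - exp (- s * of_real x)))"
        by (intro integrable_norm levy_measure_integrable_exp[OF \<nu> s])
      show "integrable \<nu> (\<lambda>x. 2 * norm s powr \<gamma> * (indicator {0<..1} x * x powr \<gamma>) + 2 * indicator {1..} x)"
        by (intro Bochner_Integration.integrable_add integrable_mult_right i1 i2)
      show "AE x in \<nu>. norm (1 - exp (- s * of_real x)) \<le> 2 * norm s powr \<gamma> * (indicator {0<..1} x * x powr \<gamma>) + 2 * indicator {1..} x"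
        using levy_measure_AE_pos[OF \<nu>] by eventually_elim (rule bd)
    qed
    also have "\<dots> = 2 * norm s powr \<gamma> * a + 2 * b"
      unfolding a_def b_def
      by (subst Bochner_Integration.integral_add) (intro integrable_mult_right i1 i2, intro integrable_mult_right i1 i2, simp)
    also have "\<dots> \<le> 2 * (a + b) * (1 + norm s powr \<gamma>)"
      using ab by (simp add: algebra_simps)
    finally show "norm (LINT x|\<nu>. 1 - exp (- s * of_real x)) \<le> 2 * (a + b) * (1 + norm s powr \<gamma>)" .
  qed (use ab in simp)
qed

text \<open>The identity behind the whole expansion: the transform \<open>1 / (q + \<Phi>)\<close> of the potential measure is
  \<open>1 / s\<close> times \<open>1 / (\<delta> + L)\<close>.\<close>

lemma laplace_tail_exponent:
  assumes "levy_measure \<nu>" "Re s > 0"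
  shows "s * (of_real \<delta> + laplace (tail_plus \<nu> q) s) = of_real q + laplace_exponent \<nu> \<delta> s"
  using laplace_tail[OF assms, of q] by (simp add: laplace_exponent_def algebra_simps)

lemma resolvent_nonzero:
  assumes "levy_measure \<nu>" "Re s > 0" "\<delta> > 0" "q \<ge> 0"
  shows "s * (of_real \<delta> + laplace (tail_plus \<nu> q) s) \<noteq> 0"
proof -
  have "0 < \<delta> * Re s" using assms by simp
  also have "\<dots> \<le> Re (of_real q + laplace_exponent \<nu> \<delta> s)"
    using Re_laplace_exponent_ge[OF assms(1), of s \<delta>] assms by simp
  finally have "of_real q + laplace_exponent \<nu> \<delta> s \<noteq> 0"
    by (metis less_irrefl zero_complex.simps(1))
  then show ?thesis using assms by (subst laplace_tail_exponent) auto
qed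

text \<open>On the line \<open>|s|\<close> is at least \<open>l\<close>, so the bounded part of the growth estimate for \<open>s L(s)\<close> can be
  absorbed into the term \<open>|s|^\<gamma>\<close>.\<close>

lemma laplace_tail_decay:
  assumes \<nu>: "levy_measure \<nu>" and bg: "blumenthal_getoor \<nu> < 1" and "q \<ge> 0" "l > 0"
  obtains \<gamma> K where "\<gamma> < 1" "K \<ge> 0"
    "\<And>s. Re s = l \<Longrightarrow> norm (laplace (tail_plus \<nu> q) s) \<le> K * norm s powr (\<gamma> - 1)"
proof -
  obtain \<gamma> where \<gamma>: "0 < \<gamma>" "\<gamma> < 1" "(\<integral>\<^sup>+x\<in>{0<..1}. ennreal (x powr \<gamma>) \<partial>\<nu>) < \<infinity>"
    using blumenthal_getoor_less_oneD[OF \<nu> bg] by blast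
  obtain C where C: "C \<ge> 0" "\<And>s. Re s \<ge> 0 \<Longrightarrow> norm (LINT x|\<nu>. 1 - exp (- s * of_real x)) \<le> C * (1 + norm s powr \<gamma>)"
    using levy_integral_growth[OF \<nu> \<gamma>] by blast
  define K where "K = (q + C) * l powr (- \<gamma>) + C"
  have K0: "K \<ge> 0" using C assms by (simp add: K_def)
  have sl: "norm s \<ge> l" if "Re s = l" for s using complex_Re_le_cmod[of s] that by simp
  have "norm (laplace (tail_plus \<nu> q) s) \<le> K * norm s powr (\<gamma> - 1)" if "Re s = l" for s
  proof -
    have r: "norm s > 0" using sl[OF that] assms by linarith
    have "norm s * norm (laplace (tail_plus \<nu> q) s) = norm (of_real q + (LINT x|\<nu>. 1 - exp (- s * of_real x)))"
      unfolding norm_mult[symmetric] using that assms by (subst laplace_tail[OF \<nu>]) auto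
    also have "\<dots> \<le> q + C * (1 + norm s powr \<gamma>)"
      using C(2)[of s] that assms by (intro order_trans[OF norm_triangle_ineq] add_mono) auto
    also have "\<dots> = (q + C) * (norm s powr (- \<gamma>) * norm s powr \<gamma>) + C * norm s powr \<gamma>"
      using r by (simp add: algebra_simps flip: powr_add)
    also have "\<dots> \<le> (q + C) * (l powr (- \<gamma>) * norm s powr \<gamma>) + C * norm s powr \<gamma>"
      using sl[OF that] assms \<gamma> C by (intro add_mono mult_left_mono mult_right_mono powr_mono2') auto
    also have "\<dots> = K * norm s powr \<gamma>" by (simp add: K_def algebra_simps)
    also have "\<dots> = norm s * (K * norm s powr (\<gamma> - 1))"
      using r by (simp add: powr_diff)
    finally show ?thesis using r by simp
  qed
  then show ?thesis using that[OF \<gamma>(2) K0] by blast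
qed

text \<open>Far out on the line \<open>L\<close> is smaller than \<open>\<delta> / 2\<close>. On the remaining bounded part
  \<open>|s| |\<delta> + L(s)| \<ge> Re (q + \<Phi>(s)) \<ge> \<delta> l\<close> gives an explicit bound.\<close>

lemma resolvent_bounded_below:
  assumes \<nu>: "levy_measure \<nu>" and bg: "blumenthal_getoor \<nu> < 1" and "\<delta> > 0" "q \<ge> 0" "l > 0"
  obtains c where "c > 0" "\<And>s. Re s = l \<Longrightarrow> norm (of_real \<delta> + laplace (tail_plus \<nu> q) s) \<ge> c"
proof -
  obtain \<gamma> K where \<gamma>: "\<gamma> < 1"
    and L: "\<And>s. Re s = l \<Longrightarrow> norm (laplace (tail_plus \<nu> q) s) \<le> K * norm s powr (\<gamma> - 1)"
    using laplace_tail_decay[OF \<nu> bg assms(4,5)] by blast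
  have sl: "norm s \<ge> l" if "Re s = l" for s using complex_Re_le_cmod[of s] that by simp
  have "((\<lambda>r. K * r powr (\<gamma> - 1)) \<longlongrightarrow> 0) at_top" using \<gamma> by real_asymp
  then have "\<forall>\<^sub>F r in at_top. K * r powr (\<gamma> - 1) < \<delta> / 2"
    using assms by (intro order_tendstoD) auto
  then obtain R where R: "\<And>r. r \<ge> R \<Longrightarrow> K * r powr (\<gamma> - 1) < \<delta> / 2"
    by (auto simp: eventually_at_top_linorder)
  define R' where "R' = max R l"
  have R': "R' > 0" "R' \<ge> R" using assms by (auto simp: R'_def)
  define c where "c = min (\<delta> / 2) (\<delta> * l / R')"
  have "norm (of_real \<delta> + laplace (tail_plus \<nu> q) s) \<ge> c" if "Re s = l" for s
  proof (cases "norm s \<ge> R'")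
    case True
    have "\<delta> = norm (complex_of_real \<delta>)" using assms by simp
    also have "\<dots> \<le> norm (of_real \<delta> + laplace (tail_plus \<nu> q) s) + norm (laplace (tail_plus \<nu> q) s)"
      by (metis add_diff_cancel_right' norm_triangle_ineq4)
    also have "norm (laplace (tail_plus \<nu> q) s) \<le> \<delta> / 2"
      using L[OF that] R[of "norm s"] True R' by simp
    finally show ?thesis by (simp add: c_def)
  next
    case False
    have r: "norm s > 0" using sl[OF that] assms by linarith
    have "\<delta> * l \<le> Re (of_real q + laplace_exponent \<nu> \<delta> s)"
      using Re_laplace_exponent_ge[OF \<nu>, of s \<delta>] assms that by simp
    also have "\<dots> = Re (s * (of_real \<delta> + laplace (tail_plus \<nu> q) s))"
      using assms that by (subst laplace_tail_exponent[OF \<nu>]) auto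
    also have "\<dots> \<le> norm s * norm (of_real \<delta> + laplace (tail_plus \<nu> q) s)"
      unfolding norm_mult[symmetric] by (rule complex_Re_le_cmod)
    also have "\<dots> \<le> R' * norm (of_real \<delta> + laplace (tail_plus \<nu> q) s)"
      using False by (intro mult_right_mono) auto
    finally have "\<delta> * l / R' \<le> norm (of_real \<delta> + laplace (tail_plus \<nu> q) s)"
      using R' by (simp add: field_simps)
    then show ?thesis by (simp add: c_def)
  qed
  moreover have "c > 0" using assms R' by (simp add: c_def)
  ultimately show ?thesis using that by blast
qed

text \<open>One factor \<open>L\<close> supplies the decay \<open>|s|^(\<gamma>-1)\<close>; the others are merely bounded.\<close>

lemma laplace_tail_power_decay:
  assumes \<nu>: "levy_measure \<nu>" and bg: "blumenthal_getoor \<nu> < 1" and "q \<ge> 0" "l > 0" "N \<ge> 1"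
  obtains \<gamma> B where "\<gamma> < 1"
    "\<And>s. Re s = l \<Longrightarrow> norm (laplace (tail_plus \<nu> q) s ^ N / s) \<le> B * norm s powr (\<gamma> - 2)"
proof -
  obtain \<gamma> K where b: "\<gamma> < 1" "K \<ge> 0"
    "\<And>s. Re s = l \<Longrightarrow> norm (laplace (tail_plus \<nu> q) s) \<le> K * norm s powr (\<gamma> - 1)"
    using laplace_tail_decay[OF assms(1-4)] by blast
  obtain n where N: "N = Suc n" using \<open>N \<ge> 1\<close> by (cases N) auto
  define B where "B = K * (K * l powr (\<gamma> - 1)) ^ n"
  have "norm (laplace (tail_plus \<nu> q) s ^ N / s) \<le> B * norm s powr (\<gamma> - 2)" if s: "Re s = l" for s
  proof -
    let ?L = "laplace (tail_plus \<nu> q) s"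
    have sl: "norm s \<ge> l" using complex_Re_le_cmod[of s] s by simp
    then have r: "norm s > 0" using assms by linarith
    have "norm ?L \<le> K * norm s powr (\<gamma> - 1)" using s by (rule b(3))
    also have "\<dots> \<le> K * l powr (\<gamma> - 1)" using sl assms b by (intro mult_left_mono powr_mono2') auto
    finally have "norm ?L ^ n \<le> (K * l powr (\<gamma> - 1)) ^ n" by (intro power_mono) auto
    then have "norm ?L * norm ?L ^ n / norm s \<le> (K * norm s powr (\<gamma> - 1)) * (K * l powr (\<gamma> - 1)) ^ n / norm s"
      using b s by (intro divide_right_mono mult_mono b(3)) auto
    also have "\<dots> = B * (norm s powr (\<gamma> - 1) / norm s powr 1)"
      using r by (simp add: B_def)
    also have "\<dots> = B * norm s powr (\<gamma> - 2)" unfolding powr_diff[symmetric] by simp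
    finally show ?thesis by (simp add: N norm_divide norm_mult norm_power)
  qed
  then show ?thesis using that b(1) by blast
qed

lemma remainder_transform_eq:
  assumes "\<delta> > 0"
  shows "remainder_transform \<nu> \<delta> N q s =
    (- laplace (tail_plus \<nu> q) s) ^ N / (s * of_real \<delta> ^ N * (of_real \<delta> + laplace (tail_plus \<nu> q) s))"
proof -
  have "of_real \<delta> ^ (N + 1) * (1 + 1 / of_real \<delta> * laplace (tail_plus \<nu> q) s)
     = of_real \<delta> ^ N * (of_real \<delta> + laplace (tail_plus \<nu> q) s)"
    using assms by (simp add: field_simps)
  then show ?thesis by (simp only: remainder_transform_def mult.assoc)
qed

lemma laplace_tail_measurable:
  assumes "levy_measure \<nu>"
  shows "(\<lambda>\<theta>. laplace (tail_plus \<nu> q) (Complex l \<theta>)) \<in> borel_measurable borel"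
proof -
  note [measurable] = tail_plus_measurable[OF assms]
  show ?thesis
    unfolding laplace_def set_lebesgue_integral_def Complex_eq by measurable
qed

lemma integrable_laplace_tail_power:
  assumes \<nu>: "levy_measure \<nu>" and bg: "blumenthal_getoor \<nu> < 1" and "q \<ge> 0" "l > 0" "N \<ge> 1"
  shows "integrable lborel (\<lambda>\<theta>. laplace (tail_plus \<nu> q) (Complex l \<theta>) ^ N / Complex l \<theta>)"
proof -
  note [measurable] = laplace_tail_measurable[OF \<nu>]
  have [measurable]: "Complex l \<in> borel_measurable borel" by (simp add: Complex_eq[abs_def])
  obtain \<gamma> B where B: "\<gamma> < 1"
    "\<And>s. Re s = l \<Longrightarrow> norm (laplace (tail_plus \<nu> q) s ^ N / s) \<le> B * norm s powr (\<gamma> - 2)"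
    using laplace_tail_power_decay[OF assms] by blast
  have dom: "integrable lborel (\<lambda>\<theta>. B * norm (Complex l \<theta>) powr (\<gamma> - 2))"
    using integrable_norm_Complex_powr[of l "\<gamma> - 2"] B assms by simp
  show ?thesis
  proof (rule Bochner_Integration.integrable_bound[OF dom])
    show "AE \<theta> in lborel. norm (laplace (tail_plus \<nu> q) (Complex l \<theta>) ^ N / Complex l \<theta>)
        \<le> norm (B * norm (Complex l \<theta>) powr (\<gamma> - 2))"
      by (intro AE_I2 order_trans[OF B(2)]) simp_all
  qed measurable
qed

lemma integrable_remainder_transform:
  assumes \<nu>: "levy_measure \<nu>" and bg: "blumenthal_getoor \<nu> < 1" and "\<delta> > 0" "q \<ge> 0" "l > 0" "N \<ge> 1"
  shows "integrable lborel (\<lambda>\<theta>. remainder_transform \<nu> \<delta> N q (Complex l \<theta>))"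
proof -
  note [measurable] = laplace_tail_measurable[OF \<nu>]
  have [measurable]: "Complex l \<in> borel_measurable borel" by (simp add: Complex_eq[abs_def])
  obtain \<gamma> B where B: "\<gamma> < 1"
    "\<And>s. Re s = l \<Longrightarrow> norm (laplace (tail_plus \<nu> q) s ^ N / s) \<le> B * norm s powr (\<gamma> - 2)"
    using laplace_tail_power_decay[OF \<nu> bg assms(4-6)] by blast
  obtain c where c: "c > 0" "\<And>s. Re s = l \<Longrightarrow> norm (of_real \<delta> + laplace (tail_plus \<nu> q) s) \<ge> c"
    using resolvent_bounded_below[OF assms(1-5)] by blast
  have dom: "integrable lborel (\<lambda>\<theta>. B / (\<delta> ^ N * c) * norm (Complex l \<theta>) powr (\<gamma> - 2))"
    using integrable_norm_Complex_powr[of l "\<gamma> - 2"] B assms by simp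
  show ?thesis
  proof (rule Bochner_Integration.integrable_bound[OF dom])
    show "AE \<theta> in lborel. norm (remainder_transform \<nu> \<delta> N q (Complex l \<theta>)) \<le> norm (B / (\<delta> ^ N * c) * norm (Complex l \<theta>) powr (\<gamma> - 2))"
    proof (intro AE_I2)
      fix \<theta>
      let ?s = "Complex l \<theta>" and ?L = "laplace (tail_plus \<nu> q) (Complex l \<theta>)"
      have s: "norm ?s > 0" using assms by (simp add: complex_eq_iff)
      have cL: "norm (of_real \<delta> + ?L) \<ge> c" by (rule c(2)) simp
      have "norm (remainder_transform \<nu> \<delta> N q ?s) = norm (?L ^ N / ?s) / (\<delta> ^ N * norm (of_real \<delta> + ?L))"
        using assms by (simp add: remainder_transform_eq norm_divide norm_mult norm_power)
      also have "\<dots> \<le> (B * norm ?s powr (\<gamma> - 2)) / (\<delta> ^ N * c)"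
      proof (rule frac_le)
        show "0 \<le> B * norm ?s powr (\<gamma> - 2)" by (rule order_trans[OF norm_ge_zero B(2)]) simp
        show "0 < \<delta> ^ N * c" using assms c by simp
        show "\<delta> ^ N * c \<le> \<delta> ^ N * norm (of_real \<delta> + ?L)" using cL assms by (intro mult_left_mono) auto
      qed (rule B(2), simp)
      finally show "norm (remainder_transform \<nu> \<delta> N q ?s) \<le> norm (B / (\<delta> ^ N * c) * norm ?s powr (\<gamma> - 2))"
        by (simp add: order_trans[OF _ abs_ge_self] del: abs_mult abs_divide)
    qed
    show "(\<lambda>\<theta>. remainder_transform \<nu> \<delta> N q (Complex l \<theta>)) \<in> borel_measurable lborel"
      unfolding remainder_transform_def by measurable
  qed
qed

section \<open>Convolution powers and pointwise Laplace inversion\<close>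

text \<open>If \<open>w\<close> exceeded \<open>c\<close> at \<open>x\<close>, it would do so by a fixed margin on an interval to the right of \<open>x\<close>.
  This is how densities are compared and shown to be nonnegative: only their integrals over intervals,
  which are masses, are accessible.\<close>

lemma continuous_le_if_integral_le:
  fixes w :: "real \<Rightarrow> real"
  assumes cont: "continuous_on {0<..} w"
    and le: "\<And>a b. 0 < a \<Longrightarrow> a < b \<Longrightarrow> (LINT x:{a<..b}|lborel. w x) \<le> c * (b - a)"
    and x: "x > 0"
  shows "w x \<le> c"
proof (rule ccontr)
  assume "\<not> w x \<le> c"
  define m where "m = (w x + c) / 2"
  have m: "c < m" "m < w x" using \<open>\<not> w x \<le> c\<close> by (auto simp: m_def)
  have "continuous (at x within {0<..}) w"
    using cont x by (auto simp: continuous_on_eq_continuous_within)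
  then have "(w \<longlongrightarrow> w x) (at x)"
    using x by (simp add: continuous_within at_within_open[OF _ open_greaterThan])
  then have "\<forall>\<^sub>F y in at x. m < w y" using m(2) by (rule order_tendstoD)
  then obtain d where d: "d > 0" "\<And>y. y \<noteq> x \<Longrightarrow> dist y x < d \<Longrightarrow> m < w y"
    by (auto simp: eventually_at)
  define b where "b = x + d / 2"
  have b: "x < b" using d by (simp add: b_def)
  have wm: "m \<le> w y" if "y \<in> {x<..b}" for y
    using that d by (intro less_imp_le d(2)) (auto simp: b_def dist_real_def)
  have int: "set_integrable lborel {x<..b} w"
    by (rule set_integrable_subset[of _ "{x..b}"])
      (use cont x in \<open>auto intro!: borel_integrable_atLeastAtMost' intro: continuous_on_subset\<close>)
  have "m * (b - x) = (LINT y:{x<..b}|lborel. m)"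
    using b by (simp add: set_lebesgue_integral_def)
  also have "\<dots> \<le> (LINT y:{x<..b}|lborel. w y)"
  proof (rule set_integral_mono)
    show "set_integrable lborel {x<..b} (\<lambda>_. m)"
      unfolding set_integrable_def
      by (intro integrable_scaleR_left integrable_real_indicator) (use b in auto)
  qed (use int wm in auto)
  also have "\<dots> \<le> c * (b - x)" using x b by (rule le)
  finally show False using m b by simp
qed

lemma continuous_eq_zero_if_integral_eq_zero:
  fixes D :: "real \<Rightarrow> complex"
  assumes cont: "continuous_on {0<..} D"
    and zero: "\<And>a b. 0 < a \<Longrightarrow> a < b \<Longrightarrow> (LINT x:{a<..b}|lborel. D x) = 0"
    and x: "x > 0"
  shows "D x = 0"
proof -
  have int: "set_integrable lborel {a<..b} D" if "0 < a" for a b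
    by (rule set_integrable_subset[of _ "{a..b}"])
      (use cont that in \<open>auto intro!: borel_integrable_atLeastAtMost' intro: continuous_on_subset\<close>)
  have Re: "(LINT x:{a<..b}|lborel. Re (D x)) = 0" and Im: "(LINT x:{a<..b}|lborel. Im (D x)) = 0"
    if "0 < a" "a < b" for a b
  proof -
    have i: "integrable lborel (\<lambda>x. indicator {a<..b} x *\<^sub>R D x)"
      and z: "(LINT x|lborel. indicator {a<..b} x *\<^sub>R D x) = 0"
      using int[OF that(1), of b] zero[OF that] by (simp_all only: set_integrable_def set_lebesgue_integral_def)
    show "(LINT x:{a<..b}|lborel. Re (D x)) = 0" "(LINT x:{a<..b}|lborel. Im (D x)) = 0"
      using integral_Re[OF i] integral_Im[OF i] z by (simp_all add: set_lebesgue_integral_def)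
  qed
  have "Re (D x) \<le> 0"
    by (rule continuous_le_if_integral_le[OF continuous_on_Re[OF cont] _ x]) (simp add: Re)
  moreover have "- Re (D x) \<le> 0"
    by (rule continuous_le_if_integral_le[OF continuous_on_minus[OF continuous_on_Re[OF cont]] _ x])
      (use Re in \<open>simp add: set_lebesgue_integral_def\<close>)
  moreover have "Im (D x) \<le> 0"
    by (rule continuous_le_if_integral_le[OF continuous_on_Im[OF cont] _ x]) (simp add: Im)
  moreover have "- Im (D x) \<le> 0"
    by (rule continuous_le_if_integral_le[OF continuous_on_minus[OF continuous_on_Im[OF cont]] _ x])
      (use Im in \<open>simp add: set_lebesgue_integral_def\<close>)
  ultimately show ?thesis by (simp add: complex_eq_iff)
qed

text \<open>The class of nonnegative causal functions that is closed under convolution and on which the Laplace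
  transform at abscissa \<open>l\<close> is multiplicative. Because such functions vanish on the left half-line,
  the convolution is an integral over the whole line. Its value may be the default \<open>0\<close> where that
  integral diverges, but this happens only on a null set.\<close>

definition laplace_summable :: "real \<Rightarrow> (real \<Rightarrow> real) \<Rightarrow> bool" where
  "laplace_summable l f \<longleftrightarrow> f \<in> borel_measurable borel \<and> (\<forall>x. 0 \<le> f x) \<and> (\<forall>x\<le>0. f x = 0) \<and>
     integrable lborel (\<lambda>x. exp (- l * x) * f x)"

lemma laplace_eq_integral:
  assumes "laplace_summable l f"
  shows "laplace f s = (LINT x|lborel. exp (- s * of_real x) * of_real (f x))"
  unfolding laplace_def set_lebesgue_integral_def
  using assms by (intro Bochner_Integration.integral_cong) (auto simp: laplace_summable_def indicator_def)

lemma laplace_summable_integrable: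
  assumes "laplace_summable l f" "Re s = l"
  shows "integrable lborel (\<lambda>x. exp (- s * of_real x) * of_real (f x))"
proof (rule Bochner_Integration.integrable_bound)
  show "integrable lborel (\<lambda>x. exp (- l * x) * f x)" using assms by (simp add: laplace_summable_def)
qed (use assms in \<open>auto simp: laplace_summable_def norm_mult\<close>)

text \<open>Multiplying by \<open>e^(-s x)\<close> commutes with convolution, so this is Fubini and translation invariance for
  two integrable functions.\<close>

lemma
  assumes f: "laplace_summable l f" and g: "laplace_summable l g"
  shows laplace_summable_convol: "laplace_summable l (convol f g)"
    and laplace_convol: "Re s = l \<Longrightarrow> laplace (convol f g) s = laplace f s * laplace g s"
proof -
  have [measurable]: "f \<in> borel_measurable borel" "g \<in> borel_measurable borel"
    using f g by (auto simp: laplace_summable_def)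
  have f0: "f x \<ge> 0" "x \<le> 0 \<Longrightarrow> f x = 0" and g0: "g x \<ge> 0" "x \<le> 0 \<Longrightarrow> g x = 0" for x
    using f g by (auto simp: laplace_summable_def)
  have fpos: "f x \<noteq> 0 \<Longrightarrow> 0 < x" and gpos: "g x \<noteq> 0 \<Longrightarrow> 0 < x" for x
    using f0(2) g0(2) not_le by blast+
  have conv: "convol f g x = (LINT y|lborel. f (x - y) * g y)" for x
    unfolding convol_def set_lebesgue_integral_def
    by (intro Bochner_Integration.integral_cong) (auto simp: indicator_def dest!: fpos gpos)
  have conv_meas: "convol f g \<in> borel_measurable borel"
    unfolding conv[abs_def] by measurable
  have conv0: "convol f g x \<ge> 0" for x
    unfolding conv by (intro Bochner_Integration.integral_nonneg mult_nonneg_nonneg f0 g0)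
  have main: "integrable lborel (\<lambda>x. exp (- s * of_real x) * complex_of_real (convol f g x)) \<and>
      (LINT x|lborel. exp (- s * of_real x) * complex_of_real (convol f g x)) = laplace f s * laplace g s"
    if s: "Re s = l" for s
  proof -
    define F where "F x = exp (- s * of_real x) * complex_of_real (f x)" for x
    define G where "G x = exp (- s * of_real x) * complex_of_real (g x)" for x
    have [measurable]: "F \<in> borel_measurable borel" "G \<in> borel_measurable borel"
      unfolding F_def G_def by measurable
    have iF: "integrable lborel F" unfolding F_def[abs_def] by (rule laplace_summable_integrable[OF f s])
    have iG: "integrable lborel G" unfolding G_def[abs_def] by (rule laplace_summable_integrable[OF g s])
    have iF': "integrable lborel (\<lambda>x. F (x - y))" for y
      using lborel_integrable_real_affine_iff[of 1 F "- y"] iF by simp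
    have shift: "(LINT x|lborel. k (x - y)) = (LINT x|lborel. k x)" for y and k :: "real \<Rightarrow> 'z::{banach, second_countable_topology}"
      using lborel_integral_real_affine[of 1 k "- y"] by simp
    have FG: "F (x - y) * G y = exp (- s * of_real x) * of_real (f (x - y) * g y)" for x y
      by (simp add: F_def G_def algebra_simps flip: exp_add)
    have pr: "integrable (lborel \<Otimes>\<^sub>M lborel) (\<lambda>(y, x). F (x - y) * G y)"
    proof (rule lborel_pair.Fubini_integrable)
      have "(LINT x|lborel. norm (F (x - y) * G y)) = (LINT x|lborel. norm (F x)) * norm (G y)" for y
        unfolding norm_mult using shift[of "\<lambda>x. norm (F x)" y] by simp
      then show "integrable lborel (\<lambda>y. LINT x|lborel. norm (case (y, x) of (y, x) \<Rightarrow> F (x - y) * G y))"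
        using iG by simp
      show "AE y in lborel. integrable lborel (\<lambda>x. case (y, x) of (y, x) \<Rightarrow> F (x - y) * G y)"
        using iF' by simp
    qed measurable
    have inner: "(LINT y|lborel. F (x - y) * G y) = exp (- s * of_real x) * of_real (convol f g x)" for x
      unfolding FG conv by (simp only: integral_mult_right_zero integral_complex_of_real)
    have "integrable lborel (\<lambda>x. LINT y|lborel. F (x - y) * G y)"
      using lborel_pair.integrable_snd[OF pr] .
    moreover have "(LINT x|lborel. LINT y|lborel. F (x - y) * G y) = (LINT y|lborel. LINT x|lborel. F (x - y) * G y)"
      using lborel_pair.Fubini_integral[OF pr] .
    moreover have "(LINT y|lborel. LINT x|lborel. F (x - y) * G y) = laplace f s * laplace g s"
    proof -
      have "laplace f s = integral\<^sup>L lborel F" "laplace g s = integral\<^sup>L lborel G"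
        unfolding laplace_eq_integral[OF f] laplace_eq_integral[OF g] F_def[abs_def] G_def[abs_def] by simp_all
      then show ?thesis using shift[of F] by simp
    qed
    ultimately show ?thesis unfolding inner by simp
  qed
  have "integrable lborel (\<lambda>x. norm (exp (- of_real l * of_real x) * complex_of_real (convol f g x)))"
    by (intro integrable_norm main[THEN conjunct1]) simp
  also have "(\<lambda>x. norm (exp (- of_real l * of_real x) * complex_of_real (convol f g x))) = (\<lambda>x. exp (- l * x) * convol f g x)"
    using conv0 by (simp add: norm_mult)
  finally show W: "laplace_summable l (convol f g)"
    using conv_meas conv0 unfolding laplace_summable_def by (auto simp: convol_def set_lebesgue_integral_def)
  show "laplace (convol f g) s = laplace f s * laplace g s" if "Re s = l"
    using main[OF that] by (simp add: laplace_eq_integral[OF W])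
qed

lemma
  assumes "l > 0"
  shows laplace_summable_heaviside: "laplace_summable l heaviside"
    and laplace_heaviside: "Re s = l \<Longrightarrow> laplace heaviside s = 1 / s"
proof -
  have "integrable lborel (\<lambda>x. norm (indicator {0<..} x *\<^sub>R exp (- of_real l * complex_of_real x)))"
    using set_integrable_exp_minus[of "of_real l"] assms unfolding set_integrable_def by (intro integrable_norm) simp
  also have "(\<lambda>x. norm (indicator {0<..} x *\<^sub>R exp (- of_real l * complex_of_real x))) = (\<lambda>x. exp (- l * x) * heaviside x)"
    by (auto simp: heaviside_def indicator_def)
  finally show "laplace_summable l heaviside"
    unfolding laplace_summable_def by (auto simp: heaviside_def[abs_def])
  show "laplace heaviside s = 1 / s" if "Re s = l"
  proof -
    have "laplace heaviside s = (LINT x:{0<..}|lborel. exp (- s * of_real x))"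
      unfolding laplace_def by (rule set_lebesgue_integral_cong) (auto simp: heaviside_def)
    then show ?thesis using integral_exp_minus_Ioi[of s] that assms by simp
  qed
qed

lemma laplace_convol_power:
  assumes "laplace_summable l f"
  shows "laplace_summable l (convol_power f (Suc n)) \<and>
    (\<forall>s. Re s = l \<longrightarrow> laplace (convol_power f (Suc n)) s = laplace f s ^ Suc n)"
proof (induction n)
  case 0
  then show ?case using assms by (simp add: convol_power_def)
next
  case (Suc n)
  have "convol_power f (Suc (Suc n)) = convol (convol_power f (Suc n)) f"
    by (simp add: convol_power_def)
  then show ?case
    using laplace_summable_convol[OF conjunct1[OF Suc] assms] laplace_convol[OF conjunct1[OF Suc] assms] Suc
    by (simp add: mult.commute)
qed

text \<open>The powers \<open>f^(*n)\<close> are in general unbounded and meaningful only almost everywhere. Convolving with the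
  Heaviside function integrates them, which restores continuity and allows inversion at every point.\<close>

lemma
  assumes f: "laplace_summable l f" and l: "l > 0" and n: "n \<ge> 1"
  shows laplace_summable_heaviside_convol_power: "laplace_summable l (heaviside_convol_power f n)"
    and laplace_heaviside_convol_power: "Re s = l \<Longrightarrow> laplace (heaviside_convol_power f n) s = laplace f s ^ n / s"
    and continuous_heaviside_convol_power: "continuous_on {0<..} (heaviside_convol_power f n)"
proof -
  obtain m where m: "n = Suc m" using n by (cases n) auto
  define p where "p = convol_power f n"
  have p: "laplace_summable l p" "\<And>s. Re s = l \<Longrightarrow> laplace p s = laplace f s ^ n"
    using laplace_convol_power[OF f, of m] by (auto simp: p_def m)
  have eq: "heaviside_convol_power f n = convol heaviside p"
    using n by (simp add: heaviside_convol_power_def[abs_def] p_def)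
  show "laplace_summable l (heaviside_convol_power f n)"
    unfolding eq by (intro laplace_summable_convol laplace_summable_heaviside l p)
  show "laplace (heaviside_convol_power f n) s = laplace f s ^ n / s" if "Re s = l"
    unfolding eq using that by (simp add: laplace_convol[OF laplace_summable_heaviside[OF l] p(1)] laplace_heaviside[OF l] p(2))
  have [measurable]: "p \<in> borel_measurable borel" and p0: "\<And>x. p x \<ge> 0"
    using p by (auto simp: laplace_summable_def)
  have intp: "set_integrable lborel {0..b} p" if "b \<ge> 0" for b
    unfolding set_integrable_def
  proof (rule Bochner_Integration.integrable_bound)
    show "integrable lborel (\<lambda>x. exp (l * b) * (exp (- l * x) * p x))"
      using p(1) by (simp add: laplace_summable_def)
    show "AE x in lborel. norm (indicator {0..b} x *\<^sub>R p x) \<le> norm (exp (l * b) * (exp (- l * x) * p x))"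
    proof (intro AE_I2)
      fix x
      have "1 * p x \<le> exp (l * b + (- l * x)) * p x" if "x \<le> b"
        using that l by (intro mult_right_mono p0) simp
      then show "norm (indicator {0..b} x *\<^sub>R p x) \<le> norm (exp (l * b) * (exp (- l * x) * p x))"
        using p0[of x] by (auto simp: indicator_def abs_mult exp_diff exp_minus divide_inverse mult_ac)
    qed
  qed measurable
  have val: "heaviside_convol_power f n x = integral {0..x} p" if "x > 0" for x
  proof -
    have "heaviside_convol_power f n x = (LINT y:{0<..<x}|lborel. p y)"
      unfolding eq convol_def by (rule set_lebesgue_integral_cong) (auto simp: heaviside_def)
    also have "\<dots> = integral {0<..<x} p"
      by (rule set_borel_integral_eq_integral(2), rule set_integrable_subset[OF intp[of x]]) (use that in auto)
    also have "\<dots> = integral {0..x} p" by (simp add: integral_open_interval_real)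
    finally show ?thesis .
  qed
  have "continuous_on {0<..<b} (heaviside_convol_power f n)" if b: "b > 0" for b
  proof -
    have "continuous_on {0..b} (\<lambda>x. integral {0..x} p)"
      using set_borel_integral_eq_integral(1)[OF intp[of b]] b by (intro indefinite_integral_continuous_1) simp
    then have "continuous_on {0<..<b} (\<lambda>x. integral {0..x} p)" by (rule continuous_on_subset) auto
    then show ?thesis by (rule continuous_on_eq) (use val in auto)
  qed
  then have "continuous_on (\<Union>b\<in>{0<..}. {0<..<b}) (heaviside_convol_power f n)"
    by (intro continuous_on_open_UN) auto
  moreover have "x \<in> (\<Union>b\<in>{0<..}. {0<..<b})" if "x > 0" for x :: real
    using that by (intro UN_I[of "x + 1"]) auto
  then have "(\<Union>b\<in>{0<..}. {0<..<b}) = {0::real<..}" by auto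
  ultimately show "continuous_on {0<..} (heaviside_convol_power f n)" by simp
qed

text \<open>Fourier inversion of the finite measure \<open>e^(-l x) k(x) dx\<close>, compared with the zero measure, gives
  the equality of the integrals over all intervals; continuity on \<open>(0, \<infinity>)\<close> makes it pointwise.\<close>

lemma laplace_inversion_pointwise:
  assumes k: "laplace_summable l k" and cont: "continuous_on {0<..} k"
    and int: "integrable lborel (\<lambda>\<theta>. laplace k (Complex l \<theta>))" and x: "x > 0"
  shows "complex_of_real (k x) =
    of_real (exp (l * x)) * (1 / (2 * of_real pi)) * (LINT \<theta>|lborel. iexp (\<theta> * x) * laplace k (Complex l \<theta>))"
proof -
  define r where "r x = exp (- l * x) * k x" for x
  define h where "h x = 1 / (2 * complex_of_real pi) * (LINT \<theta>|lborel. iexp (\<theta> * x) * laplace k (Complex l \<theta>))" for x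
  have [measurable]: "k \<in> borel_measurable borel" and k0: "\<And>x. k x \<ge> 0"
    using k by (auto simp: laplace_summable_def)
  have [measurable]: "r \<in> borel_measurable borel" unfolding r_def by measurable
  have r0: "r x \<ge> 0" for x using k0 by (simp add: r_def)
  have ir: "integrable lborel r" using k by (simp add: laplace_summable_def r_def[abs_def])
  define M1 where "M1 = density lborel (\<lambda>x. ennreal (r x))"
  define M2 where "M2 = (density lborel (\<lambda>_. 0) :: real measure)"
  have eM1: "emeasure M1 A = ennreal (LINT x:A|lborel. r x)" if "A \<in> sets borel" for A
  proof -
    have "integrable lborel (\<lambda>x. indicator A x * r x)"
      using integrable_mult_indicator[of A lborel r] ir that by simp
    then show ?thesis using that r0 unfolding M1_def set_lebesgue_integral_def
      by (simp add: emeasure_density, subst nn_integral_eq_integral[symmetric])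
         (auto intro!: nn_integral_cong split: split_indicator)
  qed
  have mM1: "measure M1 A = (LINT x:A|lborel. r x)" if "A \<in> sets borel" for A
    using eM1[OF that] r0 unfolding measure_def set_lebesgue_integral_def
    by (simp add: Bochner_Integration.integral_nonneg)
  have M1: "finite_measure M1" "sets M1 = sets borel"
    by (rule finite_measureI) (auto simp: eM1 M1_def[THEN arg_cong[where f = sets]] M1_def[THEN arg_cong[where f = space]])
  have M2: "finite_measure M2" "sets M2 = sets borel"
    by (rule finite_measureI) (auto simp: M2_def emeasure_density)
  have mM2: "measure M2 A = 0" if "A \<in> sets borel" for A
    unfolding M2_def using that by (subst measure_density_const) auto
  have atom1: "measure M1 {y} = 0" for y
  proof -
    have "AE x in lborel. x \<noteq> y" by (auto intro!: AE_I[where N = "{y}"])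
    then have "(LINT x:{y}|lborel. r x) = 0"
      unfolding set_lebesgue_integral_def by (intro integral_eq_zero_AE) (auto elim!: eventually_mono)
    then show ?thesis by (simp add: mM1)
  qed
  have G: "laplace k (Complex l \<theta>) = (CLINT x|M1. iexp (- (\<theta> * x))) - (CLINT x|M2. iexp (- (\<theta> * x)))" for \<theta>
  proof -
    have "(CLINT x|M1. iexp (- (\<theta> * x))) = (LINT x|lborel. r x *\<^sub>R iexp (- (\<theta> * x)))"
      unfolding M1_def using r0 by (subst integral_density) auto
    also have "\<dots> = (LINT x|lborel. exp (- Complex l \<theta> * of_real x) * of_real (k x))"
      by (intro Bochner_Integration.integral_cong refl)
         (simp add: r_def scaleR_conv_of_real Complex_eq algebra_simps exp_add exp_diff exp_minus divide_inverse flip: exp_of_real)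
    also have "\<dots> = laplace k (Complex l \<theta>)" by (rule laplace_eq_integral[OF k, symmetric])
    finally have "(CLINT x|M1. iexp (- (\<theta> * x))) = laplace k (Complex l \<theta>)" .
    moreover have "(CLINT x|M2. iexp (- (\<theta> * x))) = 0"
      unfolding M2_def by (subst integral_density[where g = "\<lambda>_. 0", simplified]) auto
    ultimately show ?thesis by simp
  qed
  have hc: "continuous_on UNIV h"
    unfolding h_def by (intro continuous_intros continuous_inverse_fourier int)
  have "of_real (r x) - h x = 0"
  proof (rule continuous_eq_zero_if_integral_eq_zero[OF _ _ x])
    show "continuous_on {0<..} (\<lambda>x. of_real (r x) - h x)"
      unfolding r_def by (intro continuous_intros cont continuous_on_subset[OF hc]) auto
    fix a b :: real assume ab: "0 < a" "a < b"
    have ih: "set_integrable lborel {a<..b} h"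
      by (rule set_integrable_subset[of _ "{a..b}"])
        (auto intro!: borel_integrable_atLeastAtMost' intro: continuous_on_subset[OF hc])
    have irab: "set_integrable lborel {a<..b} (\<lambda>x. complex_of_real (r x))"
      unfolding set_integrable_def using ir by (intro integrable_mult_indicator) auto
    have "complex_of_real (measure M1 {a<..b} - measure M2 {a<..b}) = (CLBINT x:{a<..b}. h x)"
      unfolding h_def
      using fourier_inversion_difference[OF M1 atom1 M2 _ G int, of a b] ab
      by (simp add: mM2)
    then have "(LINT x:{a<..b}|lborel. h x) = of_real (LINT x:{a<..b}|lborel. r x)"
      by (simp add: mM1 mM2)
    also have "\<dots> = (LINT x:{a<..b}|lborel. complex_of_real (r x))"
      by (rule set_integral_complex_of_real[symmetric])
    finally show "(LINT x:{a<..b}|lborel. of_real (r x) - h x) = 0"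
      using irab ih by (simp add: set_integral_diff)
  qed
  then have hr: "of_real (r x) = h x" by simp
  have "complex_of_real (k x) = of_real (exp (l * x)) * of_real (r x)"
    by (simp add: r_def exp_minus)
  then show ?thesis unfolding hr unfolding h_def by (simp only: mult.assoc)
qed

section \<open>The Laplace exponent of the subordinator\<close>

lemma jump_nonneg:
  assumes mono: "\<And>s t. 0 \<le> s \<Longrightarrow> s \<le> t \<Longrightarrow> w s \<le> w t"
    and llim: "\<And>t. t > 0 \<Longrightarrow> \<exists>l. (w \<longlongrightarrow> l) (at_left t)" and s: "s > 0"
  shows "jump w s \<ge> 0"
proof -
  obtain l where l: "(w \<longlongrightarrow> l) (at_left s)" using llim[OF s] by blast
  have "\<forall>\<^sub>F u in at_left s. u \<in> {0<..<s}"
    using s by (intro eventually_at_leftI[of 0]) auto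
  then have "\<forall>\<^sub>F u in at_left s. w u \<le> w s"
    by eventually_elim (auto intro: mono)
  then have "l \<le> w s" by (intro tendsto_upperbound[OF l]) auto
  moreover have "Lim (at_left s) w = l" by (intro tendsto_Lim l) simp
  ultimately show ?thesis by (simp add: jump_def)
qed

lemma drift_path_increment_ge:
  assumes jump0: "\<And>s. s > 0 \<Longrightarrow> jump w s \<ge> 0"
    and hs: "\<And>t. t \<ge> 0 \<Longrightarrow> (jump w has_sum (w t - \<delta> * t)) {0<..t}"
    and "0 \<le> s" "s \<le> t"
  shows "w t - w s \<ge> \<delta> * (t - s)"
proof -
  have "w s - \<delta> * s \<le> w t - \<delta> * t"
    by (rule has_sum_mono2[OF hs hs]) (use assms in auto)
  then show ?thesis by (simp add: algebra_simps)
qed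

definition time_measure :: "real measure" where
  "time_measure = density lborel (indicator {0<..})"

lemma sets_time_measure [simp, measurable_cong]: "sets time_measure = sets borel"
  by (simp add: time_measure_def)

lemma sigma_finite_time_measure: "sigma_finite_measure time_measure"
  unfolding time_measure_def
  by (subst sigma_finite_measure.sigma_finite_iff_density_finite'[OF sigma_finite_lborel])
    (auto split: split_indicator)

lemma emeasure_time_measure_Ioc:
  assumes "t \<ge> 0"
  shows "emeasure time_measure {0<..t} = ennreal t"
proof -
  have "emeasure time_measure {0<..t} = (\<integral>\<^sup>+x. indicator {0<..} x * indicator {0<..t} x \<partial>lborel)"
    unfolding time_measure_def by (rule emeasure_density) auto
  also have "\<dots> = (\<integral>\<^sup>+x. indicator {0<..t} x \<partial>lborel)"
    by (intro nn_integral_cong) (auto split: split_indicator)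
  finally show ?thesis using assms by simp
qed

text \<open>The integral of this function over the jump measure is the sum of the jumps up to time \<open>t\<close>. Cutting
  off negative sizes makes it nonnegative everywhere and changes nothing almost surely, as a
  nondecreasing path only jumps upwards.\<close>

definition jump_size_upto :: "real \<Rightarrow> real \<times> real \<Rightarrow> real" where
  "jump_size_upto t p = indicator {0<..t} (fst p) * max 0 (snd p)"

lemma jump_size_upto_nonneg: "jump_size_upto t p \<ge> 0"
  by (simp add: jump_size_upto_def)

lemma jump_size_upto_measurable:
  assumes "levy_measure \<nu>"
  shows "jump_size_upto t \<in> borel_measurable (time_measure \<Otimes>\<^sub>M \<nu>)"
proof -
  note [measurable_cong] = levy_measure_sets[OF assms]
  show ?thesis unfolding jump_size_upto_def[abs_def] by measurable
qed

lemma jump_intensity_finite: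
  assumes \<nu>: "levy_measure \<nu>" and t: "t \<ge> 0"
  shows "(\<integral>\<^sup>+p. ennreal (min 1 (jump_size_upto t p)) \<partial>(time_measure \<Otimes>\<^sub>M \<nu>)) < \<infinity>"
proof -
  note [measurable_cong] = levy_measure_sets[OF \<nu>]
  note [measurable] = jump_size_upto_measurable[OF \<nu>]
  interpret \<nu>: sigma_finite_measure \<nu> by (rule levy_measure_sigma_finite[OF \<nu>])
  have "(\<integral>\<^sup>+p. ennreal (min 1 (jump_size_upto t p)) \<partial>(time_measure \<Otimes>\<^sub>M \<nu>))
      = (\<integral>\<^sup>+u. (\<integral>\<^sup>+x. ennreal (min 1 (jump_size_upto t (u, x))) \<partial>\<nu>) \<partial>time_measure)"
    by (rule \<nu>.nn_integral_fst[symmetric]) measurable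
  also have "\<dots> = (\<integral>\<^sup>+u. (\<integral>\<^sup>+x. ennreal (min 1 x) \<partial>\<nu>) * indicator {0<..t} u \<partial>time_measure)"
  proof (intro nn_integral_cong)
    fix u
    have "ennreal (min 1 (max 0 x)) = ennreal (min 1 x)" for x :: real
      by (auto simp: max_def min_def ennreal_neg)
    then show "(\<integral>\<^sup>+x. ennreal (min 1 (jump_size_upto t (u, x))) \<partial>\<nu>) = (\<integral>\<^sup>+x. ennreal (min 1 x) \<partial>\<nu>) * indicator {0<..t} u"
      by (auto simp: jump_size_upto_def split: split_indicator)
  qed
  also have "\<dots> = (\<integral>\<^sup>+x. ennreal (min 1 x) \<partial>\<nu>) * ennreal t"
    by (simp add: nn_integral_cmult_indicator emeasure_time_measure_Ioc[OF t])
  also have "\<dots> < \<infinity>" using \<nu> by (simp add: levy_measure_def ennreal_mult_less_top)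
  finally show ?thesis .
qed

lemma jump_intensity_exponent:
  assumes \<nu>: "levy_measure \<nu>" and t: "t \<ge> 0" and s: "Re s \<ge> 0"
  shows "(LINT p|(time_measure \<Otimes>\<^sub>M \<nu>). 1 - exp (- s * of_real (jump_size_upto t p)))
    = of_real t * (LINT x|\<nu>. 1 - exp (- s * of_real x))"
proof -
  let ?f = "jump_size_upto t"
  note [measurable_cong] = levy_measure_sets[OF \<nu>]
  note [measurable] = jump_size_upto_measurable[OF \<nu>]
  interpret \<nu>: sigma_finite_measure \<nu> by (rule levy_measure_sigma_finite[OF \<nu>])
  interpret T: sigma_finite_measure time_measure by (rule sigma_finite_time_measure)
  interpret P: pair_sigma_finite time_measure \<nu> by unfold_locales
  have "integrable (time_measure \<Otimes>\<^sub>M \<nu>) (\<lambda>p. min 1 (?f p))"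
    by (rule integrableI_bounded) (use jump_intensity_finite[OF \<nu> t] jump_size_upto_nonneg in auto)
  then have int: "integrable (time_measure \<Otimes>\<^sub>M \<nu>) (\<lambda>p. 1 - exp (- s * of_real (?f p)))"
  proof (rule Bochner_Integration.integrable_bound[OF integrable_mult_right[of "max 2 (norm s)"]])
    show "AE p in time_measure \<Otimes>\<^sub>M \<nu>. norm (1 - exp (- s * of_real (?f p))) \<le> norm (max 2 (norm s) * min 1 (?f p))"
    proof (intro AE_I2)
      fix p
      have "norm (1 - exp (- s * of_real (?f p))) \<le> max 2 (norm s) * min 1 (?f p)"
        by (rule norm_one_minus_exp_minus_scaled_le[OF s jump_size_upto_nonneg])
      then show "norm (1 - exp (- s * of_real (?f p))) \<le> norm (max 2 (norm s) * min 1 (?f p))"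
        by (simp only: real_norm_def order_trans[OF _ abs_ge_self])
    qed
  qed measurable
  have "(LINT p|(time_measure \<Otimes>\<^sub>M \<nu>). 1 - exp (- s * of_real (?f p)))
      = (LINT u|time_measure. LINT x|\<nu>. 1 - exp (- s * of_real (?f (u, x))))"
    by (rule P.integral_fst'[OF int, symmetric])
  also have "\<dots> = (LINT u|time_measure. indicator {0<..t} u *\<^sub>R (LINT x|\<nu>. 1 - exp (- s * of_real x)))"
  proof (intro Bochner_Integration.integral_cong refl)
    fix u
    have "(LINT x|\<nu>. 1 - exp (- s * of_real (max 0 x))) = (LINT x|\<nu>. 1 - exp (- s * of_real x))"
    proof (rule integral_cong_AE)
      show "AE x in \<nu>. 1 - exp (- s * of_real (max 0 x)) = 1 - exp (- s * of_real x)"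
        using levy_measure_AE_pos[OF \<nu>] by eventually_elim simp
    qed measurable
    then show "(LINT x|\<nu>. 1 - exp (- s * of_real (?f (u, x)))) = indicator {0<..t} u *\<^sub>R (LINT x|\<nu>. 1 - exp (- s * of_real x))"
      by (auto simp: jump_size_upto_def split: split_indicator)
  qed
  also have "\<dots> = of_real t * (LINT x|\<nu>. 1 - exp (- s * of_real x))"
  proof -
    have "integrable time_measure (indicator {0<..t} :: real \<Rightarrow> real)"
      by (rule integrable_real_indicator) (use emeasure_time_measure_Ioc[OF t] in auto)
    then show ?thesis
      using emeasure_time_measure_Ioc[OF t] t
      by (simp add: integral_scaleR_left measure_def scaleR_conv_of_real)
  qed
  finally show ?thesis .
qed

lemma nn_integral_jump_measure:
  assumes jump0: "\<And>s. s > 0 \<Longrightarrow> jump w s \<ge> 0"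
    and hs: "(jump w has_sum (w t - \<delta> * t)) {0<..t}"
  shows "(\<integral>\<^sup>+p. ennreal (jump_size_upto t p) \<partial>jump_measure w) = ennreal (w t - \<delta> * t)"
proof -
  define J where "J = {s. 0 < s \<and> jump w s \<noteq> 0}"
  define f where "f s = indicator {0<..t} s * jump w s" for s
  have f0: "f s \<ge> 0" if "s \<in> J" for s using that jump0 by (auto simp: f_def J_def)
  have "(\<integral>\<^sup>+p. ennreal (jump_size_upto t p) \<partial>jump_measure w)
      = (\<integral>\<^sup>+s. ennreal (indicator {0<..t} s * max 0 (jump w s)) \<partial>count_space J)"
    unfolding jump_measure_def J_def jump_size_upto_def by (subst nn_integral_distr) (auto simp: space_pair_measure)
  also have "\<dots> = (\<integral>\<^sup>+s. ennreal (f s) \<partial>count_space J)"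
    using jump0 by (intro nn_integral_cong) (auto simp: f_def J_def)
  also have "\<dots> = ennreal (w t - \<delta> * t)"
  proof -
    have hJ: "(f has_sum (w t - \<delta> * t)) J"
      by (rule iffD1[OF has_sum_cong_neutral hs]) (auto simp: f_def J_def)
    then have "f summable_on J" by (rule has_sum_imp_summable)
    then have "(\<lambda>s. norm (f s)) summable_on J"
      using f0 by (subst summable_on_cong[where g = f]) auto
    then have abs: "Infinite_Set_Sum.abs_summable_on f J"
      using abs_summable_equivalent[of f J] by blast
    have "integral\<^sup>L (count_space J) f = w t - \<delta> * t"
      using infsetsum_infsum[OF abs] infsumI[OF hJ] by (simp add: infsetsum_def)
    then show ?thesis
      using abs f0 unfolding Infinite_Set_Sum.abs_summable_on_def
      by (subst nn_integral_eq_integral) (auto simp: AE_count_space)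
  qed
  finally show ?thesis .
qed

lemma subordinator_AE_paths:
  assumes sub: "subordinator M X" and drift: "has_drift_and_levy_measure M X \<delta> \<nu>"
  shows "AE \<omega> in M. X 0 \<omega> = 0 \<and>
    (\<forall>t\<ge>0. ((\<lambda>s. X s \<omega>) \<longlongrightarrow> X t \<omega>) (at_right t)) \<and>
    (\<forall>s>0. jump (\<lambda>t. X t \<omega>) s \<ge> 0) \<and>
    (\<forall>t\<ge>0. (jump (\<lambda>s. X s \<omega>) has_sum (X t \<omega> - \<delta> * t)) {0<..t})"
proof -
  have "AE \<omega> in M. X 0 \<omega> = 0"
    "AE \<omega> in M. (\<forall>t\<ge>0. ((\<lambda>s. X s \<omega>) \<longlongrightarrow> X t \<omega>) (at_right t)) \<and> (\<forall>t>0. \<exists>l. ((\<lambda>s. X s \<omega>) \<longlongrightarrow> l) (at_left t))"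
    "AE \<omega> in M. \<forall>s t. 0 \<le> s \<longrightarrow> s \<le> t \<longrightarrow> X s \<omega> \<le> X t \<omega>"
    "AE \<omega> in M. \<forall>t\<ge>0. (jump (\<lambda>s. X s \<omega>) has_sum (X t \<omega> - \<delta> * t)) {0<..t}"
    using sub drift by (simp_all add: subordinator_def levy_process_def has_drift_and_levy_measure_def)
  then show ?thesis
  proof eventually_elim
    case (elim \<omega>)
    have "jump (\<lambda>t. X t \<omega>) s \<ge> 0" if "s > 0" for s
      using elim by (intro jump_nonneg[OF _ _ that]) auto
    then show ?case using elim by blast
  qed
qed

text \<open>The Levy-Khintchine formula: \<open>X_t - \<delta> t\<close> is the integral of \<open>jump_size_upto t\<close> over the random
  measure of the jumps, whose intensity up to time \<open>t\<close> is \<open>t\<close> times \<open>\<nu>\<close>.\<close>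

lemma subordinator_laplace:
  assumes sub: "subordinator M X" and drift: "has_drift_and_levy_measure M X \<delta> \<nu>"
    and "\<delta> \<ge> 0" and t: "t \<ge> 0" and s: "Re s \<ge> 0"
  shows "(LINT \<omega>|M. exp (- s * of_real (X t \<omega>))) = exp (- of_real t * laplace_exponent \<nu> \<delta> s)"
proof -
  have M: "prob_space M" and [measurable]: "X t \<in> borel_measurable M"
    using sub t by (auto simp: subordinator_def levy_process_def)
  have \<nu>: "levy_measure \<nu>" using drift by (simp add: has_drift_and_levy_measure_def)
  obtain N where N: "poisson_random_measure M (time_measure \<Otimes>\<^sub>M \<nu>) N"
    and NJ: "AE \<omega> in M. N \<omega> = jump_measure (\<lambda>t. X t \<omega>)"
    using drift by (auto simp: has_drift_and_levy_measure_def time_measure_def)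
  define Y where "Y \<omega> = X t \<omega> - \<delta> * t" for \<omega>
  have "(LINT \<omega>|M. exp (- s * of_real (Y \<omega>))) = exp (- (of_real t * (LINT x|\<nu>. 1 - exp (- s * of_real x))))"
    unfolding jump_intensity_exponent[OF \<nu> t s, symmetric]
  proof (rule poisson_laplace_functional[OF M N jump_size_upto_measurable[OF \<nu>] jump_size_upto_nonneg
        jump_intensity_finite[OF \<nu> t]])
    show "Y \<in> borel_measurable M" unfolding Y_def by measurable
    show "AE \<omega> in M. (\<integral>\<^sup>+p. ennreal (jump_size_upto t p) \<partial>N \<omega>) = ennreal (Y \<omega>) \<and> Y \<omega> \<ge> 0"
      using NJ subordinator_AE_paths[OF sub drift]
    proof eventually_elim
      case (elim \<omega>)
      have "X t \<omega> - X 0 \<omega> \<ge> \<delta> * (t - 0)"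
        by (rule drift_path_increment_ge) (use elim t in auto)
      then show ?case
        using nn_integral_jump_measure[of "\<lambda>t. X t \<omega>" t \<delta>] elim t by (auto simp: Y_def)
    qed
  qed (use s in auto)
  moreover have "exp (- s * of_real (X t \<omega>)) = exp (- s * of_real (\<delta> * t)) * exp (- s * of_real (Y \<omega>))" for \<omega>
    by (simp add: Y_def algebra_simps flip: exp_add)
  ultimately have "(LINT \<omega>|M. exp (- s * of_real (X t \<omega>))) = exp (- s * of_real (\<delta> * t)) * exp (- (of_real t * (LINT x|\<nu>. 1 - exp (- s * of_real x))))"
    by (simp only: integral_mult_right_zero)
  then show ?thesis by (simp add: laplace_exponent_def algebra_simps flip: exp_add)
qed

section \<open>The potential measure\<close>

text \<open>The pathwise properties of a subordinator with drift \<open>\<delta>\<close>, but for all times and all outcomes. This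
  is the form in which the resolvent can be treated as an integral over a product space.\<close>

locale drift_increasing_process = prob_space M for M :: "'a measure" +
  fixes Y :: "real \<Rightarrow> 'a \<Rightarrow> real" and \<delta> q :: real
  assumes Y_measurable [measurable]: "\<And>t. Y t \<in> borel_measurable M"
    and Y_right_continuous: "\<And>t \<omega>. \<omega> \<in> space M \<Longrightarrow> ((\<lambda>s. Y s \<omega>) \<longlongrightarrow> Y t \<omega>) (at_right t)"
    and Y_increment: "\<And>s t \<omega>. \<omega> \<in> space M \<Longrightarrow> s \<le> t \<Longrightarrow> \<delta> * (t - s) \<le> Y t \<omega> - Y s \<omega>"
    and Y_zero: "\<And>\<omega>. \<omega> \<in> space M \<Longrightarrow> Y 0 \<omega> = 0"
    and delta_pos: "\<delta> > 0" and q_nonneg: "q \<ge> 0"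
begin

lemma Y_ge: "\<omega> \<in> space M \<Longrightarrow> t \<ge> 0 \<Longrightarrow> \<delta> * t \<le> Y t \<omega>"
  using Y_increment[of \<omega> 0 t] by (simp add: Y_zero)

text \<open>By right continuity \<open>Y\<close> is the limit of the processes that are frozen on each cell of a mesh at the
  value at the right end of the cell.\<close>

lemma Y_jointly_measurable [measurable]: "(\<lambda>p. Y (fst p) (snd p)) \<in> borel_measurable (borel \<Otimes>\<^sub>M M)"
proof (rule borel_measurable_LIMSEQ_real)
  (* The first multiple of 1 / (n + 1) strictly after t, so that t is approached from the right. *)
  define \<tau> where "\<tau> n t = of_int (\<lfloor>real (Suc n) * t\<rfloor> + 1) / real (Suc n)" for n and t :: real
  show "(\<lambda>p. Y (\<tau> n (fst p)) (snd p)) \<in> borel_measurable (borel \<Otimes>\<^sub>M M)" for n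
    unfolding \<tau>_def
    by (rule measurable_compose_countable[where g = "\<lambda>p. \<lfloor>real (Suc n) * fst p\<rfloor>"
          and f = "\<lambda>i p. Y (of_int (i + 1) / real (Suc n)) (snd p)"]) measurable
  fix p :: "real \<times> 'a" assume "p \<in> space (borel \<Otimes>\<^sub>M M)"
  then have \<omega>: "snd p \<in> space M" by (auto simp: space_pair_measure)
  define t where "t = fst p"
  have gt: "\<tau> n t > t" for n
    unfolding \<tau>_def by (simp add: field_simps del: of_nat_Suc) linarith
  have le: "\<tau> n t \<le> t + 1 / real (Suc n)" for n
    unfolding \<tau>_def by (simp add: field_simps del: of_nat_Suc)
  have "(\<lambda>n. \<tau> n t) \<longlonglongrightarrow> t"
  proof (rule tendsto_sandwich[OF _ _ tendsto_const])
    show "(\<lambda>n. t + 1 / real (Suc n)) \<longlonglongrightarrow> t"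
      using tendsto_add[OF tendsto_const LIMSEQ_inverse_real_of_nat, of t] by (simp add: divide_inverse)
  qed (use gt le in \<open>auto intro!: always_eventually less_imp_le\<close>)
  then have "filterlim (\<lambda>n. \<tau> n t) (at_right t) sequentially"
    using gt by (simp add: filterlim_at less_imp_neq[THEN not_sym])
  from filterlim_compose[OF Y_right_continuous[OF \<omega>] this]
  show "(\<lambda>n. Y (\<tau> n (fst p)) (snd p)) \<longlonglongrightarrow> Y (fst p) (snd p)" by (simp add: t_def)
qed

definition weight :: "real \<Rightarrow> real" where
  "weight t = indicator {0<..} t * exp (- q * t)"

lemma weight_measurable [measurable]: "weight \<in> borel_measurable borel"
  unfolding weight_def by measurable

lemma weight_nonneg: "weight t \<ge> 0"
  by (simp add: weight_def)

text \<open>The \<open>q\<close>-potential measure as an image measure, for which countable additivity is automatic and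
  integrals can be transformed.\<close>

definition U :: "real measure" where
  "U = distr (density (lborel \<Otimes>\<^sub>M M) (\<lambda>p. ennreal (weight (fst p)))) borel (\<lambda>p. Y (fst p) (snd p))"

lemma sets_U [simp, measurable_cong]: "sets U = sets borel"
  and space_U [simp]: "space U = UNIV"
  by (simp_all add: U_def)

lemma emeasure_U:
  assumes [measurable]: "B \<in> sets borel"
  shows "emeasure U B = (\<integral>\<^sup>+\<omega>. (\<integral>\<^sup>+t. ennreal (weight t) * indicator B (Y t \<omega>) \<partial>lborel) \<partial>M)"
proof -
  interpret P: pair_sigma_finite lborel M by unfold_locales
  have "emeasure U B = (\<integral>\<^sup>+p. ennreal (weight (fst p)) * indicator B (Y (fst p) (snd p)) \<partial>(lborel \<Otimes>\<^sub>M M))"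
    unfolding U_def
    by (subst nn_integral_indicator[symmetric], simp, subst nn_integral_distr, simp, simp, subst nn_integral_density) auto
  also have "\<dots> = (\<integral>\<^sup>+\<omega>. (\<integral>\<^sup>+t. ennreal (weight t) * indicator B (Y t \<omega>) \<partial>lborel) \<partial>M)"
    by (subst P.nn_integral_snd[symmetric]) auto
  finally show ?thesis .
qed

text \<open>Two times at which a path lies in \<open>(a, b]\<close> differ by at most \<open>(b - a) / \<delta>\<close>, since the path gains at
  least \<open>\<delta>\<close> per unit of time. So this bound holds for the time spent in the interval, path by path.\<close>

lemma emeasure_U_Ioc_le:
  assumes "a \<le> b"
  shows "emeasure U {a<..b} \<le> ennreal ((b - a) / \<delta>)"
proof -
  define d where "d = (b - a) / \<delta>"
  have d: "d \<ge> 0" using assms delta_pos by (simp add: d_def)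
  have "(\<integral>\<^sup>+t. ennreal (weight t) * indicator {a<..b} (Y t \<omega>) \<partial>lborel) \<le> ennreal d" if \<omega>: "\<omega> \<in> space M" for \<omega>
  proof -
    define S where "S = {t. Y t \<omega> \<in> {a<..b} \<and> t > 0}"
    have diam: "t - d \<le> s" if "s \<in> S" "t \<in> S" for s t
    proof (cases "s \<le> t")
      case True
      have "\<delta> * (t - s) \<le> b - a"
        using Y_increment[OF \<omega> True] that by (auto simp: S_def)
      then show ?thesis using delta_pos by (simp add: d_def field_simps)
    qed (use d in simp)
    have sub: "\<exists>c. S \<subseteq> {c..c + d}"
    proof (cases "S = {}")
      case False
      have bdd: "bdd_below S" by (rule bdd_belowI[of _ 0]) (auto simp: S_def)
      have "t \<in> {Inf S..Inf S + d}" if "t \<in> S" for t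
        using cInf_lower[OF that bdd] cInf_greatest[OF False, of "t - d"] diam[OF _ that] by auto
      then show ?thesis by blast
    qed simp
    then obtain c where c: "S \<subseteq> {c..c + d}" by blast
    have "(\<integral>\<^sup>+t. ennreal (weight t) * indicator {a<..b} (Y t \<omega>) \<partial>lborel) \<le> (\<integral>\<^sup>+t. indicator {c..c + d} t \<partial>lborel)"
    proof (intro nn_integral_mono)
      fix t
      show "ennreal (weight t) * indicator {a<..b} (Y t \<omega>) \<le> indicator {c..c + d} t"
      proof (cases "t \<in> S")
        case True
        then have "weight t \<le> 1" using q_nonneg by (auto simp: weight_def S_def)
        then show ?thesis using True c by (auto simp: indicator_def)
      qed (auto simp: S_def weight_def indicator_def)
    qed
    also have "\<dots> = ennreal d" using d by simp
    finally show ?thesis .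
  qed
  then have "(\<integral>\<^sup>+\<omega>. (\<integral>\<^sup>+t. ennreal (weight t) * indicator {a<..b} (Y t \<omega>) \<partial>lborel) \<partial>M) \<le> (\<integral>\<^sup>+\<omega>. ennreal d \<partial>M)"
    by (rule nn_integral_mono)
  then have "emeasure U {a<..b} \<le> (\<integral>\<^sup>+\<omega>. ennreal d \<partial>M)"
    by (subst emeasure_U) (simp_all only: greaterThanAtMost_borel)
  then show ?thesis by (simp add: d_def emeasure_space_1)
qed

lemma emeasure_U_singleton: "emeasure U {x} = 0"
proof (rule ccontr)
  assume "emeasure U {x} \<noteq> 0"
  moreover have le: "emeasure U {x} \<le> ennreal e" if "e > 0" for e
  proof -
    have "emeasure U {x} \<le> emeasure U {x - \<delta> * e<..x}"
      using that delta_pos by (intro emeasure_mono) auto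
    also have "\<dots> \<le> ennreal ((x - (x - \<delta> * e)) / \<delta>)"
      using that delta_pos by (intro emeasure_U_Ioc_le) auto
    finally show ?thesis using delta_pos by simp
  qed
  moreover have "emeasure U {x} \<le> 0"
    by (rule ennreal_le_epsilon) (use le in auto)
  ultimately show False by simp
qed

lemma emeasure_U_nonpos: "emeasure U {..0} = 0"
proof -
  have "(\<integral>\<^sup>+t. ennreal (weight t) * indicator {..0} (Y t \<omega>) \<partial>lborel) = 0" if \<omega>: "\<omega> \<in> space M" for \<omega>
  proof -
    have "ennreal (weight t) * indicator {..0} (Y t \<omega>) = 0" for t
    proof (cases "t > 0")
      case True
      then have "0 < \<delta> * t" using delta_pos by simp
      then have "Y t \<omega> > 0" using Y_ge[OF \<omega>, of t] True by linarith
      then show ?thesis by simp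
    qed (simp add: weight_def)
    then show ?thesis by (simp only: nn_integral_const mult_zero_left)
  qed
  then have "(\<integral>\<^sup>+\<omega>. (\<integral>\<^sup>+t. ennreal (weight t) * indicator {..0} (Y t \<omega>) \<partial>lborel) \<partial>M) = (\<integral>\<^sup>+\<omega>. 0 \<partial>M)"
    by (intro nn_integral_cong) auto
  then show ?thesis by (simp add: emeasure_U)
qed

text \<open>Fubini reduces the transform to \<open>\<integral>e^(-q t) e^(-t \<phi>) dt\<close> over \<open>(0, \<infinity>)\<close>. The integrand is dominated by
  \<open>e^(-\<delta> t Re s)\<close> because \<open>Y_t \<ge> \<delta> t\<close>, so \<open>q = 0\<close> is covered.\<close>

lemma
  assumes s: "Re s > 0" and Re: "Re (of_real q + \<phi>) > 0"
    and lap: "\<And>t. t > 0 \<Longrightarrow> (LINT \<omega>|M. exp (- s * of_real (Y t \<omega>))) = exp (- of_real t * \<phi>)"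
  shows U_integrable: "integrable U (\<lambda>x. exp (- s * of_real x))"
    and U_laplace: "(LINT x|U. exp (- s * of_real x)) = 1 / (of_real q + \<phi>)"
proof -
  interpret P: pair_sigma_finite lborel M by unfold_locales
  define F where "F p = weight (fst p) *\<^sub>R exp (- s * of_real (Y (fst p) (snd p)))" for p
  have Fm [measurable]: "F \<in> borel_measurable (lborel \<Otimes>\<^sub>M M)" unfolding F_def by measurable
  define w where "w t = norm (indicator {0<..} t *\<^sub>R exp (- of_real (\<delta> * Re s) * complex_of_real t))" for t
  have w: "integrable lborel w"
    unfolding w_def using set_integrable_exp_minus[of "of_real (\<delta> * Re s)"] s delta_pos
    by (intro integrable_norm) (simp add: set_integrable_def)
  have Fw: "norm (F (t, \<omega>)) \<le> w t" if "\<omega> \<in> space M" for t \<omega>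
  proof (cases "t > 0")
    case True
    have "\<delta> * t * Re s \<le> Y t \<omega> * Re s"
      using Y_ge[OF that, of t] True s by (intro mult_right_mono) auto
    then have "exp (- q * t) * exp (- Re s * Y t \<omega>) \<le> 1 * exp (- (\<delta> * Re s) * t)"
      using True q_nonneg by (intro mult_mono) (auto simp: mult_ac)
    then show ?thesis using True by (simp add: F_def w_def weight_def)
  qed (simp add: F_def w_def weight_def)
  have intF: "integrable (lborel \<Otimes>\<^sub>M M) F"
  proof (rule P.Fubini_integrable[OF Fm])
    have iM: "integrable M (\<lambda>\<omega>. F (t, \<omega>))" for t
      by (rule integrable_const_bound[where B = "w t"]) (use Fw in auto)
    then show "AE t in lborel. integrable M (\<lambda>\<omega>. F (t, \<omega>))" by simp
    show "integrable lborel (\<lambda>t. LINT \<omega>|M. norm (F (t, \<omega>)))"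
    proof (rule Bochner_Integration.integrable_bound[OF w])
      show "AE t in lborel. norm (LINT \<omega>|M. norm (F (t, \<omega>))) \<le> norm (w t)"
      proof (intro AE_I2)
        fix t
        have "(LINT \<omega>|M. norm (F (t, \<omega>))) \<le> (LINT \<omega>|M. w t)"
          using Fw iM by (intro integral_mono) auto
        then show "norm (LINT \<omega>|M. norm (F (t, \<omega>))) \<le> norm (w t)"
          by (simp add: prob_space abs_of_nonneg Bochner_Integration.integral_nonneg)
      qed
    qed measurable
  qed
  have intD: "integrable (density (lborel \<Otimes>\<^sub>M M) (\<lambda>p. ennreal (weight (fst p)))) (\<lambda>p. exp (- s * of_real (Y (fst p) (snd p))))"
    using intF[unfolded F_def[abs_def]] by (subst integrable_density) (auto simp: weight_nonneg)
  then show "integrable U (\<lambda>x. exp (- s * of_real x))"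
    unfolding U_def by (subst integrable_distr_eq) auto
  have "(LINT x|U. exp (- s * of_real x)) = (LINT p|density (lborel \<Otimes>\<^sub>M M) (\<lambda>p. ennreal (weight (fst p))). exp (- s * of_real (Y (fst p) (snd p))))"
    unfolding U_def by (subst integral_distr) auto
  also have "\<dots> = (LINT p|(lborel \<Otimes>\<^sub>M M). F p)"
    unfolding F_def[abs_def] by (subst integral_density) (auto simp: weight_nonneg)
  also have "\<dots> = (LINT t|lborel. LINT \<omega>|M. F (t, \<omega>))"
    by (rule P.integral_fst'[OF intF, symmetric])
  also have "\<dots> = (LINT t:{0<..}|lborel. exp (- (of_real q + \<phi>) * of_real t))"
    unfolding set_lebesgue_integral_def
  proof (intro Bochner_Integration.integral_cong refl)
    fix t :: real
    show "(LINT \<omega>|M. F (t, \<omega>)) = indicator {0<..} t *\<^sub>R exp (- (of_real q + \<phi>) * of_real t)"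
    proof (cases "t > 0")
      case True
      have "(LINT \<omega>|M. F (t, \<omega>)) = weight t *\<^sub>R exp (- of_real t * \<phi>)"
        unfolding F_def fst_conv snd_conv integral_scaleR_right using lap[OF True] by simp
      then show ?thesis using True
        by (simp add: weight_def scaleR_conv_of_real algebra_simps flip: exp_of_real exp_add)
    qed (simp add: F_def weight_def)
  qed
  also have "\<dots> = 1 / (of_real q + \<phi>)"
    by (rule integral_exp_minus_Ioi[OF Re])
  finally show "(LINT x|U. exp (- s * of_real x)) = 1 / (of_real q + \<phi>)" .
qed

text \<open>The outer integral ignores a null set of outcomes even when its integrand is not measurable, and the
  time \<open>0\<close> is negligible. So the set function that defines the potential measure is a measure.\<close>

lemma potential_measure_eq_U:
  assumes "AE \<omega> in M. \<forall>t\<ge>0. X t \<omega> = Y t \<omega>"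
  shows "potential_measure M X q = U"
proof -
  have "(\<integral>\<^sup>+\<omega>. (\<integral>\<^sup>+t\<in>{0..}. ennreal (exp (- q * t)) * indicator B (X t \<omega>) \<partial>lborel) \<partial>M) = emeasure U B"
    if "B \<in> sets borel" for B
    unfolding emeasure_U[OF that]
  proof (rule nn_integral_cong_AE)
    show "AE \<omega> in M. (\<integral>\<^sup>+t\<in>{0..}. ennreal (exp (- q * t)) * indicator B (X t \<omega>) \<partial>lborel) =
        (\<integral>\<^sup>+t. ennreal (weight t) * indicator B (Y t \<omega>) \<partial>lborel)"
      using assms
    proof eventually_elim
      case (elim \<omega>)
      have "AE t in lborel. t \<noteq> (0::real)" by (auto intro!: AE_I[where N = "{0}"])
      then show ?case
        by (intro nn_integral_cong_AE) (use elim in \<open>auto elim!: eventually_mono simp: weight_def indicator_def\<close>)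
    qed
  qed
  then have "potential_measure M X q = measure_of UNIV (sets borel) (emeasure U)"
    unfolding potential_measure_def by (intro measure_of_eq) (auto simp: sets.sigma_sets_eq[of borel, simplified])
  also have "\<dots> = U" using measure_of_of_measure[of U] by simp
  finally show ?thesis .
qed

end

text \<open>On the exceptional null set, and at negative times, the path is replaced by the pure drift
  \<open>t \<mapsto> \<delta> t\<close>, which has all the required properties.\<close>

lemma subordinator_regular_version:
  assumes sub: "subordinator M X" and drift: "has_drift_and_levy_measure M X \<delta> \<nu>"
    and "\<delta> > 0" "q \<ge> 0"
  obtains Y where "drift_increasing_process M Y \<delta> q" "AE \<omega> in M. \<forall>t\<ge>0. X t \<omega> = Y t \<omega>"
proof -
  have M: "prob_space M" and Xm: "\<And>t. t \<ge> 0 \<Longrightarrow> X t \<in> borel_measurable M"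
    using sub by (auto simp: subordinator_def levy_process_def)
  obtain Z where Z: "Z \<in> sets M" "emeasure M Z = 0"
    and good: "\<And>\<omega>. \<omega> \<in> space M \<Longrightarrow> \<omega> \<notin> Z \<Longrightarrow> X 0 \<omega> = 0 \<and>
      (\<forall>t\<ge>0. ((\<lambda>s. X s \<omega>) \<longlongrightarrow> X t \<omega>) (at_right t)) \<and>
      (\<forall>s>0. jump (\<lambda>t. X t \<omega>) s \<ge> 0) \<and>
      (\<forall>t\<ge>0. (jump (\<lambda>s. X s \<omega>) has_sum (X t \<omega> - \<delta> * t)) {0<..t})"
    using subordinator_AE_paths[OF sub drift] by (elim AE_E) blast
  define Y where "Y t \<omega> = (if t \<ge> 0 \<and> \<omega> \<notin> Z then X t \<omega> else \<delta> * t)" for t \<omega>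
  have incr0: "\<delta> * (t - s) \<le> X t \<omega> - X s \<omega>" if "\<omega> \<in> space M" "\<omega> \<notin> Z" "0 \<le> s" "s \<le> t" for \<omega> s t
    using good[OF that(1,2)] that by (intro drift_path_increment_ge) auto
  show ?thesis
  proof
    have "AE \<omega> in M. \<omega> \<notin> Z" using Z by (intro AE_I[where N = Z]) auto
    then show "AE \<omega> in M. \<forall>t\<ge>0. X t \<omega> = Y t \<omega>"
      by eventually_elim (auto simp: Y_def)
    show "drift_increasing_process M Y \<delta> q"
    proof (intro drift_increasing_process.intro M drift_increasing_process_axioms.intro)
      show "Y t \<in> borel_measurable M" for t
      proof (cases "t \<ge> 0")
        case True
        note [measurable] = Xm[OF True] Z(1)
        show ?thesis unfolding Y_def using True by simp
      qed (simp add: Y_def[abs_def])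
      fix t \<omega> assume \<omega>: "\<omega> \<in> space M"
      show "((\<lambda>s. Y s \<omega>) \<longlongrightarrow> Y t \<omega>) (at_right t)"
      proof (cases "t \<ge> 0 \<and> \<omega> \<notin> Z")
        case True
        have "\<forall>\<^sub>F s in at_right t. X s \<omega> = Y s \<omega>"
          using eventually_at_right_less[of t] by eventually_elim (use True in \<open>auto simp: Y_def\<close>)
        moreover have "((\<lambda>s. X s \<omega>) \<longlongrightarrow> Y t \<omega>) (at_right t)"
          using good[OF \<omega>] True by (simp add: Y_def)
        ultimately show ?thesis by (rule Lim_transform_eventually[rotated])
      next
        case False
        have "\<forall>\<^sub>F s in at_right t. \<delta> * s = Y s \<omega>"
        proof (cases "\<omega> \<in> Z")
          case False
          with \<open>\<not> (t \<ge> 0 \<and> \<omega> \<notin> Z)\<close> have "t < 0" by simp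
          then show ?thesis by (intro eventually_at_rightI[of t 0]) (auto simp: Y_def)
        qed (simp add: Y_def)
        moreover have "((\<lambda>s. \<delta> * s) \<longlongrightarrow> Y t \<omega>) (at_right t)"
          using False by (auto simp: Y_def intro!: tendsto_intros)
        ultimately show ?thesis by (rule Lim_transform_eventually[rotated])
      qed
      show "Y 0 \<omega> = 0" using good[OF \<omega>] by (simp add: Y_def)
      fix s assume "s \<le> t"
      have X0: "\<omega> \<notin> Z \<Longrightarrow> X 0 \<omega> = 0" using good[OF \<omega>] by simp
      show "\<delta> * (t - s) \<le> Y t \<omega> - Y s \<omega>"
        using incr0[OF \<omega>, of s t] incr0[OF \<omega>, of 0 t] X0 \<open>s \<le> t\<close>
        by (auto simp: Y_def algebra_simps)
    qed (use assms in auto)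
  qed
qed

section \<open>The potential density\<close>

lemma measure_eqI_Ioc:
  fixes A B :: "real measure"
  assumes "sets A = sets borel" "sets B = sets borel"
    and eq: "\<And>a b. a < b \<Longrightarrow> emeasure A {a<..b} = emeasure B {a<..b}"
    and fin: "\<And>a b. a < b \<Longrightarrow> emeasure A {a<..b} < \<infinity>"
  shows "A = B"
proof (rule measure_eqI_generator_eq)
  let ?E = "range (\<lambda>(a, b). {a<..b::real})"
  show "Int_stable ?E"
    by (auto simp: Int_stable_def Int_greaterThanAtMost)
  show "sets A = sigma_sets UNIV ?E" "sets B = sigma_sets UNIV ?E"
    using assms by (simp_all add: borel_sigma_sets_Ioc)
  show "emeasure A X = emeasure B X" if E: "X \<in> ?E" for X
  proof -
    obtain a b where X: "X = {a<..b}" using E by auto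
    show ?thesis using eq[of a b] unfolding X by (cases "a < b") auto
  qed
  show "range (\<lambda>n. {- real (Suc n)<..real (Suc n)}) \<subseteq> ?E" by auto
  have "x \<in> (\<Union>n. {- real (Suc n)<..real (Suc n)})" for x
  proof -
    obtain n where "\<bar>x\<bar> < real n" using reals_Archimedean2 by blast
    then show ?thesis by (intro UN_I[of n]) auto
  qed
  then show "(\<Union>n. {- real (Suc n)<..real (Suc n)}) = UNIV" by blast
  show "emeasure A {- real (Suc n)<..real (Suc n)} \<noteq> \<infinity>" for n
    using fin[of "- real (Suc n)" "real (Suc n)"] by simp
qed auto

text \<open>Two densities of the same measure agree almost everywhere, hence everywhere on \<open>(0, \<infinity>)\<close> if they are
  continuous there. So the definite description in the definition is uniquely satisfied.\<close>

lemma potential_density_eqI: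
  assumes u: "\<And>x. x \<le> 0 \<Longrightarrow> u x = 0" "\<And>x. 0 \<le> u x" "continuous_on {0<..} u" "bounded (range u)"
    and U: "potential_measure M X q = density lborel (\<lambda>x. ennreal (u x))"
  shows "potential_density M X q = u"
  unfolding potential_density_def
proof (rule the_equality)
  fix v assume v: "(\<forall>x\<le>0. v x = 0) \<and> (\<forall>x. 0 \<le> v x) \<and> continuous_on {0<..} v \<and> bounded (range v) \<and>
             potential_measure M X q = density lborel (\<lambda>x. ennreal (v x))"
  have meas: "w \<in> borel_measurable borel" if "\<And>x. x \<le> 0 \<Longrightarrow> w x = 0" "continuous_on {0<..} w" for w :: "real \<Rightarrow> real"
  proof -
    have "w = (\<lambda>x. indicator {0<..} x *\<^sub>R w x)" using that(1) by (auto simp: indicator_def fun_eq_iff)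
    then show ?thesis
      using borel_measurable_continuous_on_indicator[OF _ that(2)] by simp
  qed
  have [measurable]: "u \<in> borel_measurable borel" "v \<in> borel_measurable borel"
    using meas u v by auto
  have "density lborel (\<lambda>x. ennreal (u x)) = density lborel (\<lambda>x. ennreal (v x))"
    using U v by simp
  then have "AE x in lborel. ennreal (u x) = ennreal (v x)"
    by (subst (asm) sigma_finite_measure.density_unique_iff[OF sigma_finite_lborel]) auto
  then have ae: "AE x in lborel. u x = v x"
    using u v by (simp add: ennreal_inj)
  have AE_eq_imp_le: "w x - w' x \<le> 0" if "continuous_on {0<..} w" "continuous_on {0<..} w'" "AE x in lborel. w x = w' x" "x > 0"
      and [measurable]: "w \<in> borel_measurable borel" "w' \<in> borel_measurable borel"
    for w w' :: "real \<Rightarrow> real" and x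
  proof (rule continuous_le_if_integral_le[OF continuous_on_diff[OF that(1,2)] _ that(4)])
    fix a b :: real
    have "(LINT x:{a<..b}|lborel. w x - w' x) = 0"
      unfolding set_lebesgue_integral_def
      by (rule integral_eq_zero_AE) (use that(3) in \<open>auto elim!: eventually_mono\<close>)
    then show "(LINT x:{a<..b}|lborel. w x - w' x) \<le> 0 * (b - a)" by simp
  qed
  have ae': "AE x in lborel. v x = u x" using ae by eventually_elim simp
  have "v x = u x" if "x > 0" for x
    using AE_eq_imp_le[OF _ _ ae that] AE_eq_imp_le[OF _ _ ae' that] u v by auto
  then show "v = u" using u v by (metis linorder_not_le ext)
qed (use assms in auto)

context drift_increasing_process
begin

text \<open>The transform \<open>G\<close> on the line is that of the difference of the finite measures
  \<open>A = e^(-l x) U(dx)\<close> and \<open>B = e^(-l x) dx / \<delta>\<close> on the half-line, so \<open>A\<close> is \<open>B\<close> plus a continuous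
  density \<open>h\<close>. This yields a continuous density of \<open>U\<close> on \<open>(0, \<infinity>)\<close>. That it is nonnegative and bounded is read
  off from \<open>U\<close>: integrals of the density over intervals are values of \<open>U\<close>, which lie between \<open>0\<close> and
  \<open>(b - a) / \<delta>\<close>.\<close>

lemma potential_density_inversion:
  assumes X: "AE \<omega> in M. \<forall>t\<ge>0. X t \<omega> = Y t \<omega>" and l: "l > 0"
    and \<phi>: "\<And>\<theta>. Re (of_real q + \<phi> (Complex l \<theta>)) > 0"
    and lap: "\<And>t \<theta>. t > 0 \<Longrightarrow> (LINT \<omega>|M. exp (- Complex l \<theta> * of_real (Y t \<omega>))) = exp (- of_real t * \<phi> (Complex l \<theta>))"
    and G: "\<And>\<theta>. G \<theta> = 1 / (of_real q + \<phi> (Complex l \<theta>)) - 1 / (of_real \<delta> * Complex l \<theta>)"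
    and intG: "integrable lborel G" and x: "x > 0"
  shows "complex_of_real (potential_density M X q x) =
    of_real (1 / \<delta>) + of_real (exp (l * x)) * (1 / (2 * of_real pi)) * (LINT \<theta>|lborel. iexp (\<theta> * x) * G \<theta>)"
proof -
  define h where "h x = 1 / (2 * complex_of_real pi) * (LINT \<theta>|lborel. iexp (\<theta> * x) * G \<theta>)" for x
  have hc: "continuous_on S h" for S
    unfolding h_def by (intro continuous_intros continuous_on_subset[OF continuous_inverse_fourier[OF intG]]) auto
  define A where "A = density U (\<lambda>x. ennreal (exp (- l * x)))"
  define r where "r x = indicator {0<..} x * exp (- l * x) / \<delta>" for x
  define B where "B = density lborel (\<lambda>x. ennreal (r x))"
  have [measurable]: "r \<in> borel_measurable borel" unfolding r_def by measurable
  have r0: "r x \<ge> 0" for x using delta_pos by (simp add: r_def)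
  have expU: "integrable U (\<lambda>x. exp (- Complex l \<theta> * of_real x))"
    and lapU: "(LINT x|U. exp (- Complex l \<theta> * of_real x)) = 1 / (of_real q + \<phi> (Complex l \<theta>))" for \<theta>
    using U_integrable[OF _ \<phi> lap, of \<theta>] U_laplace[OF _ \<phi> lap, of \<theta>] l by auto
  have iexp_split: "exp (- Complex l \<theta> * of_real x) = of_real (exp (- l * x)) * iexp (- (\<theta> * x))" for \<theta> x
    by (simp add: Complex_eq algebra_simps flip: exp_of_real exp_add)
  have intU: "integrable U (\<lambda>x. exp (- l * x))"
    using integrable_norm[OF expU[of 0]] by (simp add: iexp_split norm_mult)
  have setsA: "sets A = sets borel" and setsB: "sets B = sets borel" by (simp_all add: A_def B_def)
  have finA: "finite_measure A"
  proof (rule finite_measureI)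
    show "emeasure A (space A) \<noteq> \<infinity>"
      using intU unfolding A_def by (simp add: emeasure_density nn_integral_eq_integral)
  qed
  have intr: "integrable lborel r"
  proof -
    have "integrable lborel (\<lambda>x. norm (indicator {0<..} x *\<^sub>R exp (- of_real l * complex_of_real x)) / \<delta>)"
      using set_integrable_exp_minus[of "of_real l"] l unfolding set_integrable_def
      by (intro integrable_norm integrable_divide) simp
    then show ?thesis by (simp add: r_def[abs_def])
  qed
  have intr_ind: "set_integrable lborel S r" if "S \<in> sets borel" for S
    unfolding set_integrable_def using intr that by (intro integrable_mult_indicator) auto
  have emB: "emeasure B S = ennreal (LINT x:S|lborel. r x)" if [measurable]: "S \<in> sets borel" for S
  proof -
    have "emeasure B S = (\<integral>\<^sup>+x. ennreal (indicator S x *\<^sub>R r x) \<partial>lborel)"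
      unfolding B_def by (subst emeasure_density) (auto intro!: nn_integral_cong split: split_indicator)
    then show ?thesis unfolding set_lebesgue_integral_def
      using intr_ind[OF that] r0 by (simp add: nn_integral_eq_integral set_integrable_def)
  qed
  have mB: "measure B S = (LINT x:S|lborel. r x)" if "S \<in> sets borel" for S
    unfolding measure_def using emB[OF that] r0
    by (simp add: set_lebesgue_integral_def Bochner_Integration.integral_nonneg)
  have finB: "finite_measure B"
    by (rule finite_measureI) (simp add: emB space_density B_def[THEN arg_cong[where f = space]])
  have atomA: "measure A {y} = 0" for y
  proof -
    have "{y} \<in> null_sets U" using emeasure_U_singleton by auto
    then have "{y} \<in> null_sets A"
      unfolding A_def by (subst null_sets_density_iff) (auto simp: null_sets_def intro!: AE_I[where N = "{y}"])
    then show ?thesis by (auto simp: measure_def)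
  qed
  have atomB: "measure B {y} = 0" for y
  proof -
    have "AE x in lborel. x \<noteq> y" by (auto intro!: AE_I[where N = "{y}"])
    then have "(LINT x:{y}|lborel. r x) = 0"
      unfolding set_lebesgue_integral_def by (intro integral_eq_zero_AE) (auto elim!: eventually_mono)
    then show ?thesis by (simp add: mB)
  qed
  have G_AB: "G \<theta> = (CLINT x|A. iexp (- (\<theta> * x))) - (CLINT x|B. iexp (- (\<theta> * x)))" for \<theta>
  proof -
    have "(CLINT x|A. iexp (- (\<theta> * x))) = (LINT x|U. exp (- Complex l \<theta> * of_real x))"
      unfolding A_def iexp_split by (subst integral_density) (auto simp: scaleR_conv_of_real)
    moreover have "(CLINT x|B. iexp (- (\<theta> * x))) = (LINT x|lborel. (indicator {0<..} x *\<^sub>R exp (- Complex l \<theta> * of_real x)) / of_real \<delta>)"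
      unfolding B_def iexp_split using r0
      by (subst integral_density) (auto simp: r_def scaleR_conv_of_real mult_ac intro!: Bochner_Integration.integral_cong)
    moreover have "\<dots> = 1 / Complex l \<theta> / of_real \<delta>"
      using integral_exp_minus_Ioi[of "Complex l \<theta>"] l
      by (subst integral_divide_zero) (simp add: set_lebesgue_integral_def)
    ultimately show ?thesis unfolding G lapU by (simp add: mult.commute)
  qed
  have inv: "complex_of_real (measure A {a<..b} - measure B {a<..b}) = (CLBINT x:{a<..b}. h x)" if "a \<le> b" for a b
    unfolding h_def using fourier_inversion_difference[OF finA setsA atomA finB setsB atomB G_AB intG that] by simp
  have ih: "set_integrable lborel {a<..b} h" for a b
    by (rule set_integrable_subset[of _ "{a..b}"]) (auto intro!: borel_integrable_atLeastAtMost' hc)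
  have ihR: "set_integrable lborel {a<..b} (\<lambda>x. Re (h x))" for a b
    by (rule set_integrable_subset[of _ "{a..b}"]) (auto intro!: borel_integrable_atLeastAtMost' continuous_on_Re hc)
  have ihRc: "set_integrable lborel {a<..b} (\<lambda>x. complex_of_real (Re (h x)))" for a b
    by (rule set_integrable_subset[of _ "{a..b}"])
      (auto intro!: borel_integrable_atLeastAtMost' continuous_on_of_real continuous_on_Re hc)
  have Re_h: "(LINT x:{a<..b}|lborel. Re (h x)) = measure A {a<..b} - measure B {a<..b}" if "a \<le> b" for a b
  proof -
    have "(LINT x:{a<..b}|lborel. Re (h x)) = Re (CLBINT x:{a<..b}. h x)"
      using integral_Re[OF ih[of a b, unfolded set_integrable_def]] by (simp add: set_lebesgue_integral_def)
    then show ?thesis by (simp flip: inv[OF that])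
  qed
  (* The inversion integral is complex, but its integrals over intervals are differences of masses. *)
  have h_real: "h x = of_real (Re (h x))" if "x > 0" for x
  proof -
    have "h x - of_real (Re (h x)) = 0"
    proof (rule continuous_eq_zero_if_integral_eq_zero[OF _ _ that])
      show "continuous_on {0<..} (\<lambda>x. h x - of_real (Re (h x)))"
        by (intro continuous_on_diff continuous_on_of_real continuous_on_Re hc)
      fix a b :: real assume ab: "0 < a" "a < b"
      have "(CLBINT x:{a<..b}. complex_of_real (Re (h x))) = of_real (LINT x:{a<..b}|lborel. Re (h x))"
        by (rule set_integral_complex_of_real)
      also have "\<dots> = (CLBINT x:{a<..b}. h x)"
        using ab by (simp only: Re_h inv less_imp_le)
      finally show "(CLBINT x:{a<..b}. h x - of_real (Re (h x))) = 0"
        using ih[of a b] ihRc[of a b] by (simp add: set_integral_diff)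
    qed
    then show ?thesis by simp
  qed
  define w where "w x = exp (- l * x) / \<delta> + Re (h x)" for x
  have wc: "continuous_on S w" for S
    unfolding w_def by (intro continuous_intros hc) (use delta_pos in auto)
  have [measurable]: "w \<in> borel_measurable borel"
    by (intro borel_measurable_continuous_onI wc)
  have w_int: "(LINT x:{a<..b}|lborel. w x) = measure A {a<..b}" if "0 \<le> a" "a \<le> b" for a b
  proof -
    have "(LINT x:{a<..b}|lborel. w x) = (LINT x:{a<..b}|lborel. r x + Re (h x))"
      by (rule set_lebesgue_integral_cong) (use that in \<open>auto simp: w_def r_def\<close>)
    also have "\<dots> = measure A {a<..b}"
      using intr_ind[of "{a<..b}"] ihR[of a b] by (simp add: set_integral_add Re_h[OF that(2)] mB)
    finally show ?thesis .
  qed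
  have iw: "set_integrable lborel {a<..b} w" for a b
    by (rule set_integrable_subset[of _ "{a..b}"]) (auto intro!: borel_integrable_atLeastAtMost' wc)
  have w0: "w x \<ge> 0" if "x > 0" for x
  proof -
    have "- w x \<le> 0"
    proof (rule continuous_le_if_integral_le[OF continuous_on_minus[OF wc] _ that])
      fix a b :: real assume "0 < a" "a < b"
      then show "(LINT x:{a<..b}|lborel. - w x) \<le> 0 * (b - a)"
        using w_int[of a b] by (simp add: set_lebesgue_integral_def)
    qed
    then show ?thesis by simp
  qed
  define w' where "w' x = indicator {0<..} x * w x" for x
  have [measurable]: "w' \<in> borel_measurable borel" unfolding w'_def by measurable
  have w'0: "w' x \<ge> 0" for x using w0 by (auto simp: w'_def indicator_def)
  have A_eq: "A = density lborel (\<lambda>x. ennreal (w' x))"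
  proof (rule measure_eqI_Ioc)
    interpret A: finite_measure A by (rule finA)
    show "emeasure A {a<..b} < \<infinity>" for a b by (simp add: A.emeasure_eq_measure)
    fix a b :: real assume "a < b"
    have Apos: "AE x in A. x > 0"
    proof -
      have "AE x in U. x > 0"
        by (rule AE_I[where N = "{..0}"]) (auto simp: emeasure_U_nonpos)
      then show ?thesis unfolding A_def by (subst AE_density) auto
    qed
    (* w represents A only to the right of 0, and A does not charge the left half-line. *)
    define c where "c = max a 0"
    show "emeasure A {a<..b} = emeasure (density lborel (\<lambda>x. ennreal (w' x))) {a<..b}"
    proof (cases "c \<le> b")
      case True
      have "emeasure A {a<..b} = emeasure A {c<..b}"
        by (rule emeasure_eq_AE) (use Apos setsA in \<open>auto simp: c_def elim!: eventually_mono\<close>)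
      also have "\<dots> = ennreal (LINT x:{c<..b}|lborel. w x)"
        using w_int[of c b] True by (simp add: A.emeasure_eq_measure c_def)
      also have "\<dots> = (\<integral>\<^sup>+x. ennreal (indicator {c<..b} x *\<^sub>R w x) \<partial>lborel)"
        unfolding set_lebesgue_integral_def
        by (rule nn_integral_eq_integral[symmetric])
          (use iw[of c b] w0 in \<open>auto simp: set_integrable_def c_def split: split_indicator\<close>)
      also have "\<dots> = emeasure (density lborel (\<lambda>x. ennreal (w' x))) {a<..b}"
        by (subst emeasure_density) (auto simp: w'_def c_def intro!: nn_integral_cong split: split_indicator)
      finally show ?thesis .
    next
      case False
      then have b: "b \<le> 0" using \<open>a < b\<close> by (auto simp: c_def)
      have "emeasure A {a<..b} = emeasure A {}"
        by (rule emeasure_eq_AE) (use Apos setsA b in \<open>auto elim!: eventually_mono\<close>)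
      also have "\<dots> = (\<integral>\<^sup>+x. 0 \<partial>(lborel :: real measure))" by simp
      also have "\<dots> = (\<integral>\<^sup>+x. ennreal (w' x) * indicator {a<..b} x \<partial>lborel)"
        by (rule nn_integral_cong) (use b in \<open>auto simp: w'_def split: split_indicator\<close>)
      also have "\<dots> = emeasure (density lborel (\<lambda>x. ennreal (w' x))) {a<..b}"
        by (rule emeasure_density[symmetric]) auto
      finally show ?thesis .
    qed
  qed (simp_all add: setsA)
  define u where "u x = exp (l * x) * w' x" for x
  have [measurable]: "u \<in> borel_measurable borel" unfolding u_def by measurable
  have u0: "u x \<ge> 0" for x using w'0 by (simp add: u_def)
  have uc: "continuous_on {0<..} u"
  proof -
    have "continuous_on {0<..} (\<lambda>x. exp (l * x) * w x)" by (intro continuous_intros wc)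
    then show ?thesis by (rule continuous_on_eq) (auto simp: u_def w'_def)
  qed
  have U_eq: "U = density lborel (\<lambda>x. ennreal (u x))"
  proof -
    have "U = density U (\<lambda>x. ennreal (exp (- l * x)) * ennreal (exp (l * x)))"
      by (simp add: density_1 flip: ennreal_mult exp_add)
    also have "\<dots> = density A (\<lambda>x. ennreal (exp (l * x)))"
      unfolding A_def by (rule density_density_eq[symmetric]) auto
    also have "\<dots> = density lborel (\<lambda>x. ennreal (w' x) * ennreal (exp (l * x)))"
      unfolding A_eq by (rule density_density_eq) auto
    also have "\<dots> = density lborel (\<lambda>x. ennreal (u x))"
      using w'0 by (simp add: u_def mult.commute flip: ennreal_mult)
    finally show ?thesis .
  qed
  have ule: "u x \<le> 1 / \<delta>" if "x > 0" for x
  proof (rule continuous_le_if_integral_le[OF uc _ that])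
    fix a b :: real assume ab: "0 < a" "a < b"
    have iu: "set_integrable lborel {a<..b} u"
      by (rule set_integrable_subset[of _ "{a..b}"])
        (use ab in \<open>auto intro!: borel_integrable_atLeastAtMost' intro: continuous_on_subset[OF uc]\<close>)
    have "ennreal (LINT x:{a<..b}|lborel. u x) = (\<integral>\<^sup>+x. ennreal (indicator {a<..b} x *\<^sub>R u x) \<partial>lborel)"
      unfolding set_lebesgue_integral_def
      by (rule nn_integral_eq_integral[symmetric]) (use iu u0 in \<open>auto simp: set_integrable_def\<close>)
    also have "\<dots> = emeasure U {a<..b}"
      unfolding U_eq by (subst emeasure_density) (auto intro!: nn_integral_cong split: split_indicator)
    also have "\<dots> \<le> ennreal ((b - a) / \<delta>)" using ab by (intro emeasure_U_Ioc_le) auto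
    finally show "(LINT x:{a<..b}|lborel. u x) \<le> 1 / \<delta> * (b - a)"
      using ab delta_pos by (subst (asm) ennreal_le_iff) auto
  qed
  have "potential_density M X q = u"
  proof (rule potential_density_eqI)
    show u_neg: "u x = 0" if "x \<le> 0" for x using that by (simp add: u_def w'_def)
    show "bounded (range u)"
    proof (rule boundedI)
      fix y assume "y \<in> range u"
      then obtain x where y: "y = u x" by auto
      show "norm y \<le> 1 / \<delta>"
        using ule[of x] u_neg[of x] u0[of x] delta_pos unfolding y by (cases "x > 0") auto
    qed
    show "potential_measure M X q = density lborel (\<lambda>x. ennreal (u x))"
      using potential_measure_eq_U[OF X] U_eq by simp
  qed (use u0 uc in auto)
  then have "complex_of_real (potential_density M X q x) = of_real (exp (l * x) * w x)"
    using x by (simp add: u_def w'_def)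
  also have "\<dots> = of_real (exp (l * x) * exp (- l * x) / \<delta>) + of_real (exp (l * x)) * of_real (Re (h x))"
    by (simp add: w_def algebra_simps)
  also have "\<dots> = of_real (1 / \<delta>) + of_real (exp (l * x)) * h x"
    unfolding h_real[OF x, symmetric] by (simp flip: exp_add)
  finally show ?thesis unfolding h_def by (simp only: mult.assoc)
qed

end

lemma laplace_summable_tail_plus:
  assumes \<nu>: "levy_measure \<nu>" and "q \<ge> 0" "l > 0"
  shows "laplace_summable l (tail_plus \<nu> q)"
proof -
  have "integrable lborel (\<lambda>x. norm (indicator {0<..} x *\<^sub>R (exp (- of_real l * of_real x) * complex_of_real (tail_plus \<nu> q x))))"
    using laplace_tail_integrable[OF \<nu>, of "of_real l" q] assms
    by (intro integrable_norm) (simp add: set_integrable_def)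
  also have "(\<lambda>x. norm (indicator {0<..} x *\<^sub>R (exp (- of_real l * of_real x) * complex_of_real (tail_plus \<nu> q x))))
     = (\<lambda>x. exp (- l * x) * tail_plus \<nu> q x)"
    using assms by (auto simp: tail_plus_def norm_mult indicator_def simp del: of_real_add)
  finally show ?thesis
    using assms tail_plus_measurable[OF \<nu>] by (auto simp: laplace_summable_def tail_plus_def)
qed

theorem proposition2:
  fixes M :: "'a measure" and X :: "real \<Rightarrow> 'a \<Rightarrow> real"
    and \<nu> :: "real measure" and \<delta> q :: real
  assumes "subordinator M X"
    and "has_drift_and_levy_measure M X \<delta> \<nu>"
    and "\<delta> > 0"
    and "blumenthal_getoor \<nu> < 1"
    and "q \<ge> 0"
  shows "\<forall>N\<ge>1. \<forall>l>0.
    (\<forall>\<theta>. set_integrable lborel {0<..}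
            (\<lambda>x. exp (- Complex l \<theta> * of_real x) * of_real (tail_plus \<nu> q x)) \<and>
         Complex l \<theta> * of_real \<delta> ^ (N + 1) *
            (1 + 1 / of_real \<delta> * laplace (tail_plus \<nu> q) (Complex l \<theta>)) \<noteq> 0) \<and>
    integrable lborel (\<lambda>\<theta>. remainder_transform \<nu> \<delta> N q (Complex l \<theta>)) \<and>
    (\<forall>x>0. complex_of_real (potential_density M X q x) =
       of_real (\<Sum>n<N. (- 1) ^ n / \<delta> ^ (n + 1) * heaviside_convol_power (tail_plus \<nu> q) n x) +
       of_real (exp (l * x)) * (1 / (2 * of_real pi)) *
         (LINT \<theta>|lborel. exp (\<i> * of_real \<theta> * of_real x) *
            remainder_transform \<nu> \<delta> N q (Complex l \<theta>)))"
proof (intro allI impI)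
  fix N :: nat and l :: real assume N: "N \<ge> 1" and l: "l > 0"
  have \<nu>: "levy_measure \<nu>" using assms(2) by (simp add: has_drift_and_levy_measure_def)
  let ?L = "\<lambda>\<theta>. laplace (tail_plus \<nu> q) (Complex l \<theta>)"
  let ?f = "tail_plus \<nu> q"
  have nz: "Complex l \<theta> * (of_real \<delta> + ?L \<theta>) \<noteq> 0" for \<theta>
    using resolvent_nonzero[OF \<nu>, of "Complex l \<theta>" \<delta> q] assms l by simp
  have nz': "Complex l \<theta> * of_real \<delta> ^ (N + 1) * (1 + 1 / of_real \<delta> * ?L \<theta>) \<noteq> 0" for \<theta>
  proof -
    have "Complex l \<theta> * of_real \<delta> ^ (N + 1) * (1 + 1 / of_real \<delta> * ?L \<theta>) = of_real \<delta> ^ N * (Complex l \<theta> * (of_real \<delta> + ?L \<theta>))"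
      using assms by (simp add: field_simps)
    also have "\<dots> \<noteq> 0" using nz[of \<theta>] assms by simp
    finally show ?thesis .
  qed
  define g where "g n = (\<lambda>\<theta>. remainder_transform \<nu> \<delta> n q (Complex l \<theta>))" for n
  define h where "h n x = of_real (exp (l * x)) * (1 / (2 * complex_of_real pi)) * (LINT \<theta>|lborel. iexp (\<theta> * x) * g n \<theta>)" for n x
  have g_int: "integrable lborel (g n)" if "n \<ge> 1" for n
    unfolding g_def using integrable_remainder_transform[OF \<nu> assms(4,3,5) l that] .
  have f: "laplace_summable l ?f" using laplace_summable_tail_plus[OF \<nu> assms(5) l] .
  obtain Y where Y: "drift_increasing_process M Y \<delta> q" and XY: "AE \<omega> in M. \<forall>t\<ge>0. X t \<omega> = Y t \<omega>"
    using subordinator_regular_version[OF assms(1,2,3,5)] by blast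
  interpret drift_increasing_process M Y \<delta> q by (rule Y)
  have order_one: "complex_of_real (potential_density M X q x) = of_real (1 / \<delta>) + h 1 x" if "x > 0" for x
    unfolding h_def
  proof (rule potential_density_inversion[OF XY l _ _ _ g_int that])
    fix \<theta> :: real
    have "0 < \<delta> * l" using assms l by simp
    also have "\<dots> \<le> Re (of_real q + laplace_exponent \<nu> \<delta> (Complex l \<theta>))"
      using Re_laplace_exponent_ge[OF \<nu>, of "Complex l \<theta>" \<delta>] assms l by simp
    finally show "0 < Re (of_real q + laplace_exponent \<nu> \<delta> (Complex l \<theta>))" .
    have resolvent: "of_real q + laplace_exponent \<nu> \<delta> (Complex l \<theta>) = Complex l \<theta> * (of_real \<delta> + ?L \<theta>)"
      using assms l by (subst laplace_tail_exponent[OF \<nu>]) auto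
    have "(- L) ^ 1 / (s * d ^ 1 * (d + L)) = 1 / (s * (d + L)) - 1 / (d * s)"
      if "s \<noteq> 0" "d \<noteq> 0" "d + L \<noteq> 0" for s d L :: complex
      using that by (simp add: divide_simps)
    from this[of "Complex l \<theta>" "of_real \<delta>" "?L \<theta>"]
    show "g 1 \<theta> = 1 / (of_real q + laplace_exponent \<nu> \<delta> (Complex l \<theta>)) - 1 / (of_real \<delta> * Complex l \<theta>)"
      unfolding g_def remainder_transform_eq[OF assms(3)] resolvent using nz[of \<theta>] assms by simp
    show "(LINT \<omega>|M. exp (- Complex l \<theta> * of_real (Y t \<omega>))) = exp (- of_real t * laplace_exponent \<nu> \<delta> (Complex l \<theta>))"
      if "t > 0" for t
    proof -
      have "(LINT \<omega>|M. exp (- Complex l \<theta> * of_real (Y t \<omega>))) = (LINT \<omega>|M. exp (- Complex l \<theta> * of_real (X t \<omega>)))"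
      proof (rule integral_cong_AE)
        show "AE \<omega> in M. exp (- Complex l \<theta> * of_real (Y t \<omega>)) = exp (- Complex l \<theta> * of_real (X t \<omega>))"
          using XY by eventually_elim (use that in simp)
        have [measurable]: "X t \<in> borel_measurable M"
          using assms(1) that by (auto simp: subordinator_def levy_process_def)
        show "(\<lambda>\<omega>. exp (- Complex l \<theta> * of_real (X t \<omega>))) \<in> borel_measurable M" by measurable
      qed measurable
      then show ?thesis
        using subordinator_laplace[OF assms(1,2), of t "Complex l \<theta>"] assms that l by simp
    qed
  qed simp
  (* g n - g (Suc n) is the transform of the n-th convolution term. *)
  have raise_order: "h n x = of_real ((- 1) ^ n / \<delta> ^ (n + 1) * heaviside_convol_power ?f n x) + h (Suc n) x"
    if n: "n \<ge> 1" and x: "x > 0" for n x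
  proof -
    define k where "k = heaviside_convol_power ?f n"
    have lk: "laplace k (Complex l \<theta>) = ?L \<theta> ^ n / Complex l \<theta>" for \<theta>
      unfolding k_def by (rule laplace_heaviside_convol_power[OF f l n]) simp
    have ik: "integrable lborel (\<lambda>\<theta>. laplace k (Complex l \<theta>))"
      unfolding lk using integrable_laplace_tail_power[OF \<nu> assms(4,5) l n] .
    have kx: "complex_of_real (k x) = of_real (exp (l * x)) * (1 / (2 * of_real pi)) * (LINT \<theta>|lborel. iexp (\<theta> * x) * laplace k (Complex l \<theta>))"
      using laplace_inversion_pointwise[OF _ _ ik x]
        laplace_summable_heaviside_convol_power[OF f l n] continuous_heaviside_convol_power[OF f l n]
      by (simp add: k_def)
    define c where "c = complex_of_real ((- 1) ^ n / \<delta> ^ (n + 1))"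
    have g_split: "iexp (\<theta> * x) * g n \<theta> = c * (iexp (\<theta> * x) * laplace k (Complex l \<theta>)) + iexp (\<theta> * x) * g (Suc n) \<theta>" for \<theta>
    proof -
      define s L where "s = Complex l \<theta>" and "L = laplace ?f s"
      have s: "s \<noteq> 0" "of_real \<delta> + L \<noteq> 0" using nz[of \<theta>] by (auto simp: s_def L_def)
      have "(- L) ^ n / (s * of_real \<delta> ^ n * (of_real \<delta> + L)) =
          c * (L ^ n / s) + (- L) ^ Suc n / (s * of_real \<delta> ^ Suc n * (of_real \<delta> + L))"
      proof -
        have "(- L) ^ n / (s * of_real \<delta> ^ n * (of_real \<delta> + L)) - (- L) ^ Suc n / (s * of_real \<delta> ^ Suc n * (of_real \<delta> + L))
           = (- L) ^ n * (of_real \<delta> + L) / (s * of_real \<delta> ^ Suc n * (of_real \<delta> + L))"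
          using s assms by (simp add: divide_simps) (simp add: algebra_simps)
        also have "\<dots> = (- L) ^ n / (s * of_real \<delta> ^ Suc n)" using s by simp
        also have "\<dots> = c * (L ^ n / s)"
          by (simp add: c_def power_minus[of L] mult_ac)
        finally show ?thesis by (simp add: algebra_simps)
      qed
      then have "g n \<theta> = c * laplace k (Complex l \<theta>) + g (Suc n) \<theta>"
        by (simp only: g_def lk remainder_transform_eq[OF assms(3)] s_def L_def)
      then show ?thesis by (simp only: ring_distribs mult.left_commute)
    qed
    have i: "integrable lborel (\<lambda>\<theta>. iexp (\<theta> * x) * G \<theta>)" if "integrable lborel G" for G
      by (rule Bochner_Integration.integrable_bound[OF that]) (use that in \<open>auto simp: norm_mult\<close>)
    have "(LINT \<theta>|lborel. iexp (\<theta> * x) * g n \<theta>) =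
        c * (LINT \<theta>|lborel. iexp (\<theta> * x) * laplace k (Complex l \<theta>)) + (LINT \<theta>|lborel. iexp (\<theta> * x) * g (Suc n) \<theta>)"
      unfolding g_split
    proof (subst Bochner_Integration.integral_add)
      show "integrable lborel (\<lambda>\<theta>. c * (iexp (\<theta> * x) * laplace k (Complex l \<theta>)))"
        by (intro integrable_mult_right i ik)
      show "integrable lborel (\<lambda>\<theta>. iexp (\<theta> * x) * g (Suc n) \<theta>)"
        by (intro i g_int) simp
    qed (simp only: integral_mult_right_zero)
    then have "h n x = c * of_real (k x) + h (Suc n) x"
      unfolding h_def kx by (simp add: algebra_simps)
    then show ?thesis by (simp add: c_def k_def)
  qed
  have main: "complex_of_real (potential_density M X q x) =
       of_real (\<Sum>n<m. (- 1) ^ n / \<delta> ^ (n + 1) * heaviside_convol_power ?f n x) + h m x"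
    if x: "x > 0" and m: "m \<ge> 1" for x m
    using m
  proof (induction m rule: dec_induct)
    case base
    then show ?case using \<open>x > 0\<close> by (simp add: order_one heaviside_convol_power_def)
  next
    case (step m)
    show ?case using step(3) raise_order[OF step(1) x] by simp
  qed
  show "(\<forall>\<theta>. set_integrable lborel {0<..}
            (\<lambda>x. exp (- Complex l \<theta> * of_real x) * of_real (tail_plus \<nu> q x)) \<and>
         Complex l \<theta> * of_real \<delta> ^ (N + 1) *
            (1 + 1 / of_real \<delta> * laplace (tail_plus \<nu> q) (Complex l \<theta>)) \<noteq> 0) \<and>
    integrable lborel (\<lambda>\<theta>. remainder_transform \<nu> \<delta> N q (Complex l \<theta>)) \<and>
    (\<forall>x>0. complex_of_real (potential_density M X q x) =
       of_real (\<Sum>n<N. (- 1) ^ n / \<delta> ^ (n + 1) * heaviside_convol_power (tail_plus \<nu> q) n x) +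
       of_real (exp (l * x)) * (1 / (2 * of_real pi)) *
         (LINT \<theta>|lborel. exp (\<i> * of_real \<theta> * of_real x) *
            remainder_transform \<nu> \<delta> N q (Complex l \<theta>)))"
  proof (intro conjI allI impI)
    show "set_integrable lborel {0<..} (\<lambda>x. exp (- Complex l \<theta> * of_real x) * of_real (tail_plus \<nu> q x))" for \<theta>
      using laplace_tail_integrable[OF \<nu>, of "Complex l \<theta>" q] l by simp
    show "integrable lborel (\<lambda>\<theta>. remainder_transform \<nu> \<delta> N q (Complex l \<theta>))"
      using g_int[OF N] by (simp add: g_def)
    fix x :: real assume "x > 0"
    from main[OF this N] show "complex_of_real (potential_density M X q x) =
       of_real (\<Sum>n<N. (- 1) ^ n / \<delta> ^ (n + 1) * heaviside_convol_power (tail_plus \<nu> q) n x) +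
       of_real (exp (l * x)) * (1 / (2 * of_real pi)) *
         (LINT \<theta>|lborel. exp (\<i> * of_real \<theta> * of_real x) *
            remainder_transform \<nu> \<delta> N q (Complex l \<theta>))"
      by (simp add: h_def g_def mult.assoc)
  qed (rule nz')
qed

end
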